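(* Let $\mu\vdash n-1$ and $L\subseteq\mu^\uparrow$. Let $\pi_L:=\bigoplus_{\lambda\in L}\pi_\lambda$ act on $V_L:=\bigoplus_{\lambda\in L}V_\lambda$, of dimension $d_L:=\sum_{\lambda\in L}d_\lambda$. Let $W_L\le V_L$ be the image of the isometry $\Psi_L\colon V_\mu\to V_L$, $\Psi_L(v)=\{\sqrt{d_\lambda/d_L}\,\Psi_{\lambda,\mu}(v)\}_{\lambda\in L}$. Choose any $t_1,\dots,t_n\in S_n$ with $t_k(n)=k$ for each $k$. Then $\mathcal{W}_L:=\{\pi_L(t_k)W_L\}_{k\in[n]}$ is a totally symmetric real equi-chordal tight fusion frame of $n$ subspaces of dimension $d_\mu$ in $V_L$ (dimension $d_L$). Furthermore, $\mathcal{W}_L$ is equi-isoclinic if and only if there exists $\beta\ge0$ such that \[\sum_{\lambda\in L}\frac{d_\lambda}{n d_\mu}\cdot\frac{1}{D(\lambda-\mu,(k,l))}\in\{\beta,-\beta\}\qquad\text{for all }(k,l)\in\lfloor\mu\rfloor,\] in which case $\frac{n^2d_\mu^2}{d_L^2}\beta^2$ is the common isoclinism parameter of $\mathcal{W}_L$ and $\beta=\sqrt{\frac{d_L(nd_\mu-d_L)}{d_\mu^2n^2(n-1)}}$.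
   Context: Partitions $\lambda\vdash n$ are nonincreasing sequences of positive integers summing to $n$; the Young diagram has boxes $(i,j)$ with $j\le\lambda_i$. Axial distance between boxes: $D((i,j),(k,l)):=(j-i)-(l-k)$. A standard tableau of shape $\lambda$ fills boxes bijectively with $1,\dots,n$ increasing along rows and down columns; $\operatorname{Tab}(\lambda)$ is their set and $d_\lambda:=|\operatorname{Tab}(\lambda)|$. $S_n$ acts on tableaux by $(gT)_{ij}=g(T_{ij})$; $D_T(a,b)$ is the axial distance from the box containing $a$ to the box containing $b$. $V_\lambda$ is the real Hilbert space with orthonormal basis $\{v_T\}_{T\in\operatorname{Tab}(\lambda)}$, and $\pi_\lambda\colon S_n\to\operatorname{U}(V_\lambda)$ (Young's orthogonal form) is determined by $\pi_\lambda(s_k)v_T=\frac1{D_T(k+1,k)}v_T+\sqrt{1-\frac1{D_T(k+1,k)^2}}v_{s_kT}$, $s_k=(k\ k{+}1)$ (second term absent when $s_kT$ not standard). For $\mu\vdash n-1$, $\mu^\uparrow$ is the set of $\lambda\vdash n$ obtained by adding one box to the Young diagram of $\mu$, and $\lambda-\mu$ denotes that added box. A box of $\mu$ is removable if deleting it leaves a Young diagram; $\lfloor\mu\rfloor$ is the set of removable boxes. For $R\in\operatorname{Tab}(\mu)$ and $\lambda\in\mu^\uparrow$, $R^\lambda\in\operatorname{Tab}(\lambda)$ agrees with $R$ and has $n$ in box $\lambda-\mu$; $\Psi_{\lambda,\mu}\colon V_\mu\to V_\lambda$ is the isometry $v_R\mapsto v_{R^\lambda}$. An ensemble of $r$-dim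 subspaces $\{W_k\}$ with isometries $\Phi_k$ onto them is a tight fusion frame if the projections sum to a multiple of the identity, equi-chordal if $\|\Phi_k^*\Phi_\ell\|_F$ is constant over $k\ne\ell$, equi-isoclinic with parameter $\alpha$ if $(\Phi_k^*\Phi_\ell)^*(\Phi_k^*\Phi_\ell)=\alpha I$ for all $k\ne\ell$. Totally symmetric: for every permutation $\tau\in S_n$ there is a unitary $U$ with $UW_k=W_{\tau(k)}$ for all $k$. *)

theory Defs
  imports Complex_Main "HOL-Combinatorics.Permutations" "HOL-Library.Function_Algebras"
begin

text \<open>
  The real Hilbert space with orthonormal basis indexed by a finite set \<open>I\<close> is modelled by the
  functions \<open>'i \<Rightarrow> real\<close> vanishing outside \<open>I\<close>, and a linear map from the space over \<open>J\<close> to the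
  space over \<open>I\<close> by its matrix \<open>'i \<Rightarrow> 'j \<Rightarrow> real\<close>, which vanishes outside \<open>I \<times> J\<close>.  With this
  convention equality of vectors and of maps is equality in HOL.
\<close>

interpretation fvec: vector_space "\<lambda>(c::real) (x::'i \<Rightarrow> real) i. c * x i"
  by unfold_locales (auto simp: algebra_simps fun_eq_iff)

definition vecs :: "'i set \<Rightarrow> ('i \<Rightarrow> real) set" where
  "vecs I = {x. \<forall>i. i \<notin> I \<longrightarrow> x i = 0}"

definition mats :: "'i set \<Rightarrow> 'j set \<Rightarrow> ('i \<Rightarrow> 'j \<Rightarrow> real) set" where
  "mats I J = {A. \<forall>i j. i \<notin> I \<or> j \<notin> J \<longrightarrow> A i j = 0}"

definition unit_vect :: "'i \<Rightarrow> 'i \<Rightarrow> real" where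
  "unit_vect i = (\<lambda>j. if j = i then 1 else 0)"

definition id_matr :: "'i set \<Rightarrow> 'i \<Rightarrow> 'i \<Rightarrow> real" where
  "id_matr I = (\<lambda>i j. if i \<in> I \<and> i = j then 1 else 0)"

definition matr_mult :: "'j set \<Rightarrow> ('i \<Rightarrow> 'j \<Rightarrow> real) \<Rightarrow> ('j \<Rightarrow> 'k \<Rightarrow> real) \<Rightarrow> 'i \<Rightarrow> 'k \<Rightarrow> real" where
  "matr_mult J A B = (\<lambda>i k. \<Sum>j\<in>J. A i j * B j k)"

definition matr_app :: "'j set \<Rightarrow> ('i \<Rightarrow> 'j \<Rightarrow> real) \<Rightarrow> ('j \<Rightarrow> real) \<Rightarrow> 'i \<Rightarrow> real" where
  "matr_app J A x = (\<lambda>i. \<Sum>j\<in>J. A i j * x j)"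

definition adj :: "('i \<Rightarrow> 'j \<Rightarrow> real) \<Rightarrow> 'j \<Rightarrow> 'i \<Rightarrow> real" where
  "adj A = (\<lambda>j i. A i j)"

definition frobenius_norm :: "'i set \<Rightarrow> 'j set \<Rightarrow> ('i \<Rightarrow> 'j \<Rightarrow> real) \<Rightarrow> real" where
  "frobenius_norm I J A = sqrt (\<Sum>i\<in>I. \<Sum>j\<in>J. (A i j)\<^sup>2)"

definition isometry :: "'i set \<Rightarrow> 'j set \<Rightarrow> ('i \<Rightarrow> 'j \<Rightarrow> real) \<Rightarrow> bool" where
  "isometry I J A \<longleftrightarrow> A \<in> mats I J \<and> matr_mult I (adj A) A = id_matr J"

definition unitary_on :: "'i set \<Rightarrow> ('i \<Rightarrow> 'i \<Rightarrow> real) \<Rightarrow> bool" where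
  "unitary_on I U \<longleftrightarrow> U \<in> mats I I \<and>
     matr_mult I (adj U) U = id_matr I \<and> matr_mult I U (adj U) = id_matr I"

definition orth_projection :: "'i set \<Rightarrow> ('i \<Rightarrow> 'i \<Rightarrow> real) \<Rightarrow> ('i \<Rightarrow> real) set \<Rightarrow> bool" where
  "orth_projection I P W \<longleftrightarrow> P \<in> mats I I \<and> adj P = P \<and> matr_mult I P P = P \<and>
     matr_app I P ` vecs I = W"


definition subspace_ensemble ::
  "'i set \<Rightarrow> nat \<Rightarrow> 'k set \<Rightarrow> ('k \<Rightarrow> ('i \<Rightarrow> real) set) \<Rightarrow> bool" where
  "subspace_ensemble I r K W \<longleftrightarrow>
     (\<forall>k\<in>K. fvec.subspace (W k) \<and> W k \<subseteq> vecs I \<and> fvec.dim (W k) = r)"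

definition tight_fusion_frame ::
  "'i set \<Rightarrow> nat \<Rightarrow> 'k set \<Rightarrow> ('k \<Rightarrow> ('i \<Rightarrow> real) set) \<Rightarrow> bool" where
  "tight_fusion_frame I r K W \<longleftrightarrow> subspace_ensemble I r K W \<and>
     (\<exists>P c. (\<forall>k\<in>K. orth_projection I (P k) (W k)) \<and>
            (\<lambda>i j. \<Sum>k\<in>K. P k i j) = (\<lambda>i j. c * id_matr I i j))"

definition isometries_onto ::
  "'i set \<Rightarrow> nat \<Rightarrow> 'k set \<Rightarrow> ('k \<Rightarrow> ('i \<Rightarrow> real) set) \<Rightarrow> ('k \<Rightarrow> 'i \<Rightarrow> nat \<Rightarrow> real) \<Rightarrow> bool" where
  "isometries_onto I r K W \<Phi> \<longleftrightarrow>
     (\<forall>k\<in>K. isometry I {..<r} (\<Phi> k) \<and> matr_app {..<r} (\<Phi> k) ` vecs {..<r} = W k)"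

text \<open>
  The next two notions do not depend on the choice of the isometries, since two isometries onto the
  same subspace differ by an orthogonal \<open>r \<times> r\<close> matrix on the right.
\<close>

definition equi_chordal ::
  "'i set \<Rightarrow> nat \<Rightarrow> 'k set \<Rightarrow> ('k \<Rightarrow> ('i \<Rightarrow> real) set) \<Rightarrow> bool" where
  "equi_chordal I r K W \<longleftrightarrow>
     (\<exists>\<Phi> c. isometries_onto I r K W \<Phi> \<and>
        (\<forall>k\<in>K. \<forall>l\<in>K. k \<noteq> l \<longrightarrow>
           frobenius_norm {..<r} {..<r} (matr_mult I (adj (\<Phi> k)) (\<Phi> l)) = c))"

definition equi_isoclinic_with ::
  "'i set \<Rightarrow> nat \<Rightarrow> 'k set \<Rightarrow> ('k \<Rightarrow> ('i \<Rightarrow> real) set) \<Rightarrow> real \<Rightarrow> bool" where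
  "equi_isoclinic_with I r K W \<alpha> \<longleftrightarrow>
     (\<exists>\<Phi>. isometries_onto I r K W \<Phi> \<and>
        (\<forall>k\<in>K. \<forall>l\<in>K. k \<noteq> l \<longrightarrow>
           (let A = matr_mult I (adj (\<Phi> k)) (\<Phi> l)
            in matr_mult {..<r} (adj A) A = (\<lambda>i j. \<alpha> * id_matr {..<r} i j))))"

definition equi_isoclinic ::
  "'i set \<Rightarrow> nat \<Rightarrow> 'k set \<Rightarrow> ('k \<Rightarrow> ('i \<Rightarrow> real) set) \<Rightarrow> bool" where
  "equi_isoclinic I r K W \<longleftrightarrow> (\<exists>\<alpha>. equi_isoclinic_with I r K W \<alpha>)"

definition totally_symmetric ::
  "'i set \<Rightarrow> 'k set \<Rightarrow> ('k \<Rightarrow> ('i \<Rightarrow> real) set) \<Rightarrow> bool" where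
  "totally_symmetric I K W \<longleftrightarrow>
     (\<forall>\<tau>. \<tau> permutes K \<longrightarrow>
        (\<exists>U. unitary_on I U \<and> (\<forall>k\<in>K. matr_app I U ` W k = W (\<tau> k))))"


type_synonym box = "nat \<times> nat"
type_synonym tableau = "box \<Rightarrow> nat"

definition is_partition :: "nat list \<Rightarrow> nat \<Rightarrow> bool" where
  "is_partition lam n \<longleftrightarrow> sorted_wrt (\<ge>) lam \<and> (\<forall>p\<in>set lam. 0 < p) \<and> sum_list lam = n"

definition young_diagram :: "nat list \<Rightarrow> box set" where
  "young_diagram lam = {(i, j). 1 \<le> i \<and> i \<le> length lam \<and> 1 \<le> j \<and> j \<le> lam ! (i - 1)}"

fun axial_dist :: "box \<Rightarrow> box \<Rightarrow> int" where
  "axial_dist (i, j) (k, l) = (int j - int i) - (int l - int k)"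

text \<open>
  A tableau takes the value 0 outside its diagram.  Since a permutation of \<open>{1..n}\<close> fixes 0, the
  action of \<open>g\<close> on a tableau \<open>T\<close> is then simply \<open>g \<circ> T\<close>.
\<close>

definition Tab :: "nat list \<Rightarrow> tableau set" where
  "Tab lam = {T. (\<forall>b. b \<notin> young_diagram lam \<longrightarrow> T b = 0) \<and>
     bij_betw T (young_diagram lam) {1..sum_list lam} \<and>
     (\<forall>i j j'. (i, j) \<in> young_diagram lam \<and> (i, j') \<in> young_diagram lam \<and> j < j'
        \<longrightarrow> T (i, j) < T (i, j')) \<and>
     (\<forall>i i' j. (i, j) \<in> young_diagram lam \<and> (i', j) \<in> young_diagram lam \<and> i < i'
        \<longrightarrow> T (i, j) < T (i', j))}"

definition num_tab :: "nat list \<Rightarrow> nat" where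
  "num_tab lam = card (Tab lam)"

definition box_of :: "tableau \<Rightarrow> nat \<Rightarrow> box" where
  "box_of T a = (THE b. T b = a)"

definition tab_dist :: "tableau \<Rightarrow> nat \<Rightarrow> nat \<Rightarrow> int" where
  "tab_dist T a b = axial_dist (box_of T a) (box_of T b)"

definition is_young_orthogonal_form ::
  "nat list \<Rightarrow> ((nat \<Rightarrow> nat) \<Rightarrow> tableau \<Rightarrow> tableau \<Rightarrow> real) \<Rightarrow> bool" where
  "is_young_orthogonal_form lam \<rho> \<longleftrightarrow>
     (\<forall>g. g permutes {1..sum_list lam} \<longrightarrow> unitary_on (Tab lam) (\<rho> g)) \<and>
     (\<forall>g h. g permutes {1..sum_list lam} \<longrightarrow> h permutes {1..sum_list lam} \<longrightarrow>
        \<rho> (g \<circ> h) = matr_mult (Tab lam) (\<rho> g) (\<rho> h)) \<and>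
     (\<forall>k\<in>{1..<sum_list lam}. \<forall>T\<in>Tab lam.
        (let s = Transposition.transpose k (k + 1);
             D = real_of_int (tab_dist T (k + 1) k)
         in matr_app (Tab lam) (\<rho> s) (unit_vect T) =
              (\<lambda>S. 1 / D * unit_vect T S +
                   (if s \<circ> T \<in> Tab lam then sqrt (1 - 1 / D\<^sup>2) * unit_vect (s \<circ> T) S else 0))))"

text \<open>
  The conditions determine the matrices of all permutations of \<open>{1..n}\<close>, because the adjacent
  transpositions generate the symmetric group; the choice below only affects values at
  functions that are not such permutations.
\<close>

definition young_rep :: "nat list \<Rightarrow> (nat \<Rightarrow> nat) \<Rightarrow> tableau \<Rightarrow> tableau \<Rightarrow> real" where
  "young_rep lam = (SOME \<rho>. is_young_orthogonal_form lam \<rho>)"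


definition up_set :: "nat list \<Rightarrow> nat list set" where
  "up_set mu = {lam. is_partition lam (sum_list mu + 1) \<and>
     (\<exists>b. b \<notin> young_diagram mu \<and> young_diagram lam = insert b (young_diagram mu))}"

definition added_box :: "nat list \<Rightarrow> nat list \<Rightarrow> box" where
  "added_box lam mu = the_elem (young_diagram lam - young_diagram mu)"

definition removable_boxes :: "nat list \<Rightarrow> box set" where
  "removable_boxes mu = {b \<in> young_diagram mu.
     \<exists>nu m. is_partition nu m \<and> young_diagram nu = young_diagram mu - {b}}"

definition extend_tab :: "nat list \<Rightarrow> nat list \<Rightarrow> tableau \<Rightarrow> tableau" where
  "extend_tab lam mu R = R(added_box lam mu := sum_list lam)"

definition Psi :: "nat list \<Rightarrow> nat list \<Rightarrow> tableau \<Rightarrow> tableau \<Rightarrow> real" where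
  "Psi lam mu = (\<lambda>T R. if R \<in> Tab mu then unit_vect (extend_tab lam mu R) T else 0)"

text \<open>The external direct sum \<open>V\<^sub>L\<close> has the pairs \<open>(\<lambda>, T)\<close> as its basis.\<close>

definition basis_L :: "nat list set \<Rightarrow> (nat list \<times> tableau) set" where
  "basis_L L = (SIGMA lam:L. Tab lam)"

definition d_L :: "nat list set \<Rightarrow> nat" where
  "d_L L = (\<Sum>lam\<in>L. num_tab lam)"

definition pi_L ::
  "nat list set \<Rightarrow> (nat \<Rightarrow> nat) \<Rightarrow> nat list \<times> tableau \<Rightarrow> nat list \<times> tableau \<Rightarrow> real" where
  "pi_L L g = (\<lambda>(lam, T) (lam', T').
     if lam \<in> L \<and> lam = lam' then young_rep lam g T T' else 0)"

definition Psi_L :: "nat list set \<Rightarrow> nat list \<Rightarrow> nat list \<times> tableau \<Rightarrow> tableau \<Rightarrow> real" where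
  "Psi_L L mu = (\<lambda>(lam, T) R.
     if lam \<in> L then sqrt (real (num_tab lam) / real (d_L L)) * Psi lam mu T R else 0)"

definition W_L :: "nat list set \<Rightarrow> nat list \<Rightarrow> (nat list \<times> tableau \<Rightarrow> real) set" where
  "W_L L mu = matr_app (Tab mu) (Psi_L L mu) ` vecs (Tab mu)"

definition W_family ::
  "nat list set \<Rightarrow> nat list \<Rightarrow> (nat \<Rightarrow> nat \<Rightarrow> nat) \<Rightarrow> nat \<Rightarrow> (nat list \<times> tableau \<Rightarrow> real) set" where
  "W_family L mu t k = matr_app (basis_L L) (pi_L L (t k)) ` W_L L mu"

definition beta_condition :: "nat \<Rightarrow> nat list \<Rightarrow> nat list set \<Rightarrow> real \<Rightarrow> bool" where
  "beta_condition n mu L \<beta> \<longleftrightarrow>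
     (\<forall>b\<in>removable_boxes mu.
        (\<Sum>lam\<in>L. real (num_tab lam) / (real n * real (num_tab mu)) *
                    (1 / real_of_int (axial_dist (added_box lam mu) b))) \<in> {\<beta>, - \<beta>})"

end

theory Submission
  imports Defs
begin

text \<open>
  The adjacent transpositions act by Young's formulas, and the braid relation reduces to
  \<open>1/(ab) = 1/(a+b) (1/a + 1/b)\<close> for the differences of the contents of the boxes of
  \<open>k, k+1, k+2\<close>; since the Coxeter relations present \<open>S\<^sub>n\<close>, Young's orthogonal form exists.

  The map \<open>\<Psi>\<^sub>L\<close> intertwines the actions of \<open>S\<^sub>n\<^sub>-\<^sub>1\<close>, so \<open>W\<^sub>L\<close> is \<open>S\<^sub>n\<^sub>-\<^sub>1\<close>-invariant and the
  ensemble is permuted by \<open>\<pi>\<^sub>L\<close> exactly as \<open>S\<^sub>n\<close> permutes the cosets of \<open>S\<^sub>n\<^sub>-\<^sub>1\<close>.  The sum of the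
  projections commutes with \<open>\<pi>\<^sub>L\<close>.  A matrix commuting with all \<open>\<pi>\<^sub>L(s\<^sub>k)\<close> commutes with the diagonal
  matrices of contents (the Jucys--Murphy elements), whose joint eigenvalues separate the basis, so it
  is diagonal, and constant on every \<open>V\<^sub>\<lambda>\<close> because standard tableaux are connected by admissible
  transpositions; comparing traces shows that the constants agree.

  As \<open>S\<^sub>n\<close> has only two double cosets of \<open>S\<^sub>n\<^sub>-\<^sub>1\<close>, every cross-Gramian equals
  \<open>B = \<Psi>\<^sub>L\<^sup>* \<pi>\<^sub>L(s\<^sub>n\<^sub>-\<^sub>1) \<Psi>\<^sub>L\<close> up to unitary factors on both sides.  By Young's formula \<open>B\<close> is diagonal
  and its entry at \<open>R\<close> depends only on the removable box of \<open>R\<close> that contains \<open>n-1\<close>.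
\<close>

section \<open>Matrices over finite index sets\<close>

text \<open>\<open>young_rep\<close> is a choice by \<open>SOME\<close>, so nothing is known about
  it until some form is shown to exist. This is why the presentation of \<open>S_n\<close> is
  established: for self-maps of an arbitrary type, where composition is total, with matrices
  entering as operators that are the identity off their index set.

  Chordality and isoclinism are defined through isometries on \<open>vecs {..<r}\<close>, whereas
  the isometries at hand have columns indexed by tableaux. Isoclinism is therefore restated through
  the projections, which depend only on the subspaces.

  The scalars on the different \<open>V_\<lambda>\<close> agree because of the weights
  \<open>sqrt (d_\<lambda> / d_L)\<close>: they make the trace of each projection over the block of
  \<lambda> proportional to \<open>d_\<lambda>\<close>, the size of that block.

  The entry of \<open>B\<close> at a removable box is \<open>n d_\<mu> / d_L\<close> times the sum
  in the condition on \<beta>, and the isoclinism parameter is its square; hence the factor between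
  \<alpha> and the square of \<beta>. For \<open>n = 1\<close> there are neither pairs of subspaces
  nor removable boxes, every \<alpha> and \<beta> qualifies, and the formula for \<beta> is
  restricted to \<open>n \<ge> 2\<close>.\<close>

lemma matr_mult_assoc:
  assumes "finite J" "finite K"
  shows "matr_mult K (matr_mult J A B) C = matr_mult J A (matr_mult K B C)"
proof (intro ext)
  fix i l
  have "matr_mult K (matr_mult J A B) C i l = (\<Sum>k\<in>K. \<Sum>j\<in>J. A i j * B j k * C k l)"
    by (simp add: matr_mult_def sum_distrib_right)
  also have "\<dots> = (\<Sum>j\<in>J. \<Sum>k\<in>K. A i j * B j k * C k l)" by (rule sum.swap)
  also have "\<dots> = matr_mult J A (matr_mult K B C) i l"
    by (simp add: matr_mult_def sum_distrib_left mult.assoc)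
  finally show "matr_mult K (matr_mult J A B) C i l = matr_mult J A (matr_mult K B C) i l" .
qed

lemma matr_app_matr_mult:
  assumes "finite J" "finite K"
  shows "matr_app K (matr_mult J A B) x = matr_app J A (matr_app K B x)"
  using matr_mult_assoc[OF assms, of A B "\<lambda>k (_::unit). x k"]
  by (simp add: matr_mult_def matr_app_def fun_eq_iff)

lemma adj_adj [simp]: "adj (adj A) = A"
  by (simp add: adj_def)

lemma adj_matr_mult: "adj (matr_mult J A B) = matr_mult J (adj B) (adj A)"
  by (simp add: adj_def matr_mult_def mult.commute)

lemma adj_id_matr [simp]: "adj (id_matr I) = id_matr I"
  by (auto simp: adj_def id_matr_def fun_eq_iff)

lemma adj_in_mats: "A \<in> mats I J \<Longrightarrow> adj A \<in> mats J I"
  by (auto simp: mats_def adj_def)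

lemma id_matr_in_mats: "id_matr I \<in> mats I I"
  by (auto simp: mats_def id_matr_def)

lemma matr_mult_in_mats: "A \<in> mats I J \<Longrightarrow> B \<in> mats J K \<Longrightarrow> matr_mult J' A B \<in> mats I K"
  by (auto simp: mats_def matr_mult_def)

lemma matr_mult_id_left: "finite I \<Longrightarrow> A \<in> mats I J \<Longrightarrow> matr_mult I (id_matr I) A = A"
  by (intro ext, rename_tac i k, case_tac "i \<in> I")
    (auto simp: mats_def matr_mult_def id_matr_def if_distrib[of "\<lambda>x. x * _"] cong: if_cong)

lemma matr_mult_id_right: "finite J \<Longrightarrow> A \<in> mats I J \<Longrightarrow> matr_mult J A (id_matr J) = A"
  using matr_mult_id_left[of J "adj A" I]
  by (metis adj_adj adj_id_matr adj_in_mats adj_matr_mult)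

lemma matr_mult_scale_left: "matr_mult J (\<lambda>i j. c * A i j) B = (\<lambda>i k. c * matr_mult J A B i k)"
  by (simp add: matr_mult_def sum_distrib_left mult.assoc)

lemma matr_mult_scale_right: "matr_mult J A (\<lambda>j k. c * B j k) = (\<lambda>i k. c * matr_mult J A B i k)"
  by (simp add: matr_mult_def sum_distrib_left mult_ac)

lemma matr_mult_sum_left:
  "matr_mult J (\<lambda>i j. \<Sum>m\<in>K. A m i j) B = (\<lambda>i k. \<Sum>m\<in>K. matr_mult J (A m) B i k)"
  unfolding matr_mult_def sum_distrib_right by (intro ext) (rule sum.swap)

lemma matr_mult_sum_right:
  "matr_mult J A (\<lambda>j k. \<Sum>m\<in>K. B m j k) = (\<lambda>i k. \<Sum>m\<in>K. matr_mult J A (B m) i k)"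
  unfolding matr_mult_def sum_distrib_left by (intro ext) (rule sum.swap)

lemma matr_app_id: "finite I \<Longrightarrow> x \<in> vecs I \<Longrightarrow> matr_app I (id_matr I) x = x"
  using matr_mult_id_left[of I "\<lambda>i (_::unit). x i" UNIV]
  by (auto simp: mats_def vecs_def matr_app_def matr_mult_def fun_eq_iff)

lemma matr_app_in_vecs: "A \<in> mats I J \<Longrightarrow> matr_app J A x \<in> vecs I"
  by (auto simp: mats_def vecs_def matr_app_def)

lemma matr_app_unit_vect: "finite J \<Longrightarrow> j \<in> J \<Longrightarrow> matr_app J A (unit_vect j) = (\<lambda>i. A i j)"
  by (simp add: matr_app_def unit_vect_def if_distrib[of "\<lambda>x. _ * x"] cong: if_cong)

lemma unit_vect_in_vecs: "j \<in> J \<Longrightarrow> unit_vect j \<in> vecs J"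
  by (auto simp: unit_vect_def vecs_def)

lemma matr_eqI_app:
  assumes "finite J" "A \<in> mats I J" "B \<in> mats I J" "\<And>x. x \<in> vecs J \<Longrightarrow> matr_app J A x = matr_app J B x"
  shows "A = B"
proof (intro ext)
  fix i j
  show "A i j = B i j"
  proof (cases "j \<in> J")
    case True
    from assms(4)[OF unit_vect_in_vecs[OF True]] show ?thesis
      by (simp add: matr_app_unit_vect assms(1) True fun_eq_iff)
  qed (use assms(2,3) in \<open>auto simp: mats_def\<close>)
qed

section \<open>Orthogonal projections\<close>

lemma orth_projection_fixes:
  assumes "finite I" "orth_projection I P W" "x \<in> W"
  shows "matr_app I P x = x"
proof -
  from assms obtain y where "x = matr_app I P y" by (auto simp: orth_projection_def)
  with assms show ?thesis
    by (simp add: orth_projection_def flip: matr_app_matr_mult)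
qed

text \<open>\<open>P\<close> fixes the range of \<open>Q\<close>, so \<open>P Q = Q\<close>; the
  adjoint of this is \<open>Q P = Q\<close>, while exchanging the roles gives
  \<open>Q P = P\<close>. Hence choices of isometries or coset representatives disappear in the
  projection.\<close>

lemma orth_projection_unique:
  assumes I: "finite I" and P: "orth_projection I P W" and Q: "orth_projection I Q W"
  shows "P = Q"
proof -
  have absorb: "matr_mult I P Q = Q" if P: "orth_projection I P W" and Q: "orth_projection I Q W" for P Q
  proof (rule matr_eqI_app[OF I, of _ I])
    show "matr_mult I P Q \<in> mats I I" "Q \<in> mats I I"
      using P Q by (auto simp: orth_projection_def intro: matr_mult_in_mats)
    fix x assume "x \<in> vecs I"
    then have "matr_app I Q x \<in> W" using Q by (auto simp: orth_projection_def)
    then show "matr_app I (matr_mult I P Q) x = matr_app I Q x"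
      by (simp add: matr_app_matr_mult I orth_projection_fixes[OF I P])
  qed
  have "adj (matr_mult I P Q) = adj Q" by (simp add: absorb[OF P Q])
  then have "matr_mult I Q P = Q" using P Q by (simp add: adj_matr_mult orth_projection_def)
  with absorb[OF Q P] show ?thesis by simp
qed

lemma isometry_orth_projection:
  assumes I: "finite I" and J: "finite J" and A: "isometry I J A"
  shows "orth_projection I (matr_mult J A (adj A)) (matr_app J A ` vecs J)"
proof -
  have m: "A \<in> mats I J" "adj A \<in> mats J I" and iso: "matr_mult I (adj A) A = id_matr J"
    using A by (auto simp: isometry_def adj_in_mats)
  have "matr_mult I (matr_mult J A (adj A)) (matr_mult J A (adj A))
      = matr_mult J A (matr_mult J (matr_mult I (adj A) A) (adj A))"
    by (simp add: matr_mult_assoc I J)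
  also have "\<dots> = matr_mult J A (adj A)" by (simp add: iso matr_mult_id_left[OF J m(2)])
  finally have idem: "matr_mult I (matr_mult J A (adj A)) (matr_mult J A (adj A)) = matr_mult J A (adj A)" .
  have "matr_app J A x \<in> matr_app I (matr_mult J A (adj A)) ` vecs I" if "x \<in> vecs J" for x
  proof -
    have "matr_app I (matr_mult J A (adj A)) (matr_app J A x) = matr_app J A (matr_app J (matr_mult I (adj A) A) x)"
      by (simp add: matr_app_matr_mult I J)
    also have "\<dots> = matr_app J A x" by (simp add: iso matr_app_id J that)
    finally show ?thesis using matr_app_in_vecs[OF m(1), of x] by (metis imageI)
  qed
  moreover have "matr_app I (matr_mult J A (adj A)) x \<in> matr_app J A ` vecs J" for x
    using matr_app_in_vecs[OF m(2), of x] by (auto simp: matr_app_matr_mult I J)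
  ultimately have "matr_app I (matr_mult J A (adj A)) ` vecs I = matr_app J A ` vecs J" by auto
  with idem m show ?thesis
    by (auto simp: orth_projection_def adj_matr_mult intro: matr_mult_in_mats)
qed

lemma isometry_matr_mult:
  assumes "finite I" "finite J" "finite K" "isometry I J A" "isometry J K B"
  shows "isometry I K (matr_mult J A B)"
proof -
  have "matr_mult I (adj (matr_mult J A B)) (matr_mult J A B)
     = matr_mult J (adj B) (matr_mult J (matr_mult I (adj A) A) B)"
    using assms(1-3) by (simp add: adj_matr_mult matr_mult_assoc)
  also have "\<dots> = id_matr K"
    using assms matr_mult_id_left[of J B K] by (simp add: isometry_def)
  finally show ?thesis using assms by (auto simp: isometry_def intro: matr_mult_in_mats)
qed

lemma unitary_on_isometry: "unitary_on I U \<Longrightarrow> isometry I I U"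
  by (auto simp: unitary_on_def isometry_def)

lemma unitary_on_adj: "unitary_on I U \<Longrightarrow> unitary_on I (adj U)"
  by (auto simp: unitary_on_def adj_in_mats)

lemma unitary_on_image_vecs:
  assumes "finite I" "unitary_on I U"
  shows "matr_app I U ` vecs I = vecs I"
proof -
  have "x = matr_app I U (matr_app I (adj U) x)" if "x \<in> vecs I" for x
    using assms that by (simp add: unitary_on_def matr_app_id flip: matr_app_matr_mult)
  moreover have "matr_app I (adj U) x \<in> vecs I" "matr_app I U x \<in> vecs I" for x
    using assms by (auto simp: unitary_on_def intro!: matr_app_in_vecs adj_in_mats)
  ultimately show ?thesis by blast
qed

lemma id_isometry: "finite I \<Longrightarrow> isometry I I (id_matr I)"
  using matr_mult_id_left[OF _ id_matr_in_mats] by (simp add: isometry_def id_matr_in_mats)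

text \<open>Gives images of matrices the form of a span, so that the general theory of subspaces and
  dimension applies to them.\<close>

lemma image_vecs_eq_span_columns:
  assumes J: "finite J"
  shows "matr_app J A ` vecs J = fvec.span ((\<lambda>j i. A i j) ` J)"
proof
  \<comment> \<open>Sums of vectors are sums in the pointwise additive structure on functions; the
    induction evaluates such a sum at one index.\<close>
  have "(\<Sum>j\<in>J'. (\<lambda>i. x j * A i j)) i = (\<Sum>j\<in>J'. A i j * x j)" for x i J'
    by (induct J' rule: infinite_finite_induct) (auto simp: mult.commute)
  then have "matr_app J A x = (\<Sum>j\<in>J. (\<lambda>i. x j * A i j))" for x
    by (simp add: matr_app_def fun_eq_iff)
  then show "matr_app J A ` vecs J \<subseteq> fvec.span ((\<lambda>j i. A i j) ` J)"
    by (auto intro: fvec.span_sum[OF fvec.span_scale[OF fvec.span_base]])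
  have sub: "fvec.subspace (matr_app J A ` vecs J)"
  proof (rule fvec.subspaceI)
    have "(0::_ \<Rightarrow> real) \<in> vecs J" "matr_app J A 0 = 0"
      by (auto simp: vecs_def matr_app_def fun_eq_iff)
    then show "0 \<in> matr_app J A ` vecs J" by (metis imageI)
  next
    fix x y assume "x \<in> matr_app J A ` vecs J" "y \<in> matr_app J A ` vecs J"
    then obtain u v where uv: "x = matr_app J A u" "y = matr_app J A v" "u \<in> vecs J" "v \<in> vecs J" by auto
    then have "u + v \<in> vecs J" "x + y = matr_app J A (u + v)"
      by (auto simp: vecs_def matr_app_def fun_eq_iff algebra_simps sum.distrib)
    then show "x + y \<in> matr_app J A ` vecs J" by blast
  next
    fix c :: real and x assume "x \<in> matr_app J A ` vecs J"
    then obtain u where u: "x = matr_app J A u" "u \<in> vecs J" by auto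
    then have "(\<lambda>i. c * u i) \<in> vecs J" "(\<lambda>i. c * x i) = matr_app J A (\<lambda>i. c * u i)"
      by (auto simp: vecs_def matr_app_def fun_eq_iff sum_distrib_left mult_ac)
    then show "(\<lambda>i. c * x i) \<in> matr_app J A ` vecs J" by blast
  qed
  have "(\<lambda>i. A i j) \<in> matr_app J A ` vecs J" if "j \<in> J" for j
    using matr_app_unit_vect[OF J that, of A] unit_vect_in_vecs[OF that] by (metis imageI)
  then show "fvec.span ((\<lambda>j i. A i j) ` J) \<subseteq> matr_app J A ` vecs J"
    by (intro fvec.span_minimal sub) auto
qed

text \<open>The columns are orthonormal, hence distinct and independent, and they span the
  image.\<close>

lemma dim_image_isometry:
  assumes I: "finite I" and J: "finite J" and A: "isometry I J A"
  shows "fvec.dim (matr_app J A ` vecs J) = card J"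
proof -
  let ?col = "\<lambda>j i. A i j"
  have orth: "(\<Sum>i\<in>I. A i j * A i k) = (if j = k then 1 else 0)" if "j \<in> J" for j k
    using A that by (auto simp: isometry_def matr_mult_def adj_def id_matr_def fun_eq_iff)
  have inj: "inj_on ?col J"
  proof (rule inj_onI)
    fix j k assume jk: "j \<in> J" "k \<in> J" "?col j = ?col k"
    then have "(\<Sum>i\<in>I. A i j * A i k) = (\<Sum>i\<in>I. A i j * A i j)" by (metis (no_types))
    with orth[of j k] orth[of j j] jk show "j = k" by (auto split: if_splits)
  qed
  have "fvec.independent (?col ` J)"
  proof (rule fvec.independent_if_scalars_zero)
    show "finite (?col ` J)" using J by simp
    fix f x assume s: "(\<Sum>x\<in>?col ` J. (\<lambda>i. f x * x i)) = 0" and x: "x \<in> ?col ` J"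
    then obtain k where k: "k \<in> J" "x = ?col k" by auto
    have "(\<Sum>j\<in>J. (\<lambda>i. f (?col j) * A i j)) = 0" using s by (simp add: sum.reindex[OF inj])
    moreover have "(\<Sum>j\<in>J. (\<lambda>i. f (?col j) * A i j)) i = (\<Sum>j\<in>J. f (?col j) * A i j)" for i
      by (induct J rule: infinite_finite_induct) auto
    ultimately have z: "(\<Sum>j\<in>J. f (?col j) * A i j) = 0" for i by (metis zero_fun_apply)
    \<comment> \<open>Pairing the vanishing combination with column \<open>k\<close> isolates the
      coefficient at \<open>k\<close>.\<close>
    have "0 = (\<Sum>i\<in>I. A i k * (\<Sum>j\<in>J. f (?col j) * A i j))" by (simp add: z)
    also have "\<dots> = (\<Sum>j\<in>J. f (?col j) * (\<Sum>i\<in>I. A i k * A i j))"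
      unfolding sum_distrib_left by (subst sum.swap) (simp add: mult_ac)
    also have "\<dots> = f (?col k)" using k J by (simp add: orth if_distrib[of "\<lambda>x. _ * x"] cong: if_cong)
    finally show "f x = 0" using k by simp
  qed
  then have "fvec.dim (fvec.span (?col ` J)) = card (?col ` J)"
    by (simp add: fvec.dim_eq_card_independent)
  then show ?thesis
    by (simp add: image_vecs_eq_span_columns[OF J] card_image[OF inj])
qed

lemma dim_vecs:
  assumes "finite I"
  shows "fvec.dim (vecs I) = card I"
proof -
  have "matr_app I (id_matr I) ` vecs I = vecs I"
    using assms by (simp add: matr_app_id cong: image_cong)
  then show ?thesis using dim_image_isometry[OF assms assms id_isometry[OF assms]] by simp
qed

section \<open>Ensembles given by isometries with an arbitrary index set of columns\<close>

lemma subspace_ensemble_isometries: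
  assumes "finite I" "finite J" "\<And>k. k \<in> K \<Longrightarrow> isometry I J (\<Phi> k)"
  shows "subspace_ensemble I (card J) K (\<lambda>k. matr_app J (\<Phi> k) ` vecs J)"
proof -
  have "fvec.subspace (matr_app J (\<Phi> k) ` vecs J)" for k
    by (simp add: image_vecs_eq_span_columns assms(2) fvec.subspace_span)
  moreover have "matr_app J (\<Phi> k) ` vecs J \<subseteq> vecs I" if "k \<in> K" for k
    using assms(3)[OF that] by (auto simp: isometry_def intro: matr_app_in_vecs)
  ultimately show ?thesis using assms by (simp add: subspace_ensemble_def dim_image_isometry)
qed

text \<open>\<open>Q P Q = B (X\<^sup>* X) B\<^sup>*\<close>, and compressing by
  \<open>B\<^sup>*\<close> and \<open>B\<close> recovers \<open>X\<^sup>* X\<close>. The right-hand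
  side mentions neither the isometries nor their index sets.\<close>

lemma isoclinic_iff_projections:
  assumes I: "finite I" and J: "finite J" and K: "finite K"
    and A: "isometry I J A" and B: "isometry I K B"
  defines "P \<equiv> matr_mult J A (adj A)" and "Q \<equiv> matr_mult K B (adj B)"
    and "X \<equiv> matr_mult I (adj A) B"
  shows "matr_mult J (adj X) X = (\<lambda>i j. \<alpha> * id_matr K i j) \<longleftrightarrow>
    matr_mult I Q (matr_mult I P Q) = (\<lambda>i j. \<alpha> * Q i j)"
proof -
  let ?Y = "matr_mult J (adj X) X"
  have B': "B \<in> mats I K" "adj B \<in> mats K I" "matr_mult I (adj B) B = id_matr K"
    using B by (auto simp: isometry_def adj_in_mats)
  have A': "A \<in> mats I J" "adj A \<in> mats J I" using A by (auto simp: isometry_def adj_in_mats)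
  have Y: "?Y \<in> mats K K" using A' B'
    by (auto simp: X_def adj_matr_mult intro!: matr_mult_in_mats)
  have QPQ: "matr_mult I Q (matr_mult I P Q) = matr_mult K B (matr_mult K ?Y (adj B))"
    by (simp add: P_def Q_def X_def adj_matr_mult matr_mult_assoc I J K)
  show ?thesis
  proof
    assume "?Y = (\<lambda>i j. \<alpha> * id_matr K i j)"
    then show "matr_mult I Q (matr_mult I P Q) = (\<lambda>i j. \<alpha> * Q i j)"
      unfolding QPQ by (simp add: matr_mult_scale_left matr_mult_scale_right matr_mult_id_left[OF K B'(2)] Q_def)
  next
    assume "matr_mult I Q (matr_mult I P Q) = (\<lambda>i j. \<alpha> * Q i j)"
    then have *: "matr_mult I (adj B) (matr_mult I (matr_mult K B (matr_mult K ?Y (adj B))) B) =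
       matr_mult I (adj B) (matr_mult I (\<lambda>i j. \<alpha> * Q i j) B)"
      by (simp add: QPQ)
    have "matr_mult I (adj B) (matr_mult I (matr_mult K B (matr_mult K ?Y (adj B))) B) =
       matr_mult K (matr_mult I (adj B) B) (matr_mult K ?Y (matr_mult I (adj B) B))"
      by (simp only: matr_mult_assoc I J K)
    also have "\<dots> = ?Y" by (simp add: B'(3) matr_mult_id_left[OF K Y] matr_mult_id_right[OF K Y])
    finally have 1: "matr_mult I (adj B) (matr_mult I (matr_mult K B (matr_mult K ?Y (adj B))) B) = ?Y" .
    have "matr_mult I (adj B) (matr_mult I Q B) = matr_mult K (matr_mult I (adj B) B) (matr_mult I (adj B) B)"
      by (simp only: matr_mult_assoc I J K Q_def)
    also have "\<dots> = id_matr K" by (simp add: B'(3) matr_mult_id_left[OF K id_matr_in_mats])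
    finally show "?Y = (\<lambda>i j. \<alpha> * id_matr K i j)"
      using * 1 by (simp add: matr_mult_scale_left matr_mult_scale_right)
  qed
qed

text \<open>Bridges the gap between columns indexed by tableaux and the columns indexed by
  \<open>{..<r}\<close> in the definitions on ensembles.\<close>

lemma reindex_isometry:
  assumes J: "finite J" and e: "bij_betw e J' J" and A: "isometry I J A"
  defines "A' \<equiv> \<lambda>i m. if m \<in> J' then A i (e m) else 0"
  shows "isometry I J' A'" and "matr_app J' A' ` vecs J' = matr_app J A ` vecs J"
proof -
  have eJ: "e m \<in> J" if "m \<in> J'" for m using e that by (auto simp: bij_betw_def)
  have "matr_mult I (adj A) A = id_matr J" and m: "A \<in> mats I J" using A by (auto simp: isometry_def)
  then have "(\<Sum>i\<in>I. A i j * A i k) = (if j \<in> J \<and> j = k then 1 else 0)" for j k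
    by (auto simp: matr_mult_def adj_def id_matr_def fun_eq_iff)
  moreover have "e m = e m' \<longleftrightarrow> m = m'" if "m \<in> J'" "m' \<in> J'" for m m'
    using e that by (auto simp: bij_betw_def inj_on_def)
  ultimately have "(\<Sum>i\<in>I. A' i m * A' i m') = (if m \<in> J' \<and> m = m' then 1 else 0)" for m m'
    using eJ by (cases "m \<in> J'"; cases "m' \<in> J'") (auto simp: A'_def)
  moreover have "A' \<in> mats I J'" using m by (auto simp: mats_def A'_def)
  ultimately show "isometry I J' A'"
    by (auto simp: isometry_def matr_mult_def adj_def id_matr_def fun_eq_iff)
  have "finite J'" using J e bij_betw_finite by blast
  moreover have "(\<lambda>m i. A' i m) ` J' = (\<lambda>j i. A i j) ` (e ` J')"
    unfolding image_image by (intro image_cong) (auto simp: A'_def)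
  ultimately show "matr_app J' A' ` vecs J' = matr_app J A ` vecs J"
    using e by (simp add: image_vecs_eq_span_columns J bij_betw_def)
qed

lemma ex_isometries_onto:
  assumes J: "finite J" and \<Phi>: "\<And>k. k \<in> K \<Longrightarrow> isometry I J (\<Phi> k)"
  shows "\<exists>e. bij_betw e {..<card J} J \<and>
    isometries_onto I (card J) K (\<lambda>k. matr_app J (\<Phi> k) ` vecs J)
       (\<lambda>k i m. if m \<in> {..<card J} then \<Phi> k i (e m) else 0)"
proof -
  obtain e where e: "bij_betw e {..<card J} J"
    using ex_bij_betw_nat_finite[OF J] by (auto simp: atLeast0LessThan)
  with reindex_isometry[OF J e \<Phi>] show ?thesis
    unfolding isometries_onto_def by blast
qed

text \<open>The definition asks for one family of isometries; the reindexed one serves, because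
  relabelling rows and columns preserves the Frobenius norm.\<close>

lemma equi_chordal_isometries:
  assumes J: "finite J" and \<Phi>: "\<And>k. k \<in> K \<Longrightarrow> isometry I J (\<Phi> k)"
    and c: "\<And>k l. k \<in> K \<Longrightarrow> l \<in> K \<Longrightarrow> k \<noteq> l \<Longrightarrow>
       frobenius_norm J J (matr_mult I (adj (\<Phi> k)) (\<Phi> l)) = c"
  shows "equi_chordal I (card J) K (\<lambda>k. matr_app J (\<Phi> k) ` vecs J)"
proof -
  obtain e where e: "bij_betw e {..<card J} J" and
    iso: "isometries_onto I (card J) K (\<lambda>k. matr_app J (\<Phi> k) ` vecs J)
       (\<lambda>k i m. if m \<in> {..<card J} then \<Phi> k i (e m) else 0)" (is "isometries_onto _ _ _ _ ?\<Phi>'")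
    using ex_isometries_onto[where K = K and I = I and \<Phi> = \<Phi>, OF J \<Phi>] by blast
  have "frobenius_norm {..<card J} {..<card J} (matr_mult I (adj (?\<Phi>' k)) (?\<Phi>' l)) =
        frobenius_norm J J (matr_mult I (adj (\<Phi> k)) (\<Phi> l))" for k l
    unfolding frobenius_norm_def
    by (subst (2) sum.reindex_bij_betw[OF e, symmetric], subst sum.reindex_bij_betw[OF e, symmetric])
       (simp add: matr_mult_def adj_def)
  with c have "\<forall>k\<in>K. \<forall>l\<in>K. k \<noteq> l \<longrightarrow>
      frobenius_norm {..<card J} {..<card J} (matr_mult I (adj (?\<Phi>' k)) (?\<Phi>' l)) = c" by simp
  with iso show ?thesis unfolding equi_chordal_def by (intro exI conjI)
qed

text \<open>Unlike for chordality, an equivalence is wanted, so an unknown family \<Theta> with the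
  same images has to be compared with \<Phi>; the comparison goes through the common
  projections.\<close>

lemma equi_isoclinic_with_isometries:
  assumes I: "finite I" and J: "finite J" and \<Phi>: "\<And>k. k \<in> K \<Longrightarrow> isometry I J (\<Phi> k)"
  defines "X \<equiv> \<lambda>k l. matr_mult I (adj (\<Phi> k)) (\<Phi> l)"
  shows "equi_isoclinic_with I (card J) K (\<lambda>k. matr_app J (\<Phi> k) ` vecs J) \<alpha> \<longleftrightarrow>
    (\<forall>k\<in>K. \<forall>l\<in>K. k \<noteq> l \<longrightarrow> matr_mult J (adj (X k l)) (X k l) = (\<lambda>i j. \<alpha> * id_matr J i j))"
proof -
  let ?W = "\<lambda>k. matr_app J (\<Phi> k) ` vecs J" and ?r = "card J"
  have key: "(let A = matr_mult I (adj (\<Theta> k)) (\<Theta> l)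
            in matr_mult {..<?r} (adj A) A = (\<lambda>i j. \<alpha> * id_matr {..<?r} i j)) \<longleftrightarrow>
      matr_mult J (adj (X k l)) (X k l) = (\<lambda>i j. \<alpha> * id_matr J i j)"
    if "isometries_onto I ?r K ?W \<Theta>" "k \<in> K" "l \<in> K" for \<Theta> k l
  proof -
    have P: "matr_mult {..<?r} (\<Theta> k) (adj (\<Theta> k)) = matr_mult J (\<Phi> k) (adj (\<Phi> k))"
      if "k \<in> K" for k
      using isometry_orth_projection[OF I finite_lessThan, of ?r "\<Theta> k"]
        isometry_orth_projection[OF I J \<Phi>[OF that]] \<open>isometries_onto I ?r K ?W \<Theta>\<close> that
      by (intro orth_projection_unique[OF I, where W = "?W k"]) (auto simp: isometries_onto_def)
    have iso: "isometry I {..<?r} (\<Theta> k)" "isometry I {..<?r} (\<Theta> l)"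
      using that by (auto simp: isometries_onto_def)
    show ?thesis unfolding Let_def X_def
      unfolding isoclinic_iff_projections[OF I finite_lessThan finite_lessThan iso]
        isoclinic_iff_projections[OF I J J \<Phi>[OF that(2)] \<Phi>[OF that(3)]] P[OF that(2)] P[OF that(3)] ..
  qed
  obtain \<Theta> where \<Theta>: "isometries_onto I ?r K ?W \<Theta>"
    using ex_isometries_onto[where K = K and I = I and \<Phi> = \<Phi>, OF J \<Phi>] by blast
  show ?thesis unfolding equi_isoclinic_with_def
  proof (intro iffI ballI impI; (elim exE conjE)?)
    fix \<Theta> k l assume \<Theta>: "isometries_onto I ?r K ?W \<Theta>" and "k \<in> K" "l \<in> K" "k \<noteq> l"
      and *: "\<forall>k\<in>K. \<forall>l\<in>K. k \<noteq> l \<longrightarrow> (let A = matr_mult I (adj (\<Theta> k)) (\<Theta> l)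
            in matr_mult {..<?r} (adj A) A = (\<lambda>i j. \<alpha> * id_matr {..<?r} i j))"
    show "matr_mult J (adj (X k l)) (X k l) = (\<lambda>i j. \<alpha> * id_matr J i j)"
      using *[rule_format, OF \<open>k \<in> K\<close> \<open>l \<in> K\<close> \<open>k \<noteq> l\<close>]
      unfolding key[OF \<Theta> \<open>k \<in> K\<close> \<open>l \<in> K\<close>] .
  next
    assume *: "\<forall>k\<in>K. \<forall>l\<in>K. k \<noteq> l \<longrightarrow>
      matr_mult J (adj (X k l)) (X k l) = (\<lambda>i j. \<alpha> * id_matr J i j)"
    show "\<exists>\<Phi>. isometries_onto I ?r K ?W \<Phi> \<and> (\<forall>k\<in>K. \<forall>l\<in>K. k \<noteq> l \<longrightarrow>
        (let A = matr_mult I (adj (\<Phi> k)) (\<Phi> l)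
         in matr_mult {..<?r} (adj A) A = (\<lambda>i j. \<alpha> * id_matr {..<?r} i j)))"
    proof (intro exI[of _ \<Theta>] conjI \<Theta> ballI impI)
      fix k l assume "k \<in> K" "l \<in> K" "k \<noteq> l"
      then show "let A = matr_mult I (adj (\<Theta> k)) (\<Theta> l)
         in matr_mult {..<?r} (adj A) A = (\<lambda>i j. \<alpha> * id_matr {..<?r} i j)"
        unfolding key[OF \<Theta> \<open>k \<in> K\<close> \<open>l \<in> K\<close>] using * by blast
    qed
  qed
qed

section \<open>Unitary factors on either side\<close>

lemma unitary_on_matr_mult:
  assumes "finite I" "unitary_on I A" "unitary_on I B"
  shows "unitary_on I (matr_mult I A B)"
proof -
  have iso: "isometry I I (matr_mult I U V)" if "unitary_on I U" "unitary_on I V" for U V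
    using isometry_matr_mult[OF assms(1) assms(1) assms(1)] that unitary_on_isometry by blast
  from iso[OF assms(2,3)] iso[OF unitary_on_adj[OF assms(3)] unitary_on_adj[OF assms(2)]]
  show ?thesis by (simp add: unitary_on_def isometry_def adj_matr_mult)
qed

lemma unitary_on_id: "finite I \<Longrightarrow> unitary_on I (id_matr I)"
  using id_isometry by (simp add: unitary_on_def isometry_def)

lemma unitary_on_adj_eq_inverse:
  assumes I: "finite I" and U: "unitary_on I U" and V: "V \<in> mats I I" and UV: "matr_mult I U V = id_matr I"
  shows "adj U = V"
proof -
  have m: "adj U \<in> mats I I" using U by (auto simp: unitary_on_def adj_in_mats)
  have "adj U = matr_mult I (adj U) (matr_mult I U V)" by (simp add: UV matr_mult_id_right[OF I m])
  also have "\<dots> = matr_mult I (matr_mult I (adj U) U) V" by (simp only: matr_mult_assoc I)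
  also have "\<dots> = V" using U by (simp add: unitary_on_def matr_mult_id_left[OF I V])
  finally show ?thesis .
qed

lemma frobenius_norm_adj: "frobenius_norm J I (adj X) = frobenius_norm I J X"
  unfolding frobenius_norm_def adj_def by (subst sum.swap) simp

text \<open>The squared norm of \<open>Y\<close> is the trace of \<open>Y\<^sup>* Y\<close>, in
  which an isometry on the left cancels.\<close>

lemma frobenius_norm_isometry_left:
  assumes "finite I" "finite J" "finite K" "isometry I J U" "X \<in> mats J K"
  shows "frobenius_norm I K (matr_mult J U X) = frobenius_norm J K X"
proof -
  have tr: "(\<Sum>i\<in>I'. \<Sum>k\<in>K. (Y i k)\<^sup>2) = (\<Sum>k\<in>K. matr_mult I' (adj Y) Y k k)" for Y and I' :: "'z set"
    by (subst sum.swap) (simp add: matr_mult_def adj_def power2_eq_square)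
  have "matr_mult I (adj (matr_mult J U X)) (matr_mult J U X)
     = matr_mult J (adj X) (matr_mult J (matr_mult I (adj U) U) X)"
    using assms by (simp add: adj_matr_mult matr_mult_assoc)
  also have "\<dots> = matr_mult J (adj X) X"
    using assms matr_mult_id_left[OF assms(2,5)] by (simp add: isometry_def)
  finally show ?thesis unfolding frobenius_norm_def tr by simp
qed

lemma frobenius_norm_unitary:
  assumes J: "finite J" and U: "unitary_on J U" and V: "unitary_on J V" and X: "X \<in> mats J J"
  shows "frobenius_norm J J (matr_mult J U (matr_mult J X V)) = frobenius_norm J J X"
proof -
  have m: "matr_mult J X V \<in> mats J J" using X V by (auto simp: unitary_on_def intro: matr_mult_in_mats)
  have "frobenius_norm J J (matr_mult J U (matr_mult J X V)) = frobenius_norm J J (adj (matr_mult J X V))"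
    using frobenius_norm_isometry_left[OF J J J unitary_on_isometry[OF U] m] frobenius_norm_adj by metis
  also have "\<dots> = frobenius_norm J J X"
    using frobenius_norm_isometry_left[OF J J J unitary_on_isometry[OF unitary_on_adj[OF V]] adj_in_mats[OF X]]
    by (simp add: adj_matr_mult frobenius_norm_adj)
  finally show ?thesis .
qed

text \<open>\<open>Y\<^sup>* Y\<close> is \<open>X\<^sup>* X\<close> conjugated by \<open>V\<close>,
  and conjugation fixes scalar matrices.\<close>

lemma isoclinic_unitary:
  assumes J: "finite J" and U: "unitary_on J U" and V: "unitary_on J V" and X: "X \<in> mats J J"
  defines "Y \<equiv> matr_mult J U (matr_mult J X V)"
  shows "matr_mult J (adj Y) Y = (\<lambda>i j. \<alpha> * id_matr J i j) \<longleftrightarrow>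
    matr_mult J (adj X) X = (\<lambda>i j. \<alpha> * id_matr J i j)"
proof -
  let ?Z = "matr_mult J (adj X) X"
  have u: "matr_mult J (adj U) U = id_matr J" and v: "matr_mult J (adj V) V = id_matr J" "matr_mult J V (adj V) = id_matr J"
    and m: "V \<in> mats J J" "adj V \<in> mats J J"
    using U V by (auto simp: unitary_on_def adj_in_mats)
  have Z: "?Z \<in> mats J J" using X by (auto intro: matr_mult_in_mats adj_in_mats)
  have XV: "matr_mult J X V \<in> mats J J" using X m by (auto intro: matr_mult_in_mats)
  have "matr_mult J (adj Y) Y = matr_mult J (adj V) (matr_mult J (adj X) (matr_mult J (matr_mult J (adj U) U) (matr_mult J X V)))"
    by (simp add: Y_def adj_matr_mult matr_mult_assoc J)
  also have "\<dots> = matr_mult J (adj V) (matr_mult J ?Z V)"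
    by (simp add: u matr_mult_id_left[OF J XV] matr_mult_assoc J)
  finally have Y: "matr_mult J (adj Y) Y = matr_mult J (adj V) (matr_mult J ?Z V)" .
  show ?thesis
  proof
    assume "matr_mult J (adj Y) Y = (\<lambda>i j. \<alpha> * id_matr J i j)"
    then have "matr_mult J V (matr_mult J (matr_mult J (adj V) (matr_mult J ?Z V)) (adj V)) =
      matr_mult J V (matr_mult J (\<lambda>i j. \<alpha> * id_matr J i j) (adj V))" by (simp add: Y)
    moreover have "matr_mult J V (matr_mult J (matr_mult J (adj V) (matr_mult J ?Z V)) (adj V)) =
      matr_mult J (matr_mult J V (adj V)) (matr_mult J ?Z (matr_mult J V (adj V)))"
      by (simp only: matr_mult_assoc J)
    ultimately show "?Z = (\<lambda>i j. \<alpha> * id_matr J i j)"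
      by (simp add: v matr_mult_id_left[OF J Z] matr_mult_id_right[OF J Z] matr_mult_scale_left
          matr_mult_scale_right matr_mult_id_left[OF J m(2)])
  next
    assume "?Z = (\<lambda>i j. \<alpha> * id_matr J i j)"
    then show "matr_mult J (adj Y) Y = (\<lambda>i j. \<alpha> * id_matr J i j)"
      unfolding Y by (simp add: v matr_mult_scale_left matr_mult_scale_right matr_mult_id_left[OF J m(1)])
  qed
qed

section \<open>The Coxeter presentation of the symmetric group\<close>

abbreviation adj_transp :: "nat \<Rightarrow> nat \<Rightarrow> nat" where
  "adj_transp k \<equiv> Transposition.transpose k (k + 1)"

text \<open>The relations are imposed on self-maps of any type, so that the computations with chains
  apply both to the transpositions themselves and to Young's operators.\<close>

definition coxeter_rels :: "nat \<Rightarrow> (nat \<Rightarrow> 'a \<Rightarrow> 'a) \<Rightarrow> bool" where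
  "coxeter_rels n F \<longleftrightarrow>
     (\<forall>k\<in>{1..<n}. F k \<circ> F k = id) \<and>
     (\<forall>k. 1 \<le> k \<and> k + 1 < n \<longrightarrow> F k \<circ> F (k + 1) \<circ> F k = F (k + 1) \<circ> F k \<circ> F (k + 1)) \<and>
     (\<forall>j\<in>{1..<n}. \<forall>k\<in>{1..<n}. j + 2 \<le> k \<longrightarrow> F j \<circ> F k = F k \<circ> F j)"

lemma coxeter_rels_commute:
  "coxeter_rels n F \<Longrightarrow> 1 \<le> j \<Longrightarrow> j + 2 \<le> k \<Longrightarrow> k < n \<Longrightarrow> F j \<circ> F k = F k \<circ> F j"
  unfolding coxeter_rels_def by (meson atLeastLessThan_iff le_add1 le_trans less_le_trans not_le)

lemma coxeter_rels_mono: "coxeter_rels n F \<Longrightarrow> m \<le> n \<Longrightarrow> coxeter_rels m F"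
  unfolding coxeter_rels_def by (meson atLeastLessThan_iff less_le_trans)

lemma coxeter_rels_adj_transp: "coxeter_rels n adj_transp"
  unfolding coxeter_rels_def
  by (auto simp: fun_eq_iff Transposition.transpose_def)

text \<open>\<open>chain F n d\<close> is \<open>F (n+1-d) \<circ> \<dots> \<circ> F n\<close>; for the adjacent transpositions it is the cycle taking
  \<open>n+1\<close> to \<open>n+1-d\<close>, hence a representative of a left coset of \<open>S\<^sub>n\<close> in \<open>S\<^sub>n\<^sub>+\<^sub>1\<close>.\<close>

fun chain :: "(nat \<Rightarrow> 'a \<Rightarrow> 'a) \<Rightarrow> nat \<Rightarrow> nat \<Rightarrow> 'a \<Rightarrow> 'a" where
  "chain F n 0 = id"
| "chain F n (Suc d) = F (n - d) \<circ> chain F n d"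

text \<open>All indices in the chain are at least \<open>k + 2\<close>.\<close>

lemma chain_commute_below:
  assumes "coxeter_rels (n + 1) F" "d \<le> n" "1 \<le> k" "k + d < n"
  shows "F k \<circ> chain F n d = chain F n d \<circ> F k"
  using assms(2,4)
proof (induction d)
  case (Suc d)
  have "F k \<circ> F (n - d) = F (n - d) \<circ> F k"
    using Suc.prems by (intro coxeter_rels_commute[OF assms(1,3)]) auto
  moreover have "F k \<circ> chain F n d = chain F n d \<circ> F k"
    using Suc unfolding comp_def by simp
  ultimately show ?case by (metis chain.simps(2) comp_assoc)
qed simp

text \<open>\<open>F k\<close> commutes with the factors up to \<open>F (k - 2)\<close>, the braid
  relation turns \<open>F k F (k - 1) F k\<close> into \<open>F (k - 1) F k F (k - 1)\<close>, and
  the last factor commutes with the rest of the chain.\<close>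

lemma chain_commute_above:
  assumes "coxeter_rels (n + 1) F" "d \<le> n" "n + 1 < k + d" "k \<le> n"
  shows "F k \<circ> chain F n d = chain F n d \<circ> F (k - 1)"
  using assms(2,3)
proof (induction d)
  case (Suc d)
  show ?case
  proof (cases "n + 1 < k + d")
    case True
    then have "F (n - d) \<circ> F k = F k \<circ> F (n - d)"
      using Suc.prems assms(4) by (intro coxeter_rels_commute[OF assms(1)]) auto
    moreover have "F k \<circ> chain F n d = chain F n d \<circ> F (k - 1)"
      using Suc True unfolding comp_def by simp
    ultimately show ?thesis by (metis chain.simps(2) comp_assoc)
  next
    case False
    then have kd: "k + d = n + 1" using Suc.prems by simp
    then obtain e where d: "d = Suc e" using assms(4) by (cases d) auto
    have k: "n = k + e" "k \<ge> 2" using kd d Suc.prems by auto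
    then have b: "F k \<circ> F (k - 1) \<circ> F k = F (k - 1) \<circ> F k \<circ> F (k - 1)"
      using assms(1) by (auto simp: coxeter_rels_def dest!: spec[of _ "k - 1"])
    have c: "F (k - 1) \<circ> chain F n e = chain F n e \<circ> F (k - 1)"
      using k Suc.prems by (intro chain_commute_below[OF assms(1)]) auto
    have "F k \<circ> chain F n (Suc d) = (F k \<circ> F (k - 1) \<circ> F k) \<circ> chain F n e"
      using k by (simp add: d comp_assoc)
    also have "\<dots> = F (k - 1) \<circ> F k \<circ> (chain F n e \<circ> F (k - 1))"
      unfolding b c[symmetric] by (simp only: comp_assoc)
    also have "\<dots> = chain F n (Suc d) \<circ> F (k - 1)"
      using k by (simp add: d comp_assoc)
    finally show ?thesis .
  qed
qed (use assms(4) in simp)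

lemma chain_adj_transp_top: "d \<le> n \<Longrightarrow> chain adj_transp n d (n + 1) = n + 1 - d"
  by (induction d) (auto simp: Transposition.transpose_def)

lemma chain_adj_transp_permutes: "d \<le> n \<Longrightarrow> chain adj_transp n d permutes {1..n + 1}"
  by (induction d) (auto intro!: permutes_compose permutes_swap_id permutes_id
      simp del: o_apply simp: id_def[symmetric])

lemma permutes_fix_top:
  assumes "g permutes {1..n + 1}" "g (n + 1) = n + 1"
  shows "g permutes {1..n::nat}"
proof (rule permutes_superset[OF assms(1)])
  show "g x = x" if "x \<in> {1..n + 1} - {1..n}" for x
  proof -
    have "x = n + 1" using that by auto
    then show ?thesis using assms(2) by simp
  qed
qed

text \<open>The image of \<open>n + 1\<close> fixes the length of the chain; removing the chain
  leaves a permutation that fixes \<open>n + 1\<close>.\<close>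

lemma chain_decomposition:
  assumes g: "g permutes {1..n + 1}"
  obtains d h where "d \<le> n" "h permutes {1..n}" "g = chain adj_transp n d \<circ> h"
proof -
  have gin: "g (n + 1) \<in> {1..n + 1}" using permutes_in_image[OF g, of "n + 1"] by simp
  define d where "d = n + 1 - g (n + 1)"
  define c where "c = chain adj_transp n d"
  have d: "d \<le> n" "g (n + 1) = n + 1 - d" using gin by (auto simp: d_def)
  have c: "c permutes {1..n + 1}" unfolding c_def by (rule chain_adj_transp_permutes[OF d(1)])
  have "c (n + 1) = g (n + 1)" using chain_adj_transp_top[OF d(1)] d(2) by (simp add: c_def)
  then have "inv c (g (n + 1)) = n + 1"
    using permutes_inverses(2)[OF c, of "n + 1"] by simp
  then have "(inv c \<circ> g) permutes {1..n}"
    using permutes_fix_top[OF permutes_compose[OF g permutes_inv[OF c]]] by (simp only: o_apply)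
  moreover have "g = c \<circ> (inv c \<circ> g)"
    by (simp only: comp_assoc[symmetric] permutes_inv_o(1)[OF c] id_comp)
  ultimately show thesis by (rule that[OF d(1), folded c_def])
qed

lemma permutes_adj_transp: "k \<in> {1..<n} \<Longrightarrow> adj_transp k permutes {1..n}"
  by (auto intro!: permutes_swap_id)

text \<open>The chain decomposition, applied repeatedly, writes every permutation as a product of
  adjacent transpositions.\<close>

lemma permutes_adj_transp_induct [consumes 1, case_names id step]:
  assumes "g permutes {1..n::nat}" and "Q id"
    and "\<And>k g. k \<in> {1..<n} \<Longrightarrow> g permutes {1..n} \<Longrightarrow> Q g \<Longrightarrow> Q (adj_transp k \<circ> g)"
  shows "Q g"
  using assms
proof (induction n arbitrary: g)
  case 0
  then show ?case by (simp add: id_def)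
next
  case (Suc n)
  from Suc.prems(1) obtain d h where dh: "d \<le> n" "h permutes {1..n}" "g = chain adj_transp n d \<circ> h"
    using chain_decomposition[of g n] by (metis Suc_eq_plus1)
  have hS: "h permutes {1..Suc n}" by (rule permutes_subset[OF dh(2)]) auto
  note step = Suc.prems(3)
  have "Q h"
  proof (rule Suc.IH[OF dh(2) Suc.prems(2)])
    fix k g assume "k \<in> {1..<n}" "g permutes {1..n}" "Q g"
    then show "Q (adj_transp k \<circ> g)"
      by (intro Suc.prems(3)) (auto intro: permutes_subset)
  qed
  moreover have "Q (chain adj_transp n d \<circ> h)" if "Q h"
    using dh(1)
  proof (induction d)
    case (Suc d)
    have "chain adj_transp n d \<circ> h permutes {1..Suc n}"
      using chain_adj_transp_permutes[of d n] Suc.prems by (intro permutes_compose hS) auto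
    moreover have "Q (chain adj_transp n d \<circ> h)" by (rule Suc.IH) (use Suc.prems in simp)
    moreover have "n - d \<in> {1..<Suc n}" using Suc.prems by auto
    ultimately show ?case unfolding chain.simps comp_assoc by (intro step)
  qed (use that in simp)
  ultimately show ?case unfolding dh by blast
qed

text \<open>Well-definedness is obtained by construction: \<rho> is extended from \<open>S_n\<close>
  to the next group along unique normal forms, a chain times an element of \<open>S_n\<close>, and
  only left multiplication by generators is checked. The invariant \<open>P\<close> carries along a
  property of the values, later that they come from unitary matrices.\<close>

lemma coxeter_hom_left:
  fixes F :: "nat \<Rightarrow> 'a \<Rightarrow> 'a"
  assumes "coxeter_rels n F" and "P id" and "\<And>k X. k \<in> {1..<n} \<Longrightarrow> P X \<Longrightarrow> P (F k \<circ> X)"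
  shows "\<exists>\<rho>. \<rho> id = id \<and> (\<forall>g. g permutes {1..n} \<longrightarrow> P (\<rho> g)) \<and>
    (\<forall>k\<in>{1..<n}. \<forall>g. g permutes {1..n} \<longrightarrow> \<rho> (adj_transp k \<circ> g) = F k \<circ> \<rho> g)"
  using assms
proof (induction n)
  case 0
  then show ?case by (intro exI[of _ "\<lambda>_. id"]) auto
next
  case (Suc n)
  have "\<exists>\<rho>. \<rho> id = id \<and> (\<forall>g. g permutes {1..n} \<longrightarrow> P (\<rho> g)) \<and>
    (\<forall>k\<in>{1..<n}. \<forall>g. g permutes {1..n} \<longrightarrow> \<rho> (adj_transp k \<circ> g) = F k \<circ> \<rho> g)"
    by (rule Suc.IH[OF coxeter_rels_mono[OF Suc.prems(1)] Suc.prems(2) Suc.prems(3)]) simp_all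
  then obtain \<rho> where \<rho>: "\<rho> id = id" "\<And>g. g permutes {1..n} \<Longrightarrow> P (\<rho> g)"
    "\<And>k g. k \<in> {1..<n} \<Longrightarrow> g permutes {1..n} \<Longrightarrow> \<rho> (adj_transp k \<circ> g) = F k \<circ> \<rho> g" by blast
  have F: "coxeter_rels (n + 1) F" and sc: "coxeter_rels (n + 1) adj_transp"
    using Suc.prems(1) coxeter_rels_adj_transp by auto
  let ?c = "chain adj_transp n"
  \<comment> \<open>The length of the chain is read off from the image of \<open>n + 1\<close>, the
    factor in \<open>S_n\<close> by cancelling the chain.\<close>
  define \<sigma> where "\<sigma> g = chain F n (n + 1 - g (n + 1)) \<circ> \<rho> (inv (?c (n + 1 - g (n + 1))) \<circ> g)" for g
  have \<sigma>: "\<sigma> (?c d \<circ> h) = chain F n d \<circ> \<rho> h" if "d \<le> n" "h permutes {1..n}" for d h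
  proof -
    have "h (n + 1) = n + 1" using that(2) by (auto simp: permutes_def)
    then have "(?c d \<circ> h) (n + 1) = n + 1 - d" using chain_adj_transp_top[OF that(1)] by simp
    moreover have "inv (?c d) \<circ> (?c d \<circ> h) = h"
      using permutes_inv_o(2)[OF chain_adj_transp_permutes[OF that(1)]] by (simp add: comp_assoc[symmetric])
    moreover have "n + 1 - (n + 1 - d) = d" using that(1) by simp
    ultimately show ?thesis by (simp only: \<sigma>_def)
  qed
  show ?case
  proof (intro exI[of _ \<sigma>] conjI ballI allI impI)
    show "\<sigma> id = id" using \<sigma>[of 0 id] \<rho>(1) by (simp add: permutes_id)
  next
    fix g assume "g permutes {1..Suc n}"
    then obtain d h where dh: "d \<le> n" "h permutes {1..n}" "g = ?c d \<circ> h"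
      using chain_decomposition[of g n] by (metis Suc_eq_plus1)
    have "P (chain F n d \<circ> X)" if "P X" for X
      using dh(1) by (induction d) (auto simp: that comp_assoc intro!: Suc.prems(3))
    then show "P (\<sigma> g)" unfolding dh(3) \<sigma>[OF dh(1,2)] using \<rho>(2)[OF dh(2)] by blast
  next
    fix k g assume k: "k \<in> {1..<Suc n}" and "g permutes {1..Suc n}"
    then obtain d h where dh: "d \<le> n" "h permutes {1..n}" "g = ?c d \<circ> h"
      using chain_decomposition[of g n] by (metis Suc_eq_plus1)
    have sg: "\<sigma> g = chain F n d \<circ> \<rho> h" unfolding dh(3) by (rule \<sigma>[OF dh(1,2)])
    \<comment> \<open>Left multiplication by the \<open>k\<close>-th generator passes through the
      chain unchanged, lengthens it by one factor, cancels its first factor, or passes through with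
      index \<open>k - 1\<close>.\<close>
    consider "k + d < n" | "k + d = n" | "k + d = n + 1" | "n + 1 < k + d" by linarith
    then show "\<sigma> (adj_transp k \<circ> g) = F k \<circ> \<sigma> g"
    proof cases
      case 1
      have "adj_transp k \<circ> g = ?c d \<circ> (adj_transp k \<circ> h)"
        using chain_commute_below[OF sc dh(1) _ 1] k
        by (simp only: dh(3) comp_assoc[symmetric] atLeastLessThan_iff)
      moreover have "k \<in> {1..<n}" using 1 k by auto
      ultimately have "\<sigma> (adj_transp k \<circ> g) = chain F n d \<circ> F k \<circ> \<rho> h"
        using \<sigma>[OF dh(1) permutes_compose[OF dh(2) permutes_adj_transp]] \<rho>(3)[OF _ dh(2)]
        by (simp only: comp_assoc)
      then show ?thesis
        using chain_commute_below[OF F dh(1) _ 1] k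
        by (simp only: sg comp_assoc[symmetric] atLeastLessThan_iff)
    next
      case 2
      then have "n - d = k" by simp
      then have "adj_transp k \<circ> g = ?c (Suc d) \<circ> h" by (simp add: dh(3) comp_assoc)
      moreover have "Suc d \<le> n" using 2 k by auto
      ultimately have "\<sigma> (adj_transp k \<circ> g) = chain F n (Suc d) \<circ> \<rho> h" using dh by (simp only: \<sigma>)
      then show ?thesis using \<open>n - d = k\<close> by (simp add: sg comp_assoc)
    next
      case 3
      then obtain e where e: "d = Suc e" "n - e = k" using k by (cases d) auto
      have "adj_transp k \<circ> g = (adj_transp k \<circ> adj_transp k) \<circ> (?c e \<circ> h)"
        using e by (simp only: dh(3) comp_assoc chain.simps)
      then have "adj_transp k \<circ> g = ?c e \<circ> h" by (simp only: transpose_comp_involutory id_comp)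
      then have "\<sigma> (adj_transp k \<circ> g) = chain F n e \<circ> \<rho> h"
        using dh(1) e by (simp only: \<sigma>[OF _ dh(2)])
      moreover have "F k \<circ> \<sigma> g = (F k \<circ> F k) \<circ> (chain F n e \<circ> \<rho> h)"
        using e by (simp add: sg comp_assoc)
      moreover have "F k \<circ> F k = id" using F k by (auto simp: coxeter_rels_def)
      ultimately show ?thesis by (simp only: id_comp)
    next
      case 4
      have kn: "k \<le> n" using k by auto
      have "adj_transp k \<circ> g = ?c d \<circ> (adj_transp (k - 1) \<circ> h)"
        using chain_commute_above[OF sc dh(1) 4 kn] by (simp only: dh(3) comp_assoc[symmetric])
      moreover have k1: "k - 1 \<in> {1..<n}" using 4 k dh(1) by auto
      ultimately have "\<sigma> (adj_transp k \<circ> g) = chain F n d \<circ> (F (k - 1) \<circ> \<rho> h)"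
        using \<sigma>[OF dh(1) permutes_compose[OF dh(2) permutes_adj_transp[OF k1]]] \<rho>(3)[OF k1 dh(2)]
        by simp
      then show ?thesis
        using chain_commute_above[OF F dh(1) 4 kn] by (simp only: sg comp_assoc[symmetric])
    qed
  qed
qed

text \<open>Compatibility with left multiplication by generators gives multiplicativity by induction
  on a word for the left factor.\<close>

lemma coxeter_hom:
  fixes F :: "nat \<Rightarrow> 'a \<Rightarrow> 'a"
  assumes F: "coxeter_rels n F" and "P id" and "\<And>k X. k \<in> {1..<n} \<Longrightarrow> P X \<Longrightarrow> P (F k \<circ> X)"
  shows "\<exists>\<rho>. (\<forall>g. g permutes {1..n} \<longrightarrow> P (\<rho> g)) \<and>
    (\<forall>g h. g permutes {1..n} \<longrightarrow> h permutes {1..n} \<longrightarrow> \<rho> (g \<circ> h) = \<rho> g \<circ> \<rho> h) \<and>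
    (\<forall>k\<in>{1..<n}. \<rho> (adj_transp k) = F k)"
proof -
  obtain \<rho> where \<rho>: "\<rho> id = id" "\<And>g. g permutes {1..n} \<Longrightarrow> P (\<rho> g)"
    "\<And>k g. k \<in> {1..<n} \<Longrightarrow> g permutes {1..n} \<Longrightarrow> \<rho> (adj_transp k \<circ> g) = F k \<circ> \<rho> g"
    using coxeter_hom_left[of n F P] assms by blast
  show ?thesis
  proof (intro exI[of _ \<rho>] conjI allI impI ballI \<rho>(2))
    fix g h assume "g permutes {1..n}" and h: "h permutes {1..n}"
    then show "\<rho> (g \<circ> h) = \<rho> g \<circ> \<rho> h"
    proof (induction rule: permutes_adj_transp_induct)
      case (step k g)
      then show ?case using h permutes_compose[of h "{1..n}" g]
        by (simp only: \<rho>(3) comp_assoc)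
    qed (simp add: \<rho>(1))
  next
    fix k assume "k \<in> {1..<n}"
    from \<rho>(3)[OF this permutes_id] show "\<rho> (adj_transp k) = F k" by (simp add: \<rho>(1))
  qed
qed

section \<open>Standard tableaux\<close>

definition content :: "box \<Rightarrow> int" where
  "content b = int (snd b) - int (fst b)"

definition tab_content :: "tableau \<Rightarrow> nat \<Rightarrow> int" where
  "tab_content T a = content (box_of T a)"

lemma axial_dist_content: "axial_dist b b' = content b - content b'"
  by (cases b; cases b') (simp add: content_def)

lemma tab_dist_content: "tab_dist T a b = tab_content T a - tab_content T b"
  by (simp add: tab_dist_def axial_dist_content tab_content_def)

section \<open>Young diagrams as finite down-closed sets\<close>

lemma young_diagram_Sigma: "young_diagram lam = (SIGMA i:{1..length lam}. {1..lam ! (i - 1)})"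
  by (auto simp: young_diagram_def)

lemma finite_young_diagram [simp]: "finite (young_diagram lam)"
  by (simp add: young_diagram_Sigma)

lemma card_young_diagram: "card (young_diagram lam) = sum_list lam"
proof -
  have "card (young_diagram lam) = (\<Sum>i\<in>{1..length lam}. lam ! (i - 1))"
    by (simp add: young_diagram_Sigma)
  also have "\<dots> = (\<Sum>i\<in>{0..<length lam}. lam ! i)"
    by (rule sum.reindex_bij_witness[of _ Suc "\<lambda>i. i - 1"]) auto
  finally show ?thesis by (simp add: sum_list_sum_nth)
qed

lemma young_diagram_down:
  assumes "is_partition lam n" "(i', j') \<in> young_diagram lam" "1 \<le> i" "i \<le> i'" "1 \<le> j" "j \<le> j'"
  shows "(i, j) \<in> young_diagram lam"
proof -
  have "lam ! (i' - 1) \<le> lam ! (i - 1)"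
  proof (cases "i = i'")
    case False
    then show ?thesis using assms
      by (auto simp: is_partition_def sorted_wrt_iff_nth_less young_diagram_def)
  qed simp
  then show ?thesis using assms by (auto simp: young_diagram_def)
qed

lemma young_diagram_pos: "(i, j) \<in> young_diagram lam \<Longrightarrow> 1 \<le> i \<and> 1 \<le> j"
  by (auto simp: young_diagram_def)

text \<open>Used to recognise a diagram with one box removed as a diagram again. The rows and the
  first column are initial segments, so the row lengths form the partition.\<close>

lemma ex_partition_of_down_set:
  assumes fin: "finite D" and pos: "\<And>i j. (i, j) \<in> D \<Longrightarrow> 1 \<le> i \<and> 1 \<le> j"
    and down: "\<And>i j i' j'. (i', j') \<in> D \<Longrightarrow> 1 \<le> i \<Longrightarrow> i \<le> i' \<Longrightarrow> 1 \<le> j \<Longrightarrow> j \<le> j' \<Longrightarrow> (i, j) \<in> D"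
  shows "\<exists>nu. is_partition nu (card D) \<and> young_diagram nu = D"
proof -
  have initial: "A = {1..card A}"
    if "finite A" "\<And>x. x \<in> A \<Longrightarrow> 1 \<le> x" "\<And>x y. y \<in> A \<Longrightarrow> 1 \<le> x \<Longrightarrow> x \<le> y \<Longrightarrow> x \<in> A" for A :: "nat set"
  proof (cases "A = {}")
    case False
    have "A = {1..Max A}"
    proof (rule set_eqI)
      fix x show "x \<in> A \<longleftrightarrow> x \<in> {1..Max A}"
        using that(2)[of x] that(3)[OF Max_in[OF that(1) False], of x] Max_ge[OF that(1), of x]
        by (metis atLeastAtMost_iff)
    qed
    then show ?thesis by (metis card_atLeastAtMost diff_Suc_1)
  qed simp
  define row where "row i = {j. (i, j) \<in> D}" for i
  define col where "col = {i. (i, 1) \<in> D}"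
  have finrow: "finite (row i)" for i
    by (rule finite_subset[OF _ finite_imageI[OF fin, of snd]]) (force simp: row_def)
  have row: "row i = {1..card (row i)}" for i
    by (rule initial[OF finrow]) (auto simp: row_def dest: pos intro: down[OF _ _ order_refl])
  have "finite col"
    by (rule finite_subset[OF _ finite_imageI[OF fin, of fst]]) (force simp: col_def)
  then have col: "col = {1..card col}"
    by (rule initial) (auto simp: col_def dest: pos intro: down[OF _ _ _ _ order_refl])
  define nu where "nu = map (\<lambda>i. card (row (i + 1))) [0..<card col]"
  have D: "(i, j) \<in> D \<longleftrightarrow> 1 \<le> i \<and> i \<le> card col \<and> 1 \<le> j \<and> j \<le> card (row i)" for i j
  proof -
    have "(i, j) \<in> D \<longleftrightarrow> i \<in> col \<and> j \<in> row i"
      using pos down[of i j i 1] by (auto simp: col_def row_def)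
    then show ?thesis by (metis col row atLeastAtMost_iff)
  qed
  have yd: "young_diagram nu = D"
    by (auto simp: young_diagram_def nu_def D)
  have "sorted_wrt (\<ge>) nu"
    unfolding sorted_wrt_iff_nth_less
  proof (intro allI impI)
    fix i j assume "i < j" "j < length nu"
    have "row (j + 1) \<subseteq> row (i + 1)"
      using \<open>i < j\<close> pos down[of "j + 1" _ "i + 1"] by (force simp: row_def)
    then show "nu ! j \<le> nu ! i"
      using \<open>i < j\<close> \<open>j < length nu\<close> by (auto simp: nu_def intro!: card_mono finrow)
  qed
  moreover have "\<forall>p\<in>set nu. 0 < p"
  proof
    fix p assume "p \<in> set nu"
    then obtain i where i: "i < card col" "p = card (row (i + 1))" by (auto simp: nu_def)
    then have "i + 1 \<in> col" by (subst col) simp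
    then have "1 \<in> row (i + 1)" by (simp add: col_def row_def)
    then show "0 < p" using i finrow[of "i + 1"] by (auto simp: card_gt_0_iff)
  qed
  moreover have "sum_list nu = card D" using card_young_diagram[of nu] yd by simp
  ultimately show ?thesis using yd by (auto simp: is_partition_def)
qed

text \<open>The length is the height of the first column, because all parts are positive; the parts
  are the row sizes.\<close>

lemma young_diagram_inject:
  assumes "is_partition lam m" "is_partition lam' m'" "young_diagram lam = young_diagram lam'"
  shows "lam = lam'"
proof -
  have l: "{i. (i, 1) \<in> young_diagram xs} = {1..length xs}" if "is_partition xs m" for xs m
  proof -
    have "0 < xs ! (i - 1)" if "1 \<le> i" "i \<le> length xs" for i
      using \<open>is_partition xs m\<close> that nth_mem[of "i - 1" xs] by (force simp: is_partition_def)
    then show ?thesis by (force simp: young_diagram_def)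
  qed
  have "card {1..length lam} = card {1..length lam'}"
    unfolding l[OF assms(1), symmetric] l[OF assms(2), symmetric] assms(3) ..
  then have len: "length lam = length lam'" by simp
  have "card {j. (Suc i, j) \<in> young_diagram xs} = xs ! i" if "i < length xs" for xs i
  proof -
    have "{j. (Suc i, j) \<in> young_diagram xs} = {1..xs ! i}" using that by (auto simp: young_diagram_def)
    then show ?thesis by simp
  qed
  then show ?thesis using len assms(3) by (metis nth_equalityI)
qed

section \<open>Positions and contents of the entries of a standard tableau\<close>

lemma Tab_outside: "T \<in> Tab lam \<Longrightarrow> b \<notin> young_diagram lam \<Longrightarrow> T b = 0"
  unfolding Tab_def by blast

lemma Tab_bij: "T \<in> Tab lam \<Longrightarrow> bij_betw T (young_diagram lam) {1..sum_list lam}"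
  by (auto simp: Tab_def)

lemma Tab_entry_range: "T \<in> Tab lam \<Longrightarrow> b \<in> young_diagram lam \<Longrightarrow> 1 \<le> T b \<and> T b \<le> sum_list lam"
  using Tab_bij[of T lam] by (auto simp: bij_betw_def)

lemma finite_Tab [simp]: "finite (Tab lam)"
proof (rule finite_subset)
  show "Tab lam \<subseteq> {T. (\<forall>b. (b \<in> young_diagram lam \<longrightarrow> T b \<in> {1..sum_list lam}) \<and>
      (b \<notin> young_diagram lam \<longrightarrow> T b = 0))}"
    using Tab_entry_range Tab_outside by force
qed (rule finite_set_of_finite_funs, auto)

text \<open>The description in \<open>box_of\<close> ranges over all boxes; those outside the
  diagram carry 0 and so cannot compete with an entry of the diagram, which is at least 1.\<close>

lemma box_of_entry:
  assumes "T \<in> Tab lam" "b \<in> young_diagram lam"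
  shows "box_of T (T b) = b"
  unfolding box_of_def
proof (rule the_equality)
  fix b' assume "T b' = T b"
  then have "b' \<in> young_diagram lam" using Tab_outside[OF assms(1), of b'] Tab_entry_range[OF assms] by (metis not_one_le_zero)
  then show "b' = b" using Tab_bij[OF assms(1)] assms(2) \<open>T b' = T b\<close> by (auto simp: bij_betw_def inj_on_def)
qed simp

lemma
  assumes "T \<in> Tab lam" "a \<in> {1..sum_list lam}"
  shows box_of_in_diagram: "box_of T a \<in> young_diagram lam"
    and entry_box_of: "T (box_of T a) = a"
proof -
  have "a \<in> T ` young_diagram lam" using bij_betw_imp_surj_on[OF Tab_bij[OF assms(1)]] assms(2) by simp
  then obtain b where "b \<in> young_diagram lam" "T b = a" by (rule imageE) simp
  then show "box_of T a \<in> young_diagram lam" "T (box_of T a) = a"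
    using box_of_entry[OF assms(1), of b] by auto
qed

lemma box_of_transp: "box_of (adj_transp k \<circ> T) a = box_of T (adj_transp k a)"
proof -
  have "adj_transp k x = a \<longleftrightarrow> x = adj_transp k a" for x
    by (metis transpose_involutory)
  then show ?thesis by (simp add: box_of_def)
qed

text \<open>Pass through the corner \<open>(i, j')\<close>, which lies in the diagram by
  down-closure.\<close>

lemma Tab_less:
  assumes lam: "is_partition lam n" and T: "T \<in> Tab lam"
    and b: "(i, j) \<in> young_diagram lam" "(i', j') \<in> young_diagram lam"
    and le: "i \<le> i'" "j \<le> j'" "(i, j) \<noteq> (i', j')"
  shows "T (i, j) < T (i', j')"
proof -
  have m: "(i, j') \<in> young_diagram lam"
    using young_diagram_down[OF lam b(2), of i j'] young_diagram_pos[OF b(1)] young_diagram_pos[OF b(2)] le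
    by simp
  have "T (i, j) < T (i, j')" if "j < j'" using T b(1) m that by (auto simp: Tab_def)
  moreover have "T (i, j') < T (i', j')" if "i < i'" using T b(2) m that by (auto simp: Tab_def)
  ultimately show ?thesis using le by (metis le_neq_implies_less less_trans)
qed

lemma TabI:
  assumes "\<And>b. b \<notin> young_diagram lam \<Longrightarrow> T b = 0" "bij_betw T (young_diagram lam) {1..sum_list lam}"
    "\<And>i j i' j'. (i, j) \<in> young_diagram lam \<Longrightarrow> (i', j') \<in> young_diagram lam \<Longrightarrow>
       i \<le> i' \<Longrightarrow> j \<le> j' \<Longrightarrow> (i, j) \<noteq> (i', j') \<Longrightarrow> T (i, j) < T (i', j')"
  shows "T \<in> Tab lam"
  using assms unfolding Tab_def by auto

text \<open>The exchange preserves standardness exactly when the two boxes are incomparable;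
  comparable boxes with consecutive entries are neighbours.\<close>

lemma
  assumes lam: "is_partition lam n" and T: "T \<in> Tab lam" and k: "k \<in> {1..<n}"
    and bk: "box_of T k = (i, j)" and bk1: "box_of T (k + 1) = (i', j')"
  shows Tab_consecutive_swappable:
      "adj_transp k \<circ> T \<in> Tab lam \<Longrightarrow> i < i' \<and> j' < j \<or> i' < i \<and> j < j'"
    and Tab_consecutive_adjacent:
      "adj_transp k \<circ> T \<notin> Tab lam \<Longrightarrow> i' = i \<and> j' = j + 1 \<or> i' = i + 1 \<and> j' = j"
proof -
  have n: "sum_list lam = n" using lam by (simp add: is_partition_def)
  have kin: "k \<in> {1..sum_list lam}" "k + 1 \<in> {1..sum_list lam}" using k n by auto
  have yd: "(i, j) \<in> young_diagram lam" "(i', j') \<in> young_diagram lam"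
    using box_of_in_diagram[OF T kin(1)] box_of_in_diagram[OF T kin(2)] bk bk1 by auto
  have Tk: "T (i, j) = k" "T (i', j') = k + 1"
    using entry_box_of[OF T kin(1)] entry_box_of[OF T kin(2)] bk bk1 by auto
  then have ne: "(i, j) \<noteq> (i', j')" by auto
  have pos: "1 \<le> i" "1 \<le> j" "1 \<le> i'" "1 \<le> j'" using young_diagram_pos yd by blast+
  have nle: "\<not> (i' \<le> i \<and> j' \<le> j)"
    using Tab_less[OF lam T yd(2,1)] ne Tk by fastforce
  show "i < i' \<and> j' < j \<or> i' < i \<and> j < j'" if "adj_transp k \<circ> T \<in> Tab lam"
  proof -
    have "(adj_transp k \<circ> T) (i', j') < (adj_transp k \<circ> T) (i, j)" using Tk by simp
    then have "\<not> (i \<le> i' \<and> j \<le> j')" using Tab_less[OF lam that yd] ne by fastforce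
    with nle show ?thesis by auto
  qed
  show "i' = i \<and> j' = j + 1 \<or> i' = i + 1 \<and> j' = j" if ns: "adj_transp k \<circ> T \<notin> Tab lam"
  proof (rule ccontr)
    assume na: "\<not> ?thesis"
    have ncomp: "\<not> (i \<le> i' \<and> j \<le> j')"
    proof
      assume le: "i \<le> i' \<and> j \<le> j'"
      \<comment> \<open>A box strictly between the two would carry an entry strictly between
        \<open>k\<close> and \<open>k + 1\<close>.\<close>
      obtain a b where ab: "i \<le> a" "a \<le> i'" "j \<le> b" "b \<le> j'" "(a, b) \<noteq> (i, j)" "(a, b) \<noteq> (i', j')"
      proof (cases "i = i'")
        case True
        then show thesis using that[of i "j + 1"] le na ne by auto
      next
        case False
        then show thesis using that[of "i + 1" j] le na by (cases "j = j'") auto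
      qed
      have "(a, b) \<in> young_diagram lam" using young_diagram_down[OF lam yd(2)] ab pos by simp
      then have "T (i, j) < T (a, b)" "T (a, b) < T (i', j')"
        using Tab_less[OF lam T] yd ab by metis+
      then show False using Tk by simp
    qed
    have "adj_transp k \<circ> T \<in> Tab lam"
    proof (rule TabI)
      show "(adj_transp k \<circ> T) b = 0" if "b \<notin> young_diagram lam" for b
        using Tab_outside[OF T that] k by (simp add: Transposition.transpose_def)
      show "bij_betw (adj_transp k \<circ> T) (young_diagram lam) {1..sum_list lam}"
        using k n by (intro bij_betw_trans[OF Tab_bij[OF T]] permutes_imp_bij permutes_adj_transp) auto
      fix a b a' b' assume ab: "(a, b) \<in> young_diagram lam" "(a', b') \<in> young_diagram lam"
        "a \<le> a'" "b \<le> b'" "(a, b) \<noteq> (a', b')"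
      have lt: "T (a, b) < T (a', b')" by (rule Tab_less[OF lam T ab])
      have "\<not> (T (a, b) = k \<and> T (a', b') = k + 1)"
        using box_of_entry[OF T ab(1)] box_of_entry[OF T ab(2)] ncomp ab bk bk1 by auto
      with lt show "(adj_transp k \<circ> T) (a, b) < (adj_transp k \<circ> T) (a', b')"
        by (auto simp: Transposition.transpose_def)
    qed
    with ns show False by simp
  qed
qed

text \<open>Makes standardness of the exchange a condition on contents alone, which is how it meets
  the factor \<open>sqrt (1 - 1/D\<^sup>2)\<close>.\<close>

lemma tab_content_consecutive:
  assumes "is_partition lam n" "T \<in> Tab lam" "k \<in> {1..<n}"
  shows "adj_transp k \<circ> T \<in> Tab lam \<Longrightarrow> 2 \<le> \<bar>tab_content T (k + 1) - tab_content T k\<bar>"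
    and "adj_transp k \<circ> T \<notin> Tab lam \<Longrightarrow> \<bar>tab_content T (k + 1) - tab_content T k\<bar> = 1"
  using Tab_consecutive_swappable[OF assms] Tab_consecutive_adjacent[OF assms]
  by (cases "box_of T k"; cases "box_of T (k + 1)"; force simp: tab_content_def content_def)+

lemma tab_content_consecutive_neq:
  assumes "is_partition lam n" "T \<in> Tab lam" "k \<in> {1..<n}"
  shows "tab_content T (k + 1) \<noteq> tab_content T k"
  using tab_content_consecutive[OF assms] by fastforce

text \<open>If \<open>k\<close> and \<open>k + 2\<close> were on one diagonal, the other two corners
  of their rectangle would both have to contain \<open>k + 1\<close>. This makes the third
  denominator in the braid relation nonzero.\<close>

lemma tab_content_second_neq:
  assumes lam: "is_partition lam n" and T: "T \<in> Tab lam" and k: "1 \<le> k" "k + 1 < n"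
  shows "tab_content T (k + 2) \<noteq> tab_content T k"
proof
  assume eq: "tab_content T (k + 2) = tab_content T k"
  have n: "sum_list lam = n" using lam by (simp add: is_partition_def)
  obtain i j i' j' where b: "box_of T k = (i, j)" "box_of T (k + 2) = (i', j')"
    by (cases "box_of T k"; cases "box_of T (k + 2)")
  have kin: "k \<in> {1..sum_list lam}" "k + 2 \<in> {1..sum_list lam}" using k n by auto
  have yd: "(i, j) \<in> young_diagram lam" "(i', j') \<in> young_diagram lam"
    and Tk: "T (i, j) = k" "T (i', j') = k + 2"
    using box_of_in_diagram[OF T kin(1)] box_of_in_diagram[OF T kin(2)]
      entry_box_of[OF T kin(1)] entry_box_of[OF T kin(2)] b by auto
  have pos: "1 \<le> i" "1 \<le> j" "1 \<le> i'" "1 \<le> j'" using young_diagram_pos yd by blast+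
  have "int j - int i = int j' - int i'" using eq b by (simp add: tab_content_def content_def)
  moreover have "\<not> (i' \<le> i \<and> j' \<le> j)"
    using Tab_less[OF lam T yd(2,1)] Tk by fastforce
  ultimately have lt: "i < i'" "j < j'" by linarith+
  have m: "(i, j') \<in> young_diagram lam" "(i', j) \<in> young_diagram lam"
    using young_diagram_down[OF lam yd(2)] lt pos by auto
  have "T (i, j') = k + 1" "T (i', j) = k + 1"
    using Tab_less[OF lam T yd(1) m(1)] Tab_less[OF lam T m(1) yd(2)]
      Tab_less[OF lam T yd(1) m(2)] Tab_less[OF lam T m(2) yd(2)] lt Tk by auto
  then show False using box_of_entry[OF T m(1)] box_of_entry[OF T m(2)] lt by simp
qed

text \<open>The boxes agree by strong induction on the entry. This separates basis vectors even
  across different shapes.\<close>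

lemma tab_content_determines:
  assumes lam: "is_partition lam n" "is_partition lam' n" and S: "S \<in> Tab lam" and T: "T \<in> Tab lam'"
    and eq: "\<And>k. k \<in> {1..n} \<Longrightarrow> tab_content S k = tab_content T k"
  shows "lam = lam'" "S = T"
proof -
  have n: "sum_list lam = n" "sum_list lam' = n" using lam by (auto simp: is_partition_def)
  \<comment> \<open>On a common diagonal, a higher box of \<open>k\<close> in \<open>S\<close> would
    lie in \<open>lam'\<close> and hold a smaller entry of \<open>T\<close>; by the induction
    hypothesis \<open>S\<close> has that smaller entry in the same box.\<close>
  have aux: "\<not> fst (box_of S k) < fst (box_of T k)"
    if lam: "is_partition lam n" "is_partition lam' n" and S: "S \<in> Tab lam" and T: "T \<in> Tab lam'"
      and n: "sum_list lam = n" "sum_list lam' = n"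
      and k: "k \<in> {1..n}" and same: "\<And>a. a \<in> {1..<k} \<Longrightarrow> box_of S a = box_of T a"
      and eq: "tab_content S k = tab_content T k" for lam lam' S T k
  proof
    assume lt: "fst (box_of S k) < fst (box_of T k)"
    obtain i j i' j' where b: "box_of S k = (i, j)" "box_of T k = (i', j')"
      by (cases "box_of S k"; cases "box_of T k")
    have yd: "(i, j) \<in> young_diagram lam" "(i', j') \<in> young_diagram lam'"
      and ST: "S (i, j) = k" "T (i', j') = k"
      using box_of_in_diagram[OF S] box_of_in_diagram[OF T] entry_box_of[OF S] entry_box_of[OF T]
        k n b by metis+
    have "int j - int i = int j' - int i'" using eq b by (simp add: tab_content_def content_def)
    then have lt: "i < i'" "j < j'" using lt b by auto
    have m: "(i, j) \<in> young_diagram lam'"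
      using young_diagram_down[OF lam(2) yd(2)] lt young_diagram_pos[OF yd(1)] by simp
    have Tl: "T (i, j) \<in> {1..<k}" using Tab_less[OF lam(2) T m yd(2)] lt ST Tab_entry_range[OF T m] by auto
    then have "box_of S (T (i, j)) = (i, j)" using same[OF Tl] box_of_entry[OF T m] by simp
    then have "S (i, j) = T (i, j)"
      using entry_box_of[OF S, of "T (i, j)"] Tl k n by force
    then show False using Tl ST by simp
  qed
  have box: "box_of S k = box_of T k" if "k \<in> {1..n}" for k
    using that
  proof (induction k rule: less_induct)
    case (less k)
    then have same: "box_of S a = box_of T a" if "a \<in> {1..<k}" for a using that by auto
    have e: "tab_content S k = tab_content T k" using eq less by simp
    have "fst (box_of S k) = fst (box_of T k)"
      using aux[OF lam S T n less.prems same e]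
        aux[OF lam(2,1) T S n(2,1) less.prems same[symmetric] e[symmetric]] by auto
    then show ?case using e by (simp add: tab_content_def content_def prod_eq_iff)
  qed
  have img: "young_diagram xs = box_of U ` {1..n}" if "U \<in> Tab xs" "sum_list xs = n" for U xs
  proof -
    have "b \<in> box_of U ` {1..n}" if "b \<in> young_diagram xs" for b
      using box_of_entry[OF \<open>U \<in> Tab xs\<close> that] Tab_entry_range[OF \<open>U \<in> Tab xs\<close> that] \<open>sum_list xs = n\<close>
      by (metis atLeastAtMost_iff imageI)
    then show ?thesis using box_of_in_diagram[OF that(1)] that(2) by auto
  qed
  have yd: "young_diagram lam = young_diagram lam'"
    unfolding img[OF S n(1)] img[OF T n(2)] using box by (intro image_cong) auto
  then show "lam = lam'" using young_diagram_inject[OF lam] by simp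
  show "S = T"
  proof
    fix b
    show "S b = T b"
    proof (cases "b \<in> young_diagram lam")
      case True
      then have "box_of T (S b) = b"
        using box[of "S b"] box_of_entry[OF S True] Tab_entry_range[OF S True] n by simp
      then show ?thesis using entry_box_of[OF T, of "S b"] Tab_entry_range[OF S True] n by simp
    next
      case False
      then show ?thesis using Tab_outside[OF S] Tab_outside[OF T] yd by simp
    qed
  qed
qed

text \<open>Such a tableau is the row-by-row filling; it serves as the common end point in the
  connectedness argument.\<close>

lemma row_monotone_unique:
  assumes lam: "is_partition lam n" and S: "S \<in> Tab lam" and T: "T \<in> Tab lam"
    and mono: "\<And>k. k \<in> {1..<n} \<Longrightarrow> fst (box_of S k) \<le> fst (box_of S (k + 1))"
      "\<And>k. k \<in> {1..<n} \<Longrightarrow> fst (box_of T k) \<le> fst (box_of T (k + 1))"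
  shows "S = T"
proof -
  have n: "sum_list lam = n" using lam by (auto simp: is_partition_def)
  have mono': "fst (box_of U a) \<le> fst (box_of U b)"
    if "\<And>k. k \<in> {1..<n} \<Longrightarrow> fst (box_of U k) \<le> fst (box_of U (k + 1))" "1 \<le> a" "a \<le> b" "b \<le> n" for U a b
    using that(3,4)
  proof (induction b rule: dec_induct)
    case (step m)
    then show ?case using that(1)[of m] that(2) by auto
  qed simp
  \<comment> \<open>At the first disagreement, the box of \<open>k\<close> in \<open>S\<close> holds
    an entry of \<open>T\<close> not below \<open>k\<close>, so in \<open>T\<close> that box cannot
    precede the box of \<open>k\<close> in row order.\<close>
  have aux: "\<not> fst (box_of S k) < fst (box_of T k) \<and>
      (fst (box_of S k) = fst (box_of T k) \<longrightarrow> \<not> snd (box_of S k) < snd (box_of T k))"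
    if S: "S \<in> Tab lam" and T: "T \<in> Tab lam" and k: "k \<in> {1..n}"
      and mono: "\<And>k. k \<in> {1..<n} \<Longrightarrow> fst (box_of T k) \<le> fst (box_of T (k + 1))"
      and same: "\<And>a. a \<in> {1..<k} \<Longrightarrow> box_of S a = box_of T a" for S T k
  proof -
    obtain i j i' j' where b: "box_of S k = (i, j)" "box_of T k = (i', j')"
      by (cases "box_of S k"; cases "box_of T k")
    have yd: "(i, j) \<in> young_diagram lam" "(i', j') \<in> young_diagram lam"
      and ST: "S (i, j) = k" "T (i', j') = k"
      using box_of_in_diagram[OF S] box_of_in_diagram[OF T] entry_box_of[OF S] entry_box_of[OF T]
        k n b by metis+
    have range: "1 \<le> T (i, j)" "T (i, j) \<le> n" using Tab_entry_range[OF T yd(1)] n by auto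
    have ge: "k \<le> T (i, j)"
    proof (rule ccontr)
      assume "\<not> k \<le> T (i, j)"
      then have "box_of S (T (i, j)) = (i, j)" using same[of "T (i, j)"] box_of_entry[OF T yd(1)] range by simp
      then have "S (i, j) = T (i, j)" using entry_box_of[OF S, of "T (i, j)"] range n by force
      with ST \<open>\<not> k \<le> T (i, j)\<close> show False by simp
    qed
    have "i' \<le> i" using mono'[OF mono _ ge] range k box_of_entry[OF T yd(1)] b by simp
    moreover have "\<not> j < j'" if "i = i'"
      using Tab_less[OF lam T yd] that ge ST by auto
    ultimately show ?thesis using b by auto
  qed
  have "box_of S k = box_of T k" if "k \<in> {1..n}" for k
    using that
  proof (induction k rule: less_induct)
    case (less k)
    then have same: "box_of S a = box_of T a" if "a \<in> {1..<k}" for a using that by auto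
    show ?case
      using aux[OF S T less.prems mono(2) same] aux[OF T S less.prems mono(1) same[symmetric]]
      by (auto simp: prod_eq_iff)
  qed
  then have "tab_content S k = tab_content T k" if "k \<in> {1..n}" for k
    using that by (simp add: tab_content_def)
  then show ?thesis using tab_content_determines(2)[OF lam lam S T] by blast
qed

text \<open>The start of the induction on Jucys-Murphy elements: the first one is zero.\<close>

lemma tab_content_one:
  assumes lam: "is_partition lam n" and T: "T \<in> Tab lam" and n: "1 \<le> n"
  shows "tab_content T 1 = 0"
proof -
  have s: "sum_list lam = n" using lam by (simp add: is_partition_def)
  obtain i j where b: "box_of T 1 = (i, j)" by (cases "box_of T 1")
  have yd: "(i, j) \<in> young_diagram lam" and T1: "T (i, j) = 1"
    using box_of_in_diagram[OF T, of 1] entry_box_of[OF T, of 1] b n s by auto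
  have pos: "1 \<le> i" "1 \<le> j" using young_diagram_pos[OF yd] by auto
  have o: "(1, 1) \<in> young_diagram lam" using young_diagram_down[OF lam yd] pos by simp
  have "(i, j) = (1, 1)"
  proof (rule ccontr)
    assume "(i, j) \<noteq> (1, 1)"
    then have "T (1, 1) < 1" using Tab_less[OF lam T o yd] pos T1 by auto
    then show False using Tab_entry_range[OF T o] by simp
  qed
  then show ?thesis using b by (simp add: tab_content_def content_def)
qed

lemma transp_comp_neq:
  assumes "is_partition lam n" "T \<in> Tab lam" "k \<in> {1..<n}"
  shows "adj_transp k \<circ> T \<noteq> T"
proof
  assume eq: "adj_transp k \<circ> T = T"
  have "(adj_transp k \<circ> T) (box_of T k) = k + 1"
    using entry_box_of[OF assms(2), of k] assms by (simp add: is_partition_def)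
  then show False using entry_box_of[OF assms(2), of k] assms unfolding eq by (simp add: is_partition_def)
qed

text \<open>Connectedness is phrased through an invariant \<open>h\<close>, which avoids paths and
  is applied to the diagonal of a commuting matrix. Every tableau is driven to the row-by-row
  filling.\<close>

lemma Tab_connected:
  assumes lam: "is_partition lam n" and S: "S \<in> Tab lam" and T: "T \<in> Tab lam"
    and h: "\<And>k U. k \<in> {1..<n} \<Longrightarrow> U \<in> Tab lam \<Longrightarrow> adj_transp k \<circ> U \<in> Tab lam \<Longrightarrow> h (adj_transp k \<circ> U) = h U"
  shows "h S = h T"
proof -
  have n: "sum_list lam = n" using lam by (auto simp: is_partition_def)
  define row_mono where "row_mono U \<longleftrightarrow> (\<forall>k\<in>{1..<n}. fst (box_of U k) \<le> fst (box_of U (k + 1)))" for U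
  \<comment> \<open>A bounded potential: exchanging \<open>k\<close> and \<open>k + 1\<close> when
    \<open>k + 1\<close> lies in a higher row raises it by the difference of the row
    indices.\<close>
  define w where "w U = (\<Sum>b\<in>young_diagram lam. U b * fst b)" for U :: tableau
  have w_le: "w U \<le> (\<Sum>b\<in>young_diagram lam. n * fst b)" if "U \<in> Tab lam" for U
    unfolding w_def using Tab_entry_range[OF that] n by (intro sum_mono mult_right_mono) auto
  have reach: "\<exists>V\<in>Tab lam. row_mono V \<and> h V = h U" if "U \<in> Tab lam" for U
    using that
  proof (induction "(\<Sum>b\<in>young_diagram lam. n * fst b) - w U" arbitrary: U rule: less_induct)
    case less
    note U = \<open>U \<in> Tab lam\<close>
    show ?case
    proof (cases "row_mono U")
      case False
      then obtain k where k: "k \<in> {1..<n}" "fst (box_of U (k + 1)) < fst (box_of U k)"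
        by (auto simp: row_mono_def not_le)
      obtain i j i' j' where b: "box_of U k = (i, j)" "box_of U (k + 1) = (i', j')"
        by (cases "box_of U k"; cases "box_of U (k + 1)")
      let ?V = "adj_transp k \<circ> U"
      have V: "?V \<in> Tab lam"
        using Tab_consecutive_adjacent[OF lam U k(1) b] k(2) b by auto
      have kin: "k \<in> {1..sum_list lam}" "k + 1 \<in> {1..sum_list lam}" using k n by auto
      have yd: "(i, j) \<in> young_diagram lam" "(i', j') \<in> young_diagram lam"
        and Uk: "U (i, j) = k" "U (i', j') = k + 1"
        using box_of_in_diagram[OF U kin(1)] box_of_in_diagram[OF U kin(2)]
          entry_box_of[OF U kin(1)] entry_box_of[OF U kin(2)] b by auto
      have other: "?V b' = U b'" if "b' \<in> young_diagram lam" "b' \<noteq> (i, j)" "b' \<noteq> (i', j')" for b'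
      proof -
        have "U b' \<noteq> k" "U b' \<noteq> k + 1" using box_of_entry[OF U that(1)] b that by auto
        then show ?thesis by (simp add: Transposition.transpose_def)
      qed
      have "int (w ?V) - int (w U) = (\<Sum>b\<in>young_diagram lam. (int (?V b) - int (U b)) * int (fst b))"
        by (simp add: w_def sum_subtractf left_diff_distrib)
      also have "\<dots> = (\<Sum>b\<in>{(i, j), (i', j')}. (int (?V b) - int (U b)) * int (fst b))"
        using yd other by (intro sum.mono_neutral_right) auto
      also have "\<dots> = int i - int i'" using Uk k(2) b by auto
      finally have "w U < w ?V" using k(2) b by auto
      moreover have "w ?V \<le> (\<Sum>b\<in>young_diagram lam. n * fst b)" by (rule w_le[OF V])
      ultimately have "\<exists>V'\<in>Tab lam. row_mono V' \<and> h V' = h ?V"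
        by (intro less.hyps V) linarith
      then show ?thesis using h[OF k(1) U V] by simp
    qed (use U in blast)
  qed
  obtain S' T' where "S' \<in> Tab lam" "row_mono S'" "h S' = h S" "T' \<in> Tab lam" "row_mono T'" "h T' = h T"
    using reach S T by meson
  then show ?thesis using row_monotone_unique[OF lam, of S' T'] by (auto simp: row_mono_def)
qed

section \<open>Adding and removing a box\<close>

lemma
  assumes "lam \<in> up_set mu"
  shows up_set_partition: "is_partition lam (sum_list mu + 1)"
    and up_set_sum_list: "sum_list lam = sum_list mu + 1"
    and added_box_notin: "added_box lam mu \<notin> young_diagram mu"
    and up_set_diagram: "young_diagram lam = insert (added_box lam mu) (young_diagram mu)"
proof -
  from assms obtain b where b: "is_partition lam (sum_list mu + 1)" "b \<notin> young_diagram mu"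
    "young_diagram lam = insert b (young_diagram mu)"
    by (auto simp: up_set_def)
  then have "young_diagram lam - young_diagram mu = {b}" by auto
  then have "added_box lam mu = b" by (simp add: added_box_def)
  with b show "is_partition lam (sum_list mu + 1)" "sum_list lam = sum_list mu + 1"
    "added_box lam mu \<notin> young_diagram mu"
    "young_diagram lam = insert (added_box lam mu) (young_diagram mu)"
    by (auto simp: is_partition_def)
qed

lemma finite_up_set: "finite (up_set mu)"
proof (rule finite_subset)
  let ?n = "sum_list mu + 1"
  show "up_set mu \<subseteq> {xs. set xs \<subseteq> {..?n} \<and> length xs \<le> ?n}"
  proof clarify
    fix lam assume "lam \<in> up_set mu"
    then have lam: "\<forall>p\<in>set lam. 0 < p" "sum_list lam = ?n" by (auto simp: up_set_def is_partition_def)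
    have "length xs \<le> sum_list xs" if "\<forall>p\<in>set xs. 0 < p" for xs :: "nat list"
      using that by (induction xs) auto
    then have "length lam \<le> ?n" using lam by metis
    moreover have "set lam \<subseteq> {..?n}" using lam member_le_sum_list[of _ lam] by auto
    ultimately show "set lam \<subseteq> {..?n} \<and> length lam \<le> ?n" by simp
  qed
qed (rule finite_lists_length_le, simp)

lemma extend_tab_in_Tab:
  assumes mu: "is_partition mu m" and lam: "lam \<in> up_set mu" and R: "R \<in> Tab mu"
  shows "extend_tab lam mu R \<in> Tab lam"
proof (rule TabI)
  note yd = up_set_diagram[OF lam] and nb = added_box_notin[OF lam] and s = up_set_sum_list[OF lam]
  show "extend_tab lam mu R b = 0" if "b \<notin> young_diagram lam" for b
    using that Tab_outside[OF R, of b] by (auto simp: extend_tab_def yd)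
  have "bij_betw (extend_tab lam mu R) (young_diagram mu) {1..sum_list mu}"
    using Tab_bij[OF R] nb by (subst bij_betw_cong[of _ _ R]) (auto simp: extend_tab_def)
  then have "bij_betw (extend_tab lam mu R) (young_diagram mu \<union> {added_box lam mu})
      ({1..sum_list mu} \<union> {sum_list lam})"
    using nb s by (intro bij_betw_combine) (auto simp: extend_tab_def bij_betw_def)
  moreover have "{1..sum_list mu} \<union> {sum_list lam} = {1..sum_list lam}" using s by auto
  ultimately show "bij_betw (extend_tab lam mu R) (young_diagram lam) {1..sum_list lam}"
    by (simp add: yd)
  fix i j i' j' assume a: "(i, j) \<in> young_diagram lam" "(i', j') \<in> young_diagram lam"
    "i \<le> i'" "j \<le> j'" "(i, j) \<noteq> (i', j')"
  show "extend_tab lam mu R (i, j) < extend_tab lam mu R (i', j')"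
  proof (cases "(i', j') = added_box lam mu")
    case True
    then have "(i, j) \<in> young_diagram mu" using a yd by auto
    then show ?thesis using Tab_entry_range[OF R, of "(i, j)"] True a s by (simp add: extend_tab_def)
  next
    case False
    then have 1: "(i', j') \<in> young_diagram mu" using a yd by auto
    then have 2: "(i, j) \<in> young_diagram mu"
      using young_diagram_down[OF mu 1] a young_diagram_pos[OF a(1)] by blast
    then have "(i, j) \<noteq> added_box lam mu" using nb by auto
    then show ?thesis using Tab_less[OF mu R 2 1] a False by (simp add: extend_tab_def)
  qed
qed

lemma extend_tab_inject:
  assumes "lam \<in> up_set mu" "R \<in> Tab mu" "R' \<in> Tab mu"
  shows "extend_tab lam mu R = extend_tab lam mu R' \<longleftrightarrow> R = R'"
proof
  assume eq: "extend_tab lam mu R = extend_tab lam mu R'"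
  show "R = R'"
  proof
    fix b show "R b = R' b"
      using fun_cong[OF eq, of b] Tab_outside[OF assms(2)] Tab_outside[OF assms(3)] added_box_notin[OF assms(1)]
      by (cases "b = added_box lam mu") (auto simp: extend_tab_def)
  qed
qed simp

lemma box_of_extend_tab:
  assumes mu: "is_partition mu m" and lam: "lam \<in> up_set mu" and R: "R \<in> Tab mu" and a: "a \<in> {1..m}"
  shows "box_of (extend_tab lam mu R) a = box_of R a"
proof -
  have m: "sum_list mu = m" using mu by (simp add: is_partition_def)
  have b: "box_of R a \<in> young_diagram mu" "R (box_of R a) = a"
    using box_of_in_diagram[OF R] entry_box_of[OF R] a m by auto
  then have "extend_tab lam mu R (box_of R a) = a"
    using added_box_notin[OF lam] by (auto simp: extend_tab_def)
  then show ?thesis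
    using box_of_entry[OF extend_tab_in_Tab[OF mu lam R], of "box_of R a"] up_set_diagram[OF lam] b by simp
qed

lemma box_of_extend_tab_top:
  assumes mu: "is_partition mu m" and lam: "lam \<in> up_set mu" and R: "R \<in> Tab mu"
  shows "box_of (extend_tab lam mu R) (m + 1) = added_box lam mu"
proof -
  have "sum_list mu = m" using mu by (simp add: is_partition_def)
  then have "extend_tab lam mu R (added_box lam mu) = m + 1"
    using up_set_sum_list[OF lam] by (simp add: extend_tab_def)
  then show ?thesis
    using box_of_entry[OF extend_tab_in_Tab[OF mu lam R], of "added_box lam mu"] up_set_diagram[OF lam] by simp
qed

lemma transp_extend_tab:
  assumes "lam \<in> up_set mu" "k \<in> {1..<sum_list mu}"
  shows "adj_transp k \<circ> extend_tab lam mu R = extend_tab lam mu (adj_transp k \<circ> R)"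
  using up_set_sum_list[OF assms(1)] assms(2)
  by (auto simp: extend_tab_def fun_eq_iff Transposition.transpose_def)

text \<open>Standardness of the exchange depends only on the contents of \<open>k\<close> and
  \<open>k + 1\<close>, which the extension leaves alone since both entries are at most
  \<open>m\<close>.\<close>

lemma transp_extend_tab_in_Tab_iff:
  assumes mu: "is_partition mu m" and lam: "lam \<in> up_set mu" and R: "R \<in> Tab mu" and k: "k \<in> {1..<m}"
  shows "adj_transp k \<circ> extend_tab lam mu R \<in> Tab lam \<longleftrightarrow> adj_transp k \<circ> R \<in> Tab mu"
proof -
  have m: "sum_list mu = m" using mu by (simp add: is_partition_def)
  have lam': "is_partition lam (m + 1)" using up_set_partition[OF lam] m by simp
  have E: "extend_tab lam mu R \<in> Tab lam" by (rule extend_tab_in_Tab[OF mu lam R])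
  have "tab_content (extend_tab lam mu R) k = tab_content R k"
       "tab_content (extend_tab lam mu R) (k + 1) = tab_content R (k + 1)"
    using k box_of_extend_tab[OF mu lam R] by (auto simp: tab_content_def)
  moreover have "k \<in> {1..<m + 1}" using k by simp
  ultimately show ?thesis
    using tab_content_consecutive[OF mu R k] tab_content_consecutive[OF lam' E, of k] by fastforce
qed

text \<open>Induction: the last box of the last row can be removed, and a tableau of the smaller
  shape extends by the new largest entry.\<close>

lemma Tab_nonempty:
  assumes "is_partition lam n"
  shows "Tab lam \<noteq> {}"
  using assms
proof (induction n arbitrary: lam)
  case 0
  then have "lam = []" by (cases lam) (auto simp: is_partition_def)
  then have "young_diagram lam = {}" by (auto simp: young_diagram_def)
  then have "(\<lambda>_. 0) \<in> Tab lam" using \<open>lam = []\<close> by (simp add: Tab_def bij_betw_def)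
  then show ?case by blast
next
  case (Suc n)
  note lam = \<open>is_partition lam (Suc n)\<close>
  have "lam \<noteq> []" using lam by (auto simp: is_partition_def)
  define b where "b = (length lam, last lam)"
  have "0 < last lam" using lam \<open>lam \<noteq> []\<close> by (auto simp: is_partition_def)
  then have b: "b \<in> young_diagram lam"
    using \<open>lam \<noteq> []\<close> by (auto simp: b_def young_diagram_def last_conv_nth Suc_le_eq)
  have "\<exists>nu. is_partition nu (card (young_diagram lam - {b})) \<and> young_diagram nu = young_diagram lam - {b}"
  proof (rule ex_partition_of_down_set)
    fix i j i' j' assume a: "(i', j') \<in> young_diagram lam - {b}" "1 \<le> i" "i \<le> i'" "1 \<le> j" "j \<le> j'"
    then have "(i, j) \<noteq> b" using \<open>lam \<noteq> []\<close> by (auto simp: b_def young_diagram_def last_conv_nth)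
    then show "(i, j) \<in> young_diagram lam - {b}"
      using young_diagram_down[OF lam, of i' j' i j] a by auto
  qed (auto dest: young_diagram_pos)
  moreover have "card (young_diagram lam - {b}) = n"
    using b lam by (simp add: card_young_diagram is_partition_def)
  ultimately obtain nu where nu: "is_partition nu n" "young_diagram nu = young_diagram lam - {b}" by auto
  then have "lam \<in> up_set nu"
    using lam b unfolding up_set_def
    by (intro CollectI conjI exI[of _ b]) (auto simp: is_partition_def)
  then show ?case using Suc.IH[OF nu(1)] extend_tab_in_Tab[OF nu(1)] by blast
qed

lemma num_tab_pos: "is_partition lam k \<Longrightarrow> 0 < num_tab lam"
  using Tab_nonempty[of lam k] by (simp add: num_tab_def card_gt_0_iff)

text \<open>A box to the lower right of the largest entry would have to hold a larger one.\<close>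

lemma box_of_top_removable:
  assumes mu: "is_partition mu m" and m: "1 \<le> m" and R: "R \<in> Tab mu"
  shows "box_of R m \<in> removable_boxes mu"
proof -
  let ?b = "box_of R m"
  have s: "sum_list mu = m" using mu by (simp add: is_partition_def)
  have b: "?b \<in> young_diagram mu" "R ?b = m"
    using box_of_in_diagram[OF R] entry_box_of[OF R] m s by auto
  have "\<exists>nu. is_partition nu (card (young_diagram mu - {?b})) \<and> young_diagram nu = young_diagram mu - {?b}"
  proof (rule ex_partition_of_down_set)
    fix i j i' j' assume a: "(i', j') \<in> young_diagram mu - {?b}" "1 \<le> i" "i \<le> i'" "1 \<le> j" "j \<le> j'"
    then have 1: "(i, j) \<in> young_diagram mu" using young_diagram_down[OF mu, of i' j' i j] by auto
    have "(i, j) \<noteq> ?b"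
    proof
      assume "(i, j) = ?b"
      then have "m < R (i', j')" using Tab_less[OF mu R 1, of i' j'] a b by auto
      then show False using Tab_entry_range[OF R, of "(i', j')"] a s by auto
    qed
    with 1 show "(i, j) \<in> young_diagram mu - {?b}" by auto
  qed (auto dest: young_diagram_pos)
  with b show ?thesis by (auto simp: removable_boxes_def)
qed

text \<open>The converse: fill the diagram without \<open>b\<close> arbitrarily and put
  \<open>m\<close> into \<open>b\<close>. So the removable boxes are exactly the positions of
  \<open>m\<close>.\<close>

lemma removable_box_of_top:
  assumes mu: "is_partition mu m" and b: "b \<in> removable_boxes mu"
  obtains R where "R \<in> Tab mu" "box_of R m = b"
proof -
  from b obtain nu l where nu: "is_partition nu l" "young_diagram nu = young_diagram mu - {b}"
    and bmu: "b \<in> young_diagram mu"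
    by (auto simp: removable_boxes_def)
  have s: "sum_list mu = m" "sum_list nu = l" using mu nu by (auto simp: is_partition_def)
  have "card (young_diagram mu) = card (young_diagram nu) + 1"
    using card_Suc_Diff1[OF finite_young_diagram bmu] nu(2) by simp
  then have m: "m = l + 1" using s by (simp add: card_young_diagram)
  have up: "mu \<in> up_set nu"
    using mu m s bmu nu(2) unfolding up_set_def by (intro CollectI conjI exI[of _ b]) auto
  then have "added_box mu nu = b" using bmu nu by (simp add: added_box_def insert_absorb Diff_Diff_Int)
  moreover obtain R where "R \<in> Tab nu" using Tab_nonempty[OF nu(1)] by blast
  ultimately show thesis
    using that[OF extend_tab_in_Tab[OF nu(1) up]] box_of_extend_tab_top[OF nu(1) up] m by simp
qed

section \<open>Young's orthogonal form\<close>

definition young_coeff :: "tableau \<Rightarrow> nat \<Rightarrow> real" where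
  "young_coeff T k = 1 / real_of_int (tab_content T (k + 1) - tab_content T k)"

definition young_coeff_off :: "tableau \<Rightarrow> nat \<Rightarrow> real" where
  "young_coeff_off T k = sqrt (1 - (young_coeff T k)\<^sup>2)"

text \<open>Ignoring standardness is harmless, because the second coefficient vanishes exactly when
  \<open>s\<^sub>k T\<close> is not standard; this makes the braid relation a case-free computation.\<close>

definition young_step :: "nat \<Rightarrow> (tableau \<Rightarrow> real) \<Rightarrow> tableau \<Rightarrow> real" where
  "young_step k f T = young_coeff T k * f T + young_coeff_off T k * f (adj_transp k \<circ> T)"

text \<open>Acting as the identity off the standard tableaux makes this a self-map of the full
  function space on which the relations hold globally.\<close>

definition young_op :: "nat list \<Rightarrow> nat \<Rightarrow> (tableau \<Rightarrow> real) \<Rightarrow> tableau \<Rightarrow> real" where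
  "young_op lam k f = (\<lambda>T. if T \<in> Tab lam then young_step k f T else f T)"

lemma tab_content_transp: "tab_content (adj_transp k \<circ> T) a = tab_content T (adj_transp k a)"
  by (simp only: tab_content_def box_of_transp)

lemma young_coeff_transp_same: "young_coeff (adj_transp k \<circ> T) k = - young_coeff T k"
  unfolding young_coeff_def tab_content_transp
  by (simp add: minus_divide_right del: of_int_diff flip: of_int_minus)

lemma young_coeff_off_transp_same: "young_coeff_off (adj_transp k \<circ> T) k = young_coeff_off T k"
  unfolding young_coeff_off_def young_coeff_transp_same by simp

lemma young_coeff_transp_far:
  assumes "j + 2 \<le> k \<or> k + 2 \<le> j"
  shows "young_coeff (adj_transp k \<circ> T) j = young_coeff T j"
proof -
  have "adj_transp k j = j" "adj_transp k (j + 1) = j + 1"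
    using assms by (auto simp: Transposition.transpose_def)
  then show ?thesis by (simp only: young_coeff_def tab_content_transp)
qed

lemma int_recip_square_le_1: "(1 / real_of_int d)\<^sup>2 \<le> 1"
proof (cases "d = 0")
  case False
  then have "1 \<le> \<bar>real_of_int d\<bar>" by linarith
  then have "\<bar>1 / real_of_int d\<bar> \<le> 1" by simp
  then show ?thesis by (simp only: abs_square_le_1)
qed simp

lemma young_coeff_off_square: "young_coeff_off T k * young_coeff_off T k = 1 - (young_coeff T k)\<^sup>2"
  unfolding young_coeff_off_def young_coeff_def
  using int_recip_square_le_1[of "tab_content T (k + 1) - tab_content T k"] by simp

lemma young_coeff_off_eq_0:
  assumes "is_partition lam n" "T \<in> Tab lam" "k \<in> {1..<n}" "adj_transp k \<circ> T \<notin> Tab lam"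
  shows "young_coeff_off T k = 0"
proof -
  define d where "d = tab_content T (k + 1) - tab_content T k"
  have "\<bar>d\<bar> = 1" using tab_content_consecutive(2)[OF assms] by (simp add: d_def)
  then have "d = 1 \<or> d = -1" by linarith
  then show ?thesis unfolding young_coeff_off_def young_coeff_def d_def[symmetric] by auto
qed

lemma young_coeff_off_neq_0:
  assumes "is_partition lam n" "T \<in> Tab lam" "k \<in> {1..<n}" "adj_transp k \<circ> T \<in> Tab lam"
  shows "young_coeff_off T k \<noteq> 0"
proof
  define d where "d = tab_content T (k + 1) - tab_content T k"
  assume "young_coeff_off T k = 0"
  then have "1 - (1 / real_of_int d)\<^sup>2 = 0"
    unfolding young_coeff_off_def young_coeff_def d_def by simp
  moreover have "d \<noteq> 0" "2 \<le> \<bar>d\<bar>" using tab_content_consecutive(1)[OF assms] by (auto simp: d_def)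
  ultimately have "(real_of_int d)\<^sup>2 = 1" by (simp add: power_divide field_simps)
  then have "d\<^sup>2 = 1" by (metis of_int_eq_1_iff of_int_power)
  then show False using \<open>2 \<le> \<bar>d\<bar>\<close> by (auto simp: power2_eq_1_iff)
qed

text \<open>At a nonstandard neighbour the value of \<open>f\<close> is multiplied by 0. Agreement
  of \<open>f\<close> and \<open>f'\<close> on standard tableaux thus suffices, and compositions of
  operators reduce to compositions of steps.\<close>

lemma young_op_eq_step:
  assumes "is_partition lam n" "T \<in> Tab lam" "k \<in> {1..<n}" "\<And>U. U \<in> Tab lam \<Longrightarrow> f U = f' U"
  shows "young_op lam k f T = young_step k f' T"
proof (cases "adj_transp k \<circ> T \<in> Tab lam")
  case True
  then show ?thesis using assms(2,4) by (simp add: young_op_def young_step_def)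
next
  case False
  then show ?thesis using assms(2,4) young_coeff_off_eq_0[OF assms(1-3)]
    by (simp add: young_op_def young_step_def)
qed

text \<open>The exchange flips the sign of the diagonal coefficient and keeps the other, so cross
  terms cancel and the squares add up to 1.\<close>

lemma young_op_involutive:
  assumes "is_partition lam n" "k \<in> {1..<n}"
  shows "young_op lam k \<circ> young_op lam k = id"
proof (intro ext)
  fix f T
  show "(young_op lam k \<circ> young_op lam k) f T = id f T"
  proof (cases "T \<in> Tab lam")
    case True
    have tt: "adj_transp k \<circ> (adj_transp k \<circ> T) = T"
      unfolding comp_assoc[symmetric] transpose_comp_involutory by simp
    have "young_op lam k (young_op lam k f) T = young_step k (young_step k f) T"
      using young_op_eq_step[OF assms(1) _ assms(2)] True by blast
    also have "\<dots> = ((young_coeff T k)\<^sup>2 + young_coeff_off T k * young_coeff_off T k) * f T"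
      unfolding young_step_def young_coeff_transp_same young_coeff_off_transp_same tt
      by (simp add: algebra_simps power2_eq_square)
    also have "\<dots> = f T" unfolding young_coeff_off_square by simp
    finally show ?thesis by simp
  qed (simp add: young_op_def)
qed

lemma young_op_commute:
  assumes "is_partition lam n" "j \<in> {1..<n}" "k \<in> {1..<n}" "j + 2 \<le> k"
  shows "young_op lam j \<circ> young_op lam k = young_op lam k \<circ> young_op lam j"
proof (intro ext)
  fix f T
  show "(young_op lam j \<circ> young_op lam k) f T = (young_op lam k \<circ> young_op lam j) f T"
  proof (cases "T \<in> Tab lam")
    case True
    have tt: "adj_transp j \<circ> (adj_transp k \<circ> T) = adj_transp k \<circ> (adj_transp j \<circ> T)"
      unfolding comp_assoc[symmetric]
      using coxeter_rels_commute[OF coxeter_rels_adj_transp[of n], of j k] assms by simp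
    have far: "young_coeff (adj_transp k \<circ> T) j = young_coeff T j"
      "young_coeff (adj_transp j \<circ> T) k = young_coeff T k"
      using assms(4) by (intro young_coeff_transp_far; simp)+
    have "young_op lam j (young_op lam k f) T = young_step j (young_step k f) T"
      "young_op lam k (young_op lam j f) T = young_step k (young_step j f) T"
      using young_op_eq_step[OF assms(1)] assms(2,3) True by blast+
    moreover have "young_step j (young_step k f) T = young_step k (young_step j f) T"
      unfolding young_step_def young_coeff_off_def far tt by (simp add: algebra_simps)
    ultimately show ?thesis by simp
  qed (simp add: young_op_def)
qed

text \<open>Both sides expand over the six rearrangements of \<open>k, k+1, k+2\<close> in
  \<open>T\<close>. All coefficients are functions of the reciprocals \<open>x\<close>,
  \<open>y\<close>, \<open>z\<close> of the three content differences.\<close>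

lemma young_op_braid:
  assumes lam: "is_partition lam n" and k: "1 \<le> k" "k + 1 < n"
  shows "young_op lam k \<circ> young_op lam (k + 1) \<circ> young_op lam k =
    young_op lam (k + 1) \<circ> young_op lam k \<circ> young_op lam (k + 1)"
proof (intro ext)
  fix f T
  show "(young_op lam k \<circ> young_op lam (k + 1) \<circ> young_op lam k) f T =
    (young_op lam (k + 1) \<circ> young_op lam k \<circ> young_op lam (k + 1)) f T"
  proof (cases "T \<in> Tab lam")
    case True
    have kin: "k \<in> {1..<n}" "k + 1 \<in> {1..<n}" using k by auto
    define s t where "s = adj_transp k" and "t = adj_transp (k + 1)"
    define c0 c1 c2 where "c0 = tab_content T k" and "c1 = tab_content T (k + 1)"
      and "c2 = tab_content T (k + 2)"
    define x y z where "x = 1 / real_of_int (c1 - c0)" and "y = 1 / real_of_int (c2 - c1)"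
      and "z = 1 / real_of_int (c2 - c0)"
    define p q r where "p = sqrt (1 - x\<^sup>2)" and "q = sqrt (1 - y\<^sup>2)" and "r = sqrt (1 - z\<^sup>2)"
    have ne: "c1 \<noteq> c0" "c2 \<noteq> c1" "c2 \<noteq> c0"
      using tab_content_consecutive_neq[OF lam True kin(1)] tab_content_consecutive_neq[OF lam True kin(2)]
        tab_content_second_neq[OF lam True k] by (auto simp: c0_def c1_def c2_def)
    have recip: "1 / u * (1 / v) = 1 / (u + v) * (1 / u + 1 / v)"
      if "u \<noteq> 0" "v \<noteq> 0" "u + v \<noteq> 0" for u v :: real
    proof -
      have "1 / u + 1 / v = (u + v) / (u * v)" using that by (simp add: add_frac_eq add.commute)
      then show ?thesis using that by simp
    qed
    have "real_of_int (c2 - c0) = real_of_int (c1 - c0) + real_of_int (c2 - c1)" by simp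
    moreover have "real_of_int (c1 - c0) \<noteq> 0" "real_of_int (c2 - c1) \<noteq> 0" "real_of_int (c2 - c0) \<noteq> 0"
      using ne by simp_all
    ultimately have xyz: "x * y = z * (x + y)"
      unfolding x_def y_def z_def by (metis recip)
    have sq: "p * p = 1 - x\<^sup>2" "q * q = 1 - y\<^sup>2"
      unfolding p_def q_def x_def y_def
      using int_recip_square_le_1[of "c1 - c0"] int_recip_square_le_1[of "c2 - c1"] by simp_all
    have val: "s k = k + 1" "s (k + 1) = k" "s (k + 2) = k + 2" "t k = k" "t (k + 1) = k + 2" "t (k + 2) = k + 1"
      by (auto simp: s_def t_def Transposition.transpose_def)
    have cs: "tab_content (s \<circ> U) a = tab_content U (s a)" "tab_content (t \<circ> U) a = tab_content U (t a)" for U a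
      unfolding s_def t_def by (rule tab_content_transp)+
    have k2: "k + 1 + 1 = k + 2" by simp
    have neg: "1 / real_of_int (a - b) = - (1 / real_of_int (b - a))" for a b
      by (metis minus_diff_eq minus_divide_right of_int_minus)
    have coeff: "young_coeff T k = x" "young_coeff T (k + 1) = y"
      "young_coeff (s \<circ> T) k = - x" "young_coeff (s \<circ> T) (k + 1) = z"
      "young_coeff (t \<circ> T) k = z" "young_coeff (t \<circ> T) (k + 1) = - y"
      "young_coeff (t \<circ> (s \<circ> T)) k = y" "young_coeff (s \<circ> (t \<circ> T)) (k + 1) = x"
      unfolding young_coeff_def k2 cs val c0_def[symmetric] c1_def[symmetric] c2_def[symmetric]
      by (simp_all only: x_def y_def z_def neg[of c0 c1] neg[of c1 c2])
    have off: "young_coeff_off T k = p" "young_coeff_off T (k + 1) = q"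
      "young_coeff_off (s \<circ> T) k = p" "young_coeff_off (s \<circ> T) (k + 1) = r"
      "young_coeff_off (t \<circ> T) k = r" "young_coeff_off (t \<circ> T) (k + 1) = q"
      "young_coeff_off (t \<circ> (s \<circ> T)) k = q" "young_coeff_off (s \<circ> (t \<circ> T)) (k + 1) = p"
      unfolding young_coeff_off_def coeff p_def q_def r_def by simp_all
    have tt: "s \<circ> (s \<circ> T) = T" "t \<circ> (t \<circ> T) = T"
      unfolding comp_assoc[symmetric] s_def t_def transpose_comp_involutory by simp_all
    have "s \<circ> t \<circ> s = t \<circ> s \<circ> t"
      using coxeter_rels_adj_transp[of n] k unfolding coxeter_rels_def s_def t_def by blast
    then have br: "s \<circ> (t \<circ> (s \<circ> T)) = t \<circ> (s \<circ> (t \<circ> T))"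
      by (simp only: comp_assoc[symmetric])
    have step: "young_step k g U = young_coeff U k * g U + young_coeff_off U k * g (s \<circ> U)"
      "young_step (k + 1) g U = young_coeff U (k + 1) * g U + young_coeff_off U (k + 1) * g (t \<circ> U)" for g U
      by (simp_all only: young_step_def s_def t_def)
    have l: "young_op lam k (young_op lam (k + 1) (young_op lam k f)) T =
        young_step k (young_step (k + 1) (young_step k f)) T"
      "young_op lam (k + 1) (young_op lam k (young_op lam (k + 1) f)) T =
        young_step (k + 1) (young_step k (young_step (k + 1) f)) T"
      using young_op_eq_step[OF lam _ kin(1)] young_op_eq_step[OF lam _ kin(2)] True by simp_all
    have "young_step k (young_step (k + 1) (young_step k f)) T =
        (x\<^sup>2 * y + p * p * z) * f T + p * (x * y - z * x) * f (s \<circ> T) + x * q * z * f (t \<circ> T)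
        + x * q * r * f (s \<circ> (t \<circ> T)) + p * r * y * f (t \<circ> (s \<circ> T)) + p * q * r * f (s \<circ> (t \<circ> (s \<circ> T)))"
      unfolding step coeff off tt by (simp add: algebra_simps power2_eq_square)
    also have "\<dots> = (y\<^sup>2 * x + q * q * z) * f T + p * y * z * f (s \<circ> T) + q * (x * y - z * y) * f (t \<circ> T)
        + x * q * r * f (s \<circ> (t \<circ> T)) + p * r * y * f (t \<circ> (s \<circ> T)) + p * q * r * f (s \<circ> (t \<circ> (s \<circ> T)))"
    proof -
      \<comment> \<open>From \<open>x y = z (x + y)\<close> follows \<open>x\<^sup>2 y - y\<^sup>2 x
        = z (x + y) (x - y) = z x\<^sup>2 - z y\<^sup>2\<close>.\<close>
      have 1: "x\<^sup>2 * y + p * p * z = y\<^sup>2 * x + q * q * z"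
        unfolding sq using xyz by algebra
      have 2: "x * y - z * x = y * z" "x * y - z * y = x * z" using xyz by algebra+
      show ?thesis unfolding 1 2 by (simp add: algebra_simps)
    qed
    also have "\<dots> = young_step (k + 1) (young_step k (young_step (k + 1) f)) T"
      unfolding step coeff off tt br by (simp add: algebra_simps power2_eq_square)
    finally show ?thesis using l by simp
  qed (simp add: young_op_def)
qed

lemma coxeter_rels_young_op:
  assumes "is_partition lam n"
  shows "coxeter_rels n (young_op lam)"
  unfolding coxeter_rels_def
  using young_op_involutive[OF assms] young_op_braid[OF assms] young_op_commute[OF assms] by blast

section \<open>Matrices of the generators and existence of the form\<close>

definition young_mat :: "nat list \<Rightarrow> nat \<Rightarrow> tableau \<Rightarrow> tableau \<Rightarrow> real" where
  "young_mat lam k S T = (if S \<in> Tab lam \<and> T \<in> Tab lam then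
     (if T = S then young_coeff S k else 0) + (if T = adj_transp k \<circ> S then young_coeff_off S k else 0)
   else 0)"

text \<open>Turns matrix products into compositions and the identity matrix into \<open>id\<close>,
  faithfully on matrices supported on \<open>I\<close>; this carries the homomorphism theorem over
  to matrices.\<close>

definition extend_op :: "'i set \<Rightarrow> ('i \<Rightarrow> 'i \<Rightarrow> real) \<Rightarrow> ('i \<Rightarrow> real) \<Rightarrow> 'i \<Rightarrow> real" where
  "extend_op I A f = (\<lambda>i. if i \<in> I then matr_app I A f i else f i)"

lemma extend_op_matr_mult:
  assumes "finite I"
  shows "extend_op I (matr_mult I A B) = extend_op I A \<circ> extend_op I B"
proof (intro ext)
  fix f i
  show "extend_op I (matr_mult I A B) f i = (extend_op I A \<circ> extend_op I B) f i"
    using matr_app_matr_mult[OF assms assms, of A B f]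
    by (auto simp: extend_op_def matr_app_def)
qed

lemma extend_op_id_matr: "finite I \<Longrightarrow> extend_op I (id_matr I) = id"
  by (auto simp: extend_op_def matr_app_def id_matr_def fun_eq_iff if_distrib[of "\<lambda>x. x * _"] cong: if_cong)

lemma extend_op_inject:
  assumes I: "finite I" and A: "A \<in> mats I I" "B \<in> mats I I" and eq: "extend_op I A = extend_op I B"
  shows "A = B"
proof (rule matr_eqI_app[OF I A])
  fix x :: "'a \<Rightarrow> real" assume "x \<in> vecs I"
  show "matr_app I A x = matr_app I B x"
  proof
    fix i
    show "matr_app I A x i = matr_app I B x i"
      using fun_cong[OF fun_cong[OF eq, of x], of i] matr_app_in_vecs[OF A(1), of x] matr_app_in_vecs[OF A(2), of x]
      by (cases "i \<in> I") (auto simp: extend_op_def vecs_def)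
  qed
qed

lemma transp_comp_eq_iff: "T = adj_transp k \<circ> S \<longleftrightarrow> S = adj_transp k \<circ> T"
proof -
  have "adj_transp k \<circ> (adj_transp k \<circ> U) = U" for U :: "'a \<Rightarrow> nat"
    unfolding comp_assoc[symmetric] transpose_comp_involutory by simp
  then show ?thesis by metis
qed

lemma young_mat_in_mats: "young_mat lam k \<in> mats (Tab lam) (Tab lam)"
  by (auto simp: mats_def young_mat_def)

lemma young_mat_sym: "young_mat lam k S T = young_mat lam k T S"
proof -
  have "T = adj_transp k \<circ> S \<longleftrightarrow> S = adj_transp k \<circ> T" by (rule transp_comp_eq_iff)
  moreover have "young_coeff_off T k = young_coeff_off S k" if "T = adj_transp k \<circ> S"
    unfolding that by (rule young_coeff_off_transp_same)
  ultimately show ?thesis unfolding young_mat_def by presburger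
qed

lemma young_op_eq_extend_op:
  assumes "is_partition lam n" "k \<in> {1..<n}"
  shows "young_op lam k = extend_op (Tab lam) (young_mat lam k)"
proof (intro ext)
  fix f T
  show "young_op lam k f T = extend_op (Tab lam) (young_mat lam k) f T"
  proof (cases "T \<in> Tab lam")
    case True
    have "matr_app (Tab lam) (young_mat lam k) f T =
      (\<Sum>U\<in>Tab lam. (if U = T then young_coeff T k * f T else 0) +
         (if U = adj_transp k \<circ> T then young_coeff_off T k * f (adj_transp k \<circ> T) else 0))"
      unfolding matr_app_def using True by (intro sum.cong refl) (simp add: young_mat_def distrib_right)
    also have "\<dots> = young_coeff T k * f T +
        (if adj_transp k \<circ> T \<in> Tab lam then young_coeff_off T k * f (adj_transp k \<circ> T) else 0)"
      using True by (simp add: sum.distrib)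
    also have "\<dots> = young_step k f T"
      using young_coeff_off_eq_0[OF assms(1) True assms(2)] by (simp add: young_step_def)
    finally show ?thesis using True by (simp add: young_op_def extend_op_def)
  qed (simp add: young_op_def extend_op_def)
qed

text \<open>A symmetric involution.\<close>

lemma unitary_young_mat:
  assumes "is_partition lam n" "k \<in> {1..<n}"
  shows "unitary_on (Tab lam) (young_mat lam k)"
proof -
  have "extend_op (Tab lam) (matr_mult (Tab lam) (young_mat lam k) (young_mat lam k)) = extend_op (Tab lam) (id_matr (Tab lam))"
    using young_op_involutive[OF assms]
    by (simp add: extend_op_matr_mult extend_op_id_matr young_op_eq_extend_op[OF assms])
  then have "matr_mult (Tab lam) (young_mat lam k) (young_mat lam k) = id_matr (Tab lam)"
    by (rule extend_op_inject[rotated 3])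
      (auto intro: matr_mult_in_mats young_mat_in_mats id_matr_in_mats)
  moreover have "adj (young_mat lam k) = young_mat lam k"
    by (auto simp: adj_def fun_eq_iff intro: young_mat_sym)
  ultimately show ?thesis by (simp add: unitary_on_def young_mat_in_mats)
qed

lemma matr_app_young_mat_unit_vect:
  assumes "T \<in> Tab lam"
  shows "matr_app (Tab lam) (young_mat lam k) (unit_vect T) =
     (\<lambda>S. young_coeff T k * unit_vect T S +
        (if adj_transp k \<circ> T \<in> Tab lam then young_coeff_off T k * unit_vect (adj_transp k \<circ> T) S else 0))"
  unfolding matr_app_unit_vect[OF finite_Tab assms]
  by (rule ext, subst young_mat_sym) (use assms in \<open>auto simp: young_mat_def unit_vect_def\<close>)

text \<open>The invariant \<open>P\<close> guarantees that every operator in the representation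
  comes from a unitary matrix; faithfulness of \<open>extend_op\<close> makes this matrix unique, so
  multiplicativity descends to it.\<close>

lemma ex_young_orthogonal_form:
  assumes lam: "is_partition lam n"
  shows "\<exists>\<rho>. is_young_orthogonal_form lam \<rho>"
proof -
  let ?I = "Tab lam"
  have n: "sum_list lam = n" using lam by (simp add: is_partition_def)
  define P where "P X \<longleftrightarrow> (\<exists>A. unitary_on ?I A \<and> X = extend_op ?I A)" for X
  have "P id" unfolding P_def
    by (intro exI[of _ "id_matr ?I"]) (simp add: unitary_on_id extend_op_id_matr)
  moreover have "P (young_op lam k \<circ> X)" if "k \<in> {1..<n}" "P X" for k X
    using that unitary_on_matr_mult[OF finite_Tab unitary_young_mat[OF lam that(1)]]
    unfolding P_def young_op_eq_extend_op[OF lam that(1)] by (metis extend_op_matr_mult finite_Tab)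
  ultimately obtain R where R: "\<And>g. g permutes {1..n} \<Longrightarrow> P (R g)"
    "\<And>g h. g permutes {1..n} \<Longrightarrow> h permutes {1..n} \<Longrightarrow> R (g \<circ> h) = R g \<circ> R h"
    "\<And>k. k \<in> {1..<n} \<Longrightarrow> R (adj_transp k) = young_op lam k"
    using coxeter_hom[OF coxeter_rels_young_op[OF lam], of P] by blast
  define \<rho> where "\<rho> g = (SOME A. unitary_on ?I A \<and> R g = extend_op ?I A)" for g
  have \<rho>: "unitary_on ?I (\<rho> g)" "R g = extend_op ?I (\<rho> g)" if "g permutes {1..n}" for g
    using R(1)[OF that] someI_ex[of "\<lambda>A. unitary_on ?I A \<and> R g = extend_op ?I A"]
    unfolding P_def \<rho>_def by blast+
  have uniq: "A = B" if "unitary_on ?I A" "unitary_on ?I B" "extend_op ?I A = extend_op ?I B" for A B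
    using that extend_op_inject[OF finite_Tab] by (auto simp: unitary_on_def)
  have hom: "\<rho> (g \<circ> h) = matr_mult ?I (\<rho> g) (\<rho> h)" if "g permutes {1..n}" "h permutes {1..n}" for g h
    using that R(2)[OF that] \<rho>(2)[OF that(1)] \<rho>(2)[OF that(2)] \<rho>(2)[OF permutes_compose[OF that(2,1)]]
    by (intro uniq \<rho>(1) unitary_on_matr_mult permutes_compose) (simp_all add: extend_op_matr_mult)
  have gen: "\<rho> (adj_transp k) = young_mat lam k" if "k \<in> {1..<n}" for k
    using R(3)[OF that] \<rho>(2)[OF permutes_adj_transp[OF that]] young_op_eq_extend_op[OF lam that]
    by (intro uniq \<rho>(1)[OF permutes_adj_transp[OF that]] unitary_young_mat[OF lam that]) simp
  have D: "young_coeff T k = 1 / real_of_int (tab_dist T (k + 1) k)"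
    "young_coeff_off T k = sqrt (1 - 1 / (real_of_int (tab_dist T (k + 1) k))\<^sup>2)" for T k
    by (simp_all add: young_coeff_off_def young_coeff_def tab_dist_content power_one_over)
  have "is_young_orthogonal_form lam \<rho>"
    unfolding is_young_orthogonal_form_def n Let_def
    using \<rho>(1) hom gen matr_app_young_mat_unit_vect[of _ lam, unfolded D] by simp
  then show ?thesis by blast
qed

lemma young_rep_form: "is_partition lam n \<Longrightarrow> is_young_orthogonal_form lam (young_rep lam)"
  unfolding young_rep_def by (erule someI_ex[OF ex_young_orthogonal_form])

lemma
  assumes lam: "is_partition lam n"
  shows young_rep_unitary: "g permutes {1..n} \<Longrightarrow> unitary_on (Tab lam) (young_rep lam g)"
    and young_rep_comp: "g permutes {1..n} \<Longrightarrow> h permutes {1..n} \<Longrightarrow>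
      young_rep lam (g \<circ> h) = matr_mult (Tab lam) (young_rep lam g) (young_rep lam h)"
    and young_rep_adj_transp: "k \<in> {1..<n} \<Longrightarrow> young_rep lam (adj_transp k) = young_mat lam k"
proof -
  have n: "sum_list lam = n" using lam by (simp add: is_partition_def)
  note form = young_rep_form[OF lam, unfolded is_young_orthogonal_form_def n Let_def]
  show U: "unitary_on (Tab lam) (young_rep lam g)" if "g permutes {1..n}" for g using form that by blast
  show "young_rep lam (g \<circ> h) = matr_mult (Tab lam) (young_rep lam g) (young_rep lam h)"
    if "g permutes {1..n}" "h permutes {1..n}" using form that by blast
  have D: "1 / real_of_int (tab_dist T (k + 1) k) = young_coeff T k"
    "sqrt (1 - 1 / (real_of_int (tab_dist T (k + 1) k))\<^sup>2) = young_coeff_off T k" for T k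
    by (simp_all add: young_coeff_off_def young_coeff_def tab_dist_content power_one_over)
  show "young_rep lam (adj_transp k) = young_mat lam k" if k: "k \<in> {1..<n}"
  proof (intro ext)
    fix S T
    show "young_rep lam (adj_transp k) S T = young_mat lam k S T"
    proof (cases "T \<in> Tab lam")
      case True
      then have "matr_app (Tab lam) (young_rep lam (adj_transp k)) (unit_vect T) =
          matr_app (Tab lam) (young_mat lam k) (unit_vect T)"
        unfolding matr_app_young_mat_unit_vect[OF True] using form k unfolding D by blast
      then show ?thesis by (simp only: matr_app_unit_vect[OF finite_Tab True] fun_eq_iff)
    next
      case False
      then show ?thesis using U[OF permutes_adj_transp[OF k]] by (auto simp: unitary_on_def mats_def young_mat_def)
    qed
  qed
qed

text \<open>Multiplicativity makes the image of \<open>id\<close> idempotent, and a unitary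
  idempotent is the identity.\<close>

lemma young_rep_id:
  assumes lam: "is_partition lam n"
  shows "young_rep lam id = id_matr (Tab lam)"
proof -
  have U: "unitary_on (Tab lam) (young_rep lam id)" by (rule young_rep_unitary[OF lam permutes_id])
  have m: "young_rep lam id \<in> mats (Tab lam) (Tab lam)" using U by (simp add: unitary_on_def)
  have "young_rep lam id = matr_mult (Tab lam) (young_rep lam id) (young_rep lam id)"
    using young_rep_comp[OF lam permutes_id permutes_id] by simp
  then have "matr_mult (Tab lam) (adj (young_rep lam id)) (young_rep lam id) =
    matr_mult (Tab lam) (matr_mult (Tab lam) (adj (young_rep lam id)) (young_rep lam id)) (young_rep lam id)"
    by (simp add: matr_mult_assoc)
  then show ?thesis using U matr_mult_id_left[OF finite_Tab m] by (simp add: unitary_on_def)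
qed

section \<open>Restriction to the permutations that fix the largest entry\<close>

lemma Psi_in_mats:
  assumes "is_partition mu m" "lam \<in> up_set mu"
  shows "Psi lam mu \<in> mats (Tab lam) (Tab mu)"
  using extend_tab_in_Tab[OF assms] by (auto simp: mats_def Psi_def unit_vect_def)

lemma matr_mult_Psi:
  assumes "is_partition mu m" "lam \<in> up_set mu"
  shows "matr_mult (Tab lam) A (Psi lam mu) S R = (if R \<in> Tab mu then A S (extend_tab lam mu R) else 0)"
  using extend_tab_in_Tab[OF assms, of R]
  by (auto simp: matr_mult_def Psi_def unit_vect_def if_distrib[of "\<lambda>x. _ * x"] cong: if_cong)

text \<open>For \<open>k < m\<close> the exchange involves only entries of \<open>mu\<close>, whose
  contents and standardness are unaffected by the extension.\<close>

lemma Psi_intertwines_young_mat: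
  assumes mu: "is_partition mu m" and lam: "lam \<in> up_set mu" and k: "k \<in> {1..<m}"
  shows "matr_mult (Tab lam) (young_mat lam k) (Psi lam mu) = matr_mult (Tab mu) (Psi lam mu) (young_mat mu k)"
proof (intro ext)
  fix S R
  let ?e = "extend_tab lam mu"
  have m: "sum_list mu = m" using mu by (simp add: is_partition_def)
  show "matr_mult (Tab lam) (young_mat lam k) (Psi lam mu) S R = matr_mult (Tab mu) (Psi lam mu) (young_mat mu k) S R"
  proof (cases "R \<in> Tab mu")
    case True
    note R = True and eR = extend_tab_in_Tab[OF mu lam True]
    have l: "matr_mult (Tab lam) (young_mat lam k) (Psi lam mu) S R = young_mat lam k S (?e R)"
      by (simp only: matr_mult_Psi[OF mu lam] R if_True)
    show ?thesis
    proof (cases "\<exists>R'\<in>Tab mu. S = ?e R'")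
      case True
      then obtain R' where R': "R' \<in> Tab mu" "S = ?e R'" by blast
      have "matr_mult (Tab mu) (Psi lam mu) (young_mat mu k) S R =
          (\<Sum>U\<in>Tab mu. if U = R' then young_mat mu k U R else 0)"
        unfolding matr_mult_def
        by (intro sum.cong refl) (auto simp: Psi_def unit_vect_def R' extend_tab_inject[OF lam R'(1)])
      also have "\<dots> = young_mat mu k R' R" using R' by simp
      also have "\<dots> = young_mat lam k (?e R') (?e R)"
      proof -
        have c: "tab_content (?e R') k = tab_content R' k" "tab_content (?e R') (k + 1) = tab_content R' (k + 1)"
          using k box_of_extend_tab[OF mu lam R'(1)] by (auto simp: tab_content_def)
        have y: "young_coeff (?e R') k = young_coeff R' k" by (simp only: young_coeff_def c)
        have "?e R = adj_transp k \<circ> ?e R' \<longleftrightarrow> R = adj_transp k \<circ> R'"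
        proof
          assume a: "?e R = adj_transp k \<circ> ?e R'"
          then have "adj_transp k \<circ> ?e R' \<in> Tab lam" using eR by simp
          then have "adj_transp k \<circ> R' \<in> Tab mu"
            using transp_extend_tab_in_Tab_iff[OF mu lam R'(1) k] by blast
          then show "R = adj_transp k \<circ> R'"
            using a transp_extend_tab[OF lam, of k R'] k m extend_tab_inject[OF lam R, of "adj_transp k \<circ> R'"]
            by simp
        next
          assume "R = adj_transp k \<circ> R'"
          then show "?e R = adj_transp k \<circ> ?e R'" using transp_extend_tab[OF lam, of k R'] k m by simp
        qed
        then show ?thesis using R R'(1) eR extend_tab_in_Tab[OF mu lam R'(1)] extend_tab_inject[OF lam R R'(1)] y
          unfolding young_mat_def young_coeff_off_def by simp
      qed
      finally show ?thesis using l R' by simp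
    next
      \<comment> \<open>The exchange maps extended tableaux to extended ones, so a row index that is
        not of this form has a zero entry on both sides.\<close>
      case False
      have "young_mat lam k S (?e R) = 0"
      proof (rule ccontr)
        assume nz: "young_mat lam k S (?e R) \<noteq> 0"
        then have S: "S \<in> Tab lam" by (auto simp: young_mat_def split: if_splits)
        have "?e R = adj_transp k \<circ> S" using nz False R by (auto simp: young_mat_def split: if_splits)
        then have "S = adj_transp k \<circ> ?e R" using transp_comp_eq_iff by blast
        then have "S = ?e (adj_transp k \<circ> R)" "adj_transp k \<circ> R \<in> Tab mu"
          using transp_extend_tab[OF lam, of k R] k m transp_extend_tab_in_Tab_iff[OF mu lam R k] S by auto
        then show False using False by blast
      qed
      moreover have "matr_mult (Tab mu) (Psi lam mu) (young_mat mu k) S R = 0"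
        using False by (auto simp: matr_mult_def Psi_def unit_vect_def)
      ultimately show ?thesis using l by simp
    qed
  next
    case False
    then show ?thesis by (auto simp: matr_mult_def Psi_def young_mat_def)
  qed
qed

lemma Psi_intertwines:
  assumes mu: "is_partition mu m" and lam: "lam \<in> up_set mu" and h: "h permutes {1..m}"
  shows "matr_mult (Tab lam) (young_rep lam h) (Psi lam mu) = matr_mult (Tab mu) (Psi lam mu) (young_rep mu h)"
  using h
proof (induction rule: permutes_adj_transp_induct)
  case id
  have lam': "is_partition lam (m + 1)" using up_set_partition[OF lam] mu by (simp add: is_partition_def)
  show ?case unfolding young_rep_id[OF mu] young_rep_id[OF lam']
      matr_mult_id_left[OF finite_Tab Psi_in_mats[OF mu lam]] matr_mult_id_right[OF finite_Tab Psi_in_mats[OF mu lam]] ..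
next
  case (step k g)
  have lam': "is_partition lam (m + 1)" using up_set_partition[OF lam] mu by (simp add: is_partition_def)
  have s: "adj_transp k permutes {1..m}" "adj_transp k permutes {1..m + 1}" "g permutes {1..m + 1}"
    and k: "k \<in> {1..<m + 1}"
    using step.hyps permutes_adj_transp[of k] permutes_subset[OF step.hyps(2)] by auto
  have "matr_mult (Tab lam) (young_rep lam (adj_transp k \<circ> g)) (Psi lam mu) =
      matr_mult (Tab lam) (young_mat lam k) (matr_mult (Tab lam) (young_rep lam g) (Psi lam mu))"
    by (simp only: young_rep_comp[OF lam' s(2,3)] young_rep_adj_transp[OF lam' k] matr_mult_assoc finite_Tab)
  also have "\<dots> = matr_mult (Tab mu) (matr_mult (Tab lam) (young_mat lam k) (Psi lam mu)) (young_rep mu g)"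
    by (simp only: step.IH matr_mult_assoc finite_Tab)
  also have "\<dots> = matr_mult (Tab mu) (Psi lam mu) (young_rep mu (adj_transp k \<circ> g))"
    by (simp only: Psi_intertwines_young_mat[OF mu lam step.hyps(1)] young_rep_comp[OF mu s(1) step.hyps(2)]
        young_rep_adj_transp[OF mu step.hyps(1)] matr_mult_assoc finite_Tab)
  finally show ?case .
qed

section \<open>Direct sums and Schur's lemma\<close>

definition block_diag :: "nat list set \<Rightarrow> (nat list \<Rightarrow> tableau \<Rightarrow> tableau \<Rightarrow> real) \<Rightarrow>
    nat list \<times> tableau \<Rightarrow> nat list \<times> tableau \<Rightarrow> real" where
  "block_diag L A = (\<lambda>(lam, S) (lam', T). if lam \<in> L \<and> lam = lam' then A lam S T else 0)"

lemma pi_L_block_diag: "pi_L L g = block_diag L (\<lambda>lam. young_rep lam g)"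
  by (simp add: pi_L_def block_diag_def)

lemma sum_basis_L: "finite L \<Longrightarrow> (\<Sum>x\<in>basis_L L. f x) = (\<Sum>lam\<in>L. \<Sum>T\<in>Tab lam. f (lam, T))"
  unfolding basis_L_def by (subst sum.Sigma) auto

lemma matr_mult_block_diag_left:
  assumes "finite L"
  shows "matr_mult (basis_L L) (block_diag L A) X (lam, S) r =
    (if lam \<in> L then matr_mult (Tab lam) (A lam) (\<lambda>T. X (lam, T)) S r else 0)"
proof -
  have "matr_mult (basis_L L) (block_diag L A) X (lam, S) r =
     (\<Sum>lam'\<in>L. if lam' = lam then \<Sum>T\<in>Tab lam. A lam S T * X (lam, T) r else 0)"
    unfolding matr_mult_def sum_basis_L[OF assms]
    by (intro sum.cong refl) (auto simp: block_diag_def)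
  then show ?thesis using assms by (simp add: matr_mult_def)
qed

lemma block_diag_mult:
  assumes "finite L"
  shows "matr_mult (basis_L L) (block_diag L A) (block_diag L B) =
    block_diag L (\<lambda>lam. matr_mult (Tab lam) (A lam) (B lam))"
proof (intro ext)
  fix x y :: "nat list \<times> tableau"
  show "matr_mult (basis_L L) (block_diag L A) (block_diag L B) x y =
    block_diag L (\<lambda>lam. matr_mult (Tab lam) (A lam) (B lam)) x y"
    by (cases x; cases y) (auto simp: matr_mult_block_diag_left[OF assms], auto simp: block_diag_def matr_mult_def)
qed

lemma adj_block_diag: "adj (block_diag L A) = block_diag L (\<lambda>lam. adj (A lam))"
  by (auto simp: adj_def block_diag_def fun_eq_iff)

lemma block_diag_id: "(\<And>lam. lam \<in> L \<Longrightarrow> A lam = id_matr (Tab lam)) \<Longrightarrow> block_diag L A = id_matr (basis_L L)"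
  by (auto simp: block_diag_def id_matr_def basis_L_def fun_eq_iff)

lemma unitary_block_diag:
  assumes "finite L" "\<And>lam. lam \<in> L \<Longrightarrow> unitary_on (Tab lam) (A lam)"
  shows "unitary_on (basis_L L) (block_diag L A)"
proof -
  have "block_diag L A \<in> mats (basis_L L) (basis_L L)"
    using assms(2) by (auto simp: mats_def block_diag_def basis_L_def unitary_on_def)
  then show ?thesis using assms
    by (simp add: unitary_on_def adj_block_diag block_diag_mult block_diag_id)
qed

text \<open>This is the recursion \<open>X\<^sub>k\<^sub>+\<^sub>1 = s\<^sub>k X\<^sub>k s\<^sub>k + s\<^sub>k\<close> of the Jucys--Murphy elements, which act on
  \<open>v\<^sub>T\<close> by the content of \<open>k\<close>, multiplied by \<open>s\<^sub>k\<close> from the left.\<close>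

lemma young_mat_content:
  assumes "is_partition lam n" "k \<in> {1..<n}" "S \<in> Tab lam" "T \<in> Tab lam"
  shows "young_mat lam k S T * real_of_int (tab_content T (k + 1)) =
    real_of_int (tab_content S k) * young_mat lam k S T + (if S = T then 1 else 0)"
proof (cases "S = T")
  case True
  have d: "real_of_int (tab_content S (k + 1) - tab_content S k) \<noteq> 0"
    using tab_content_consecutive_neq[OF assms(1,3,2)] by simp
  have "young_mat lam k S T = young_coeff S k"
    using True assms(3) transp_comp_neq[OF assms(1,3,2)] by (auto simp: young_mat_def)
  moreover have "young_coeff S k * real_of_int (tab_content S (k + 1) - tab_content S k) = 1"
    using d by (simp add: young_coeff_def)
  ultimately show ?thesis using True by (simp add: algebra_simps)
next
  case False
  show ?thesis
  proof (cases "T = adj_transp k \<circ> S")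
    case True
    have "tab_content T (k + 1) = tab_content S k" unfolding True tab_content_transp by simp
    then show ?thesis using False by simp
  qed (use False in \<open>simp add: young_mat_def\<close>)
qed

text \<open>Commutation is assumed only with the generators. The scalars may still differ between
  blocks; they are compared later by traces.\<close>

lemma schur_block_diag:
  assumes L: "finite L" and part: "\<And>lam. lam \<in> L \<Longrightarrow> is_partition lam n"
    and M: "M \<in> mats (basis_L L) (basis_L L)"
    and comm: "\<And>k. k \<in> {1..<n} \<Longrightarrow> matr_mult (basis_L L) (pi_L L (adj_transp k)) M =
      matr_mult (basis_L L) M (pi_L L (adj_transp k))"
  shows "\<exists>c. M = (\<lambda>x y. c (fst x) * id_matr (basis_L L) x y)"
proof -
  let ?I = "basis_L L" and ?A = "\<lambda>k. pi_L L (adj_transp k)"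
  define ct where "ct k x = real_of_int (tab_content (snd x) k)" for k and x :: "nat list \<times> tableau"
  have I: "finite ?I" using L by (auto simp: basis_L_def)
  have M0: "M x y = 0" if "x \<notin> ?I \<or> y \<notin> ?I" for x y using M that unfolding mats_def by blast
  have A: "?A k (lam, S) (lam', T) = (if lam \<in> L \<and> lam = lam' then young_mat lam k S T else 0)"
    if "k \<in> {1..<n}" for k lam lam' S T
    unfolding pi_L_def using young_rep_adj_transp[OF part that] by auto
  have ctA: "?A k x y * ct (k + 1) y = ct k x * ?A k x y + (if x = y then 1 else 0)"
    if k: "k \<in> {1..<n}" and "x \<in> ?I" "y \<in> ?I" for k x y
  proof (cases "fst x = fst y")
    case True
    then obtain lam S T where xy: "x = (lam, S)" "y = (lam, T)" by (cases x; cases y) auto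
    then have "lam \<in> L" "S \<in> Tab lam" "T \<in> Tab lam" using that by (auto simp: basis_L_def)
    then show ?thesis using young_mat_content[OF part k] by (simp only: xy A[OF k] ct_def snd_conv) simp
  next
    case False
    then show ?thesis by (cases x; cases y) (auto simp: pi_L_def)
  qed
  have U: "unitary_on ?I (?A k)" if "k \<in> {1..<n}" for k
    unfolding pi_L_block_diag using young_rep_unitary[OF part permutes_adj_transp[OF that]]
    by (intro unitary_block_diag L)
  \<comment> \<open>These are the entries of the commutator of \<open>M\<close> with the diagonal
    matrix \<open>C_k\<close> of contents of \<open>k\<close>.\<close>
  have commC: "M x y * (ct k y - ct k x) = 0" if "1 \<le> k" "k \<le> n" for k x y
    using that
  proof (induction k arbitrary: x y rule: dec_induct)
    case base
    show ?case
    proof (cases "x \<in> ?I \<and> y \<in> ?I")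
      case True
      then have "ct 1 x = 0" "ct 1 y = 0"
        using tab_content_one[OF part] base by (auto simp: ct_def basis_L_def)
      then show ?thesis by simp
    qed (use M0[of x y] in auto)
  next
    case (step k)
    have k: "k \<in> {1..<n}" using step by auto
    have IH: "M x y * ct k y = ct k x * M x y" for x y
      using step.IH[of x y] step.prems by (simp add: algebra_simps)
    define K where "K x y = M x y * (ct (k + 1) y - ct (k + 1) x)" for x y
    have K: "K \<in> mats ?I ?I" using M by (auto simp: mats_def K_def)
    have AKm: "matr_mult ?I (?A k) K \<in> mats ?I ?I"
      using U[OF k] K by (auto simp only: unitary_on_def intro: matr_mult_in_mats)
    \<comment> \<open>With \<open>s C_{k+1} = C_k s + 1\<close> and \<open>C_k\<close> commuting
      with \<open>M\<close>: \<open>M s C_{k+1} = C_k M s + M = (C_k s + 1) M = s C_{k+1} M\<close>.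
      As \<open>s\<close> commutes with \<open>M\<close>, \<open>s\<close> annihilates the
      commutator \<open>K\<close>, and \<open>s\<close> is invertible.\<close>
    have AK: "matr_mult ?I (?A k) K x y = 0" for x y
    proof (cases "x \<in> ?I \<and> y \<in> ?I")
      case True
      then have x: "x \<in> ?I" and y: "y \<in> ?I" by auto
      have "matr_mult ?I (?A k) M x y * ct (k + 1) y = (\<Sum>z\<in>?I. M x z * (?A k z y * ct (k + 1) y))"
        unfolding comm[OF k] by (simp add: matr_mult_def sum_distrib_right mult.assoc)
      also have "\<dots> = (\<Sum>z\<in>?I. M x z * (ct k z * ?A k z y + (if z = y then 1 else 0)))"
        using y by (intro sum.cong refl) (simp only: ctA[OF k])
      also have "\<dots> = (\<Sum>z\<in>?I. ct k x * (M x z * ?A k z y) + (if z = y then M x y else 0))"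
      proof (intro sum.cong refl)
        fix z
        have "M x z * (ct k z * ?A k z y) = ct k x * (M x z * ?A k z y)"
          using IH[of x z] by (metis mult.assoc)
        then show "M x z * (ct k z * ?A k z y + (if z = y then 1 else 0)) =
          ct k x * (M x z * ?A k z y) + (if z = y then M x y else 0)"
          by (auto simp: distrib_left)
      qed
      also have "\<dots> = ct k x * matr_mult ?I M (?A k) x y + M x y"
        using I y by (simp add: sum.distrib matr_mult_def sum_distrib_left)
      also have "\<dots> = (\<Sum>z\<in>?I. ct k x * (?A k x z * M z y) + (if z = x then M x y else 0))"
        unfolding comm[OF k, symmetric] using I x by (simp add: sum.distrib matr_mult_def sum_distrib_left)
      also have "\<dots> = (\<Sum>z\<in>?I. (ct k x * ?A k x z + (if x = z then 1 else 0)) * M z y)"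
        by (intro sum.cong refl) (auto simp: distrib_right)
      also have "\<dots> = (\<Sum>z\<in>?I. ?A k x z * ct (k + 1) z * M z y)"
        using x by (intro sum.cong refl) (simp only: ctA[OF k])
      finally have "matr_mult ?I (?A k) M x y * ct (k + 1) y = (\<Sum>z\<in>?I. ?A k x z * ct (k + 1) z * M z y)" .
      then show ?thesis
        by (simp add: matr_mult_def K_def right_diff_distrib sum_subtractf sum_distrib_left
            sum_distrib_right mult_ac)
    next
      case False
      then show ?thesis using AKm unfolding mats_def by blast
    qed
    have "matr_mult ?I (matr_mult ?I (adj (?A k)) (?A k)) K = matr_mult ?I (adj (?A k)) (matr_mult ?I (?A k) K)"
      by (rule matr_mult_assoc[OF I I])
    also have "matr_mult ?I (?A k) K = (\<lambda>x y. 0)" by (intro ext) (rule AK)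
    also have "matr_mult ?I (adj (?A k)) (\<lambda>x y. 0) = (\<lambda>x y. 0)" by (simp add: matr_mult_def)
    finally have "K = (\<lambda>x y. 0)"
      using U[OF k] matr_mult_id_left[OF I K] by (simp add: unitary_on_def)
    from fun_cong[OF fun_cong[OF this, of x], of y] show ?case by (simp add: K_def)
  qed
  \<comment> \<open>A nonzero entry would force all contents to agree, hence both shape and
    tableau.\<close>
  have off: "M x y = 0" if "x \<noteq> y" for x y
  proof (rule ccontr)
    assume nz: "M x y \<noteq> 0"
    then have xy: "x \<in> ?I" "y \<in> ?I" using M0[of x y] by blast+
    obtain lam S lam' T where eq: "x = (lam, S)" "y = (lam', T)" by (cases x; cases y)
    have "tab_content S k = tab_content T k" if "k \<in> {1..n}" for k
      using commC[of k x y] nz that eq by (simp add: ct_def)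
    then show False using tab_content_determines[OF part part, of lam lam' S T] xy eq that
      by (auto simp: basis_L_def)
  qed
  \<comment> \<open>Compare the entries of \<open>s_k M = M s_k\<close> at an admissible exchange;
    the matrix of \<open>s_k\<close> does not vanish there.\<close>
  have diag: "M (lam, S) (lam, S) = M (lam, T) (lam, T)" if lam: "lam \<in> L" and "S \<in> Tab lam" "T \<in> Tab lam" for lam S T
  proof (rule Tab_connected[OF part[OF lam] that(2,3)])
    fix k U assume k: "k \<in> {1..<n}" and Ut: "U \<in> Tab lam" and V: "adj_transp k \<circ> U \<in> Tab lam"
    let ?V = "adj_transp k \<circ> U"
    have in_I: "(lam, U) \<in> ?I" "(lam, ?V) \<in> ?I" using lam Ut V by (auto simp: basis_L_def)
    have "matr_mult ?I (?A k) M (lam, ?V) (lam, U) = (\<Sum>z\<in>?I. if z = (lam, U) then ?A k (lam, ?V) (lam, U) * M (lam, U) (lam, U) else 0)"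
      unfolding matr_mult_def by (intro sum.cong refl) (auto simp: off)
    then have 1: "matr_mult ?I (?A k) M (lam, ?V) (lam, U) = ?A k (lam, ?V) (lam, U) * M (lam, U) (lam, U)"
      using I in_I by simp
    have "matr_mult ?I M (?A k) (lam, ?V) (lam, U) = (\<Sum>z\<in>?I. if z = (lam, ?V) then M (lam, ?V) (lam, ?V) * ?A k (lam, ?V) (lam, U) else 0)"
      unfolding matr_mult_def by (intro sum.cong refl) (auto simp: off)
    then have 2: "matr_mult ?I M (?A k) (lam, ?V) (lam, U) = M (lam, ?V) (lam, ?V) * ?A k (lam, ?V) (lam, U)"
      using I in_I by simp
    have "?A k (lam, ?V) (lam, U) = young_mat lam k U ?V"
      using lam by (simp only: A[OF k] young_mat_sym[of lam k U]) simp
    also have "\<dots> = young_coeff_off U k"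
      using Ut V transp_comp_neq[OF part[OF lam] Ut k] by (auto simp: young_mat_def)
    finally have "?A k (lam, ?V) (lam, U) \<noteq> 0"
      using young_coeff_off_neq_0[OF part[OF lam] Ut k V] by simp
    with 1 2 comm[OF k] show "M (lam, ?V) (lam, ?V) = M (lam, U) (lam, U)" by (simp add: mult.commute)
  qed
  define c where "c lam = (let T = SOME T. T \<in> Tab lam in M (lam, T) (lam, T))" for lam
  have "M x y = c (fst x) * id_matr ?I x y" for x y
  proof (cases "x = y \<and> x \<in> ?I")
    case True
    then obtain lam S where x: "x = (lam, S)" "lam \<in> L" "S \<in> Tab lam" by (auto simp: basis_L_def)
    have "(SOME T. T \<in> Tab lam) \<in> Tab lam" using x(3) by (metis someI)
    then have "M (lam, S) (lam, S) = c lam" unfolding c_def Let_def by (rule diag[OF x(2) x(3)])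
    moreover have "id_matr ?I x y = 1" using True unfolding id_matr_def by metis
    moreover have "M x y = M (lam, S) (lam, S)" "fst x = lam" using True x(1) by auto
    ultimately show ?thesis by simp
  next
    case False
    then show ?thesis using off[of x y] M0[of x y] by (cases "x = y") (auto simp: id_matr_def)
  qed
  then show ?thesis by (intro exI[of _ c] ext)
qed

section \<open>The fusion frame\<close>

lemma young_rep_inv:
  assumes lam: "is_partition lam n" and g: "g permutes {1..n}"
  shows "adj (young_rep lam g) = young_rep lam (inv g)"
proof (rule unitary_on_adj_eq_inverse[OF finite_Tab young_rep_unitary[OF lam g]])
  show "young_rep lam (inv g) \<in> mats (Tab lam) (Tab lam)"
    using young_rep_unitary[OF lam permutes_inv[OF g]] by (simp add: unitary_on_def)
  show "matr_mult (Tab lam) (young_rep lam g) (young_rep lam (inv g)) = id_matr (Tab lam)"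
    using young_rep_comp[OF lam g permutes_inv[OF g]] permutes_inv_o(1)[OF g] young_rep_id[OF lam] by simp
qed

text \<open>The nontrivial double coset: \<open>a\<close> brings the image of \<open>m + 1\<close>
  to \<open>m\<close>, after which the adjacent transposition brings it back to
  \<open>m + 1\<close>.\<close>

lemma permutes_decompose_top_moved:
  assumes g: "g permutes {1..m + 1}" and ne: "g (m + 1) \<noteq> m + 1"
  obtains a b where "a permutes {1..m}" "b permutes {1..m}" "g = a \<circ> (adj_transp m \<circ> b)" "1 \<le> m"
proof -
  have gin: "g (m + 1) \<in> {1..m + 1}" using permutes_in_image[OF g, of "m + 1"] by simp
  then have j: "g (m + 1) \<in> {1..m}" "1 \<le> m" using ne by auto
  define a where "a = Transposition.transpose (g (m + 1)) m"
  define b where "b = adj_transp m \<circ> (a \<circ> g)"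
  have a: "a permutes {1..m}" unfolding a_def using j by (intro permutes_swap_id) auto
  have "b permutes {1..m + 1}" unfolding b_def
    using j by (intro permutes_compose[OF permutes_compose[OF g]] permutes_subset[OF a] permutes_adj_transp) auto
  moreover have "b (m + 1) = m + 1" by (simp add: b_def a_def)
  ultimately have b: "b permutes {1..m}" by (rule permutes_fix_top)
  have "a \<circ> (adj_transp m \<circ> b) = a \<circ> (adj_transp m \<circ> adj_transp m) \<circ> (a \<circ> g)"
    by (simp only: b_def comp_assoc)
  also have "\<dots> = (a \<circ> a) \<circ> g" by (simp only: transpose_comp_involutory comp_id comp_assoc)
  also have "\<dots> = g" by (simp only: a_def transpose_comp_involutory id_comp)
  finally show thesis using that[OF a b _ j(2)] by simp
qed

locale young_frame =
  fixes m :: nat and mu :: "nat list" and L :: "nat list set"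
  assumes mu: "is_partition mu m" and L_up: "L \<subseteq> up_set mu" and L_ne: "L \<noteq> {}"
begin

abbreviation "I \<equiv> basis_L L"
abbreviation "J \<equiv> Tab mu"

text \<open>Defined for all permutations, not only the representatives \<open>t k\<close>, because
  products such as \<open>\<tau> \<circ> t k\<close> leave the set of representatives.\<close>

definition Phi :: "(nat \<Rightarrow> nat) \<Rightarrow> nat list \<times> tableau \<Rightarrow> tableau \<Rightarrow> real" where
  "Phi g = matr_mult I (pi_L L g) (Psi_L L mu)"

lemma finite_L: "finite L"
  using finite_subset[OF L_up finite_up_set] .

lemma finite_I: "finite I"
  using finite_L by (auto simp: basis_L_def)

lemma L_partition: "lam \<in> L \<Longrightarrow> is_partition lam (m + 1)"
  using up_set_partition L_up mu by (fastforce simp: is_partition_def)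

lemma d_L_pos: "0 < d_L L"
  unfolding d_L_def using finite_L L_ne num_tab_pos[OF L_partition] by (intro sum_pos) auto

lemma card_I: "card I = d_L L"
  using finite_L by (simp add: basis_L_def d_L_def num_tab_def)

lemma pi_unitary: "g permutes {1..m + 1} \<Longrightarrow> unitary_on I (pi_L L g)"
  unfolding pi_L_block_diag
  by (intro unitary_block_diag finite_L young_rep_unitary[OF L_partition])

lemma pi_comp:
  assumes "g permutes {1..m + 1}" "h permutes {1..m + 1}"
  shows "pi_L L (g \<circ> h) = matr_mult I (pi_L L g) (pi_L L h)"
  unfolding pi_L_block_diag block_diag_mult[OF finite_L]
  using young_rep_comp[OF L_partition assms] by (auto simp: block_diag_def fun_eq_iff)

lemma pi_inv:
  assumes "g permutes {1..m + 1}"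
  shows "adj (pi_L L g) = pi_L L (inv g)"
  unfolding pi_L_block_diag adj_block_diag
  using young_rep_inv[OF L_partition assms] by (auto simp: block_diag_def fun_eq_iff)

lemma Psi_L_in_mats: "Psi_L L mu \<in> mats I J"
  using Psi_in_mats[OF mu] L_up by (fastforce simp: mats_def Psi_L_def basis_L_def)

lemma sqrt_weight_square:
  "sqrt (real (num_tab lam) / real (d_L L)) * sqrt (real (num_tab lam) / real (d_L L)) =
     real (num_tab lam) / real (d_L L)"
  by simp

lemma matr_mult_adj_Psi_L:
  assumes "R \<in> J"
  shows "matr_mult I (adj (Psi_L L mu)) X R r =
    (\<Sum>lam\<in>L. sqrt (real (num_tab lam) / real (d_L L)) * X (lam, extend_tab lam mu R) r)"
proof -
  have "matr_mult I (adj (Psi_L L mu)) X R r = (\<Sum>lam\<in>L. \<Sum>T\<in>Tab lam. Psi_L L mu (lam, T) R * X (lam, T) r)"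
    by (simp add: matr_mult_def adj_def sum_basis_L[OF finite_L])
  also have "\<dots> = (\<Sum>lam\<in>L. \<Sum>T\<in>Tab lam. if T = extend_tab lam mu R then
      sqrt (real (num_tab lam) / real (d_L L)) * X (lam, extend_tab lam mu R) r else 0)"
    using assms by (intro sum.cong refl) (auto simp: Psi_L_def Psi_def unit_vect_def)
  also have "\<dots> = (\<Sum>lam\<in>L. sqrt (real (num_tab lam) / real (d_L L)) * X (lam, extend_tab lam mu R) r)"
    using extend_tab_in_Tab[OF mu _ assms] L_up by (intro sum.cong refl) auto
  finally show ?thesis .
qed

text \<open>The squared weights \<open>d_\<lambda> / d_L\<close> sum to 1.\<close>

lemma Psi_L_isometry: "isometry I J (Psi_L L mu)"
proof -
  have "matr_mult I (adj (Psi_L L mu)) (Psi_L L mu) R R' = id_matr J R R'" for R R'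
  proof (cases "R \<in> J")
    case True
    have "matr_mult I (adj (Psi_L L mu)) (Psi_L L mu) R R' =
      (\<Sum>lam\<in>L. real (num_tab lam) / real (d_L L) * id_matr J R R')"
      unfolding matr_mult_adj_Psi_L[OF True]
    proof (intro sum.cong refl)
      fix lam assume lam: "lam \<in> L"
      have "Psi lam mu (extend_tab lam mu R) R' = id_matr J R R'"
        using True extend_tab_inject[of lam mu R R'] lam L_up
        by (auto simp: Psi_def unit_vect_def id_matr_def)
      then show "sqrt (real (num_tab lam) / real (d_L L)) * Psi_L L mu (lam, extend_tab lam mu R) R' =
         real (num_tab lam) / real (d_L L) * id_matr J R R'"
        using lam by (simp add: Psi_L_def mult.assoc[symmetric] sqrt_weight_square del: real_sqrt_divide)
    qed
    also have "\<dots> = (\<Sum>lam\<in>L. real (num_tab lam)) / real (d_L L) * id_matr J R R'"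
      by (simp add: sum_distrib_right sum_divide_distrib)
    also have "(\<Sum>lam\<in>L. real (num_tab lam)) = real (d_L L)" by (simp add: d_L_def)
    also have "real (d_L L) / real (d_L L) * id_matr J R R' = id_matr J R R'" using d_L_pos by simp
    finally show ?thesis .
  next
    case False
    then have "Psi_L L mu x R = 0" for x using Psi_L_in_mats unfolding mats_def by blast
    then show ?thesis using False by (simp add: matr_mult_def adj_def id_matr_def)
  qed
  then show ?thesis using Psi_L_in_mats by (auto simp: isometry_def fun_eq_iff)
qed

lemma Phi_apply:
  "Phi g (lam, S) R = (if lam \<in> L \<and> R \<in> J then
     sqrt (real (num_tab lam) / real (d_L L)) * young_rep lam g S (extend_tab lam mu R) else 0)"
proof (cases "lam \<in> L")
  case True
  then have up: "lam \<in> up_set mu" using L_up by auto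
  have "Phi g (lam, S) R = sqrt (real (num_tab lam) / real (d_L L)) * matr_mult (Tab lam) (young_rep lam g) (Psi lam mu) S R"
    unfolding Phi_def pi_L_block_diag matr_mult_block_diag_left[OF finite_L] using True
    by (simp add: matr_mult_def Psi_L_def sum_distrib_left mult_ac del: real_sqrt_divide)
  then show ?thesis using True by (simp add: matr_mult_Psi[OF mu up] del: real_sqrt_divide)
next
  case False
  then show ?thesis unfolding Phi_def pi_L_block_diag matr_mult_block_diag_left[OF finite_L] by simp
qed

lemma Phi_isometry: "g permutes {1..m + 1} \<Longrightarrow> isometry I J (Phi g)"
  unfolding Phi_def
  by (intro isometry_matr_mult finite_I finite_Tab unitary_on_isometry pi_unitary Psi_L_isometry)

text \<open>The intertwining property of the single \<open>Psi lam mu\<close>, assembled over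
  \<open>L\<close>: \<open>W_L\<close> is invariant under the smaller group.\<close>

lemma Phi_restrict:
  assumes h: "h permutes {1..m}"
  shows "Phi h = matr_mult J (Psi_L L mu) (young_rep mu h)"
proof (intro ext)
  fix x :: "nat list \<times> tableau" and R
  obtain lam S where x: "x = (lam, S)" by (cases x)
  show "Phi h x R = matr_mult J (Psi_L L mu) (young_rep mu h) x R"
  proof (cases "lam \<in> L")
    case True
    then have up: "lam \<in> up_set mu" using L_up by auto
    have "Phi h x R = sqrt (real (num_tab lam) / real (d_L L)) * matr_mult (Tab lam) (young_rep lam h) (Psi lam mu) S R"
      unfolding x Phi_apply using True by (simp add: matr_mult_Psi[OF mu up] del: real_sqrt_divide)
    also have "\<dots> = matr_mult J (Psi_L L mu) (young_rep mu h) x R"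
      unfolding Psi_intertwines[OF mu up h] x using True
      by (simp add: matr_mult_def Psi_L_def sum_distrib_left mult_ac del: real_sqrt_divide)
    finally show ?thesis .
  next
    case False
    then show ?thesis unfolding x Phi_apply by (simp add: matr_mult_def Psi_L_def)
  qed
qed

lemma permutes_Suc: "h permutes {1..m} \<Longrightarrow> h permutes {1..m + 1}"
  by (erule permutes_subset) auto

lemma pi_Phi:
  assumes "g permutes {1..m + 1}" "h permutes {1..m + 1}"
  shows "matr_mult I (pi_L L g) (Phi h) = Phi (g \<circ> h)"
  unfolding Phi_def pi_comp[OF assms] by (simp only: matr_mult_assoc finite_I)

lemma Phi_comp_restrict:
  assumes g: "g permutes {1..m + 1}" and h: "h permutes {1..m}"
  shows "Phi (g \<circ> h) = matr_mult J (Phi g) (young_rep mu h)"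
  unfolding pi_Phi[OF g permutes_Suc[OF h], symmetric] Phi_restrict[OF h]
  by (simp only: Phi_def matr_mult_assoc finite_I finite_Tab)

text \<open>The isometries of one coset differ by a unitary factor on the right, which changes
  neither image nor projection; so the ensemble does not depend on the choice of the
  \<open>t k\<close>.\<close>

lemma Phi_same_coset:
  assumes g: "g permutes {1..m + 1}" and g': "g' permutes {1..m + 1}" and eq: "g (m + 1) = g' (m + 1)"
  obtains h where "h permutes {1..m}" "Phi g = matr_mult J (Phi g') (young_rep mu h)"
proof -
  let ?h = "inv g' \<circ> g"
  have "?h permutes {1..m + 1}" by (rule permutes_compose[OF g permutes_inv[OF g']])
  moreover have "?h (m + 1) = m + 1" using eq permutes_inverses(2)[OF g', of "m + 1"] by simp
  ultimately have h: "?h permutes {1..m}" by (rule permutes_fix_top)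
  have "g = g' \<circ> ?h" by (simp only: comp_assoc[symmetric] permutes_inv_o(1)[OF g'] id_comp)
  then show thesis using that[OF h] Phi_comp_restrict[OF g' h] by simp
qed

section \<open>The projections and tightness\<close>

definition Proj :: "(nat \<Rightarrow> nat) \<Rightarrow> nat list \<times> tableau \<Rightarrow> nat list \<times> tableau \<Rightarrow> real" where
  "Proj g = matr_mult J (Phi g) (adj (Phi g))"

lemma Phi_image_same_coset:
  assumes "g permutes {1..m + 1}" "g' permutes {1..m + 1}" "g (m + 1) = g' (m + 1)"
  shows "matr_app J (Phi g) ` vecs J = matr_app J (Phi g') ` vecs J"
proof -
  obtain h where h: "h permutes {1..m}" "Phi g = matr_mult J (Phi g') (young_rep mu h)"
    using Phi_same_coset[OF assms] .
  have "matr_app J (Phi g) ` vecs J = matr_app J (Phi g') ` (matr_app J (young_rep mu h) ` vecs J)"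
    unfolding h(2) image_image by (simp add: matr_app_matr_mult)
  then show ?thesis using unitary_on_image_vecs[OF finite_Tab young_rep_unitary[OF mu h(1)]] by simp
qed

lemma Proj_orth: "g permutes {1..m + 1} \<Longrightarrow> orth_projection I (Proj g) (matr_app J (Phi g) ` vecs J)"
  unfolding Proj_def by (intro isometry_orth_projection finite_I finite_Tab Phi_isometry)

lemma Proj_same_coset:
  assumes "g permutes {1..m + 1}" "g' permutes {1..m + 1}" "g (m + 1) = g' (m + 1)"
  shows "Proj g = Proj g'"
  using orth_projection_unique[OF finite_I Proj_orth[OF assms(1)]] Proj_orth[OF assms(2)]
    Phi_image_same_coset[OF assms] by simp

lemma pi_Proj:
  assumes g: "g permutes {1..m + 1}" and h: "h permutes {1..m + 1}"
  shows "matr_mult I (pi_L L g) (Proj h) = matr_mult I (Proj (g \<circ> h)) (pi_L L g)"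
proof -
  have m: "adj (Phi h) \<in> mats J I" using Phi_isometry[OF h] by (auto simp: isometry_def adj_in_mats)
  have "matr_mult I (Proj (g \<circ> h)) (pi_L L g) =
     matr_mult J (matr_mult I (pi_L L g) (Phi h)) (matr_mult I (adj (Phi h)) (matr_mult I (adj (pi_L L g)) (pi_L L g)))"
    unfolding Proj_def pi_Phi[OF g h, symmetric] adj_matr_mult by (simp only: matr_mult_assoc finite_I finite_Tab)
  also have "\<dots> = matr_mult J (matr_mult I (pi_L L g) (Phi h)) (adj (Phi h))"
    using pi_unitary[OF g] by (simp add: unitary_on_def matr_mult_id_right[OF finite_I m])
  finally show ?thesis by (simp only: Proj_def matr_mult_assoc finite_I finite_Tab)
qed

text \<open>The columns of an orthogonal matrix are unit vectors, so each \<open>R\<close>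
  contributes exactly the squared weight. Proportionality to \<open>num_tab lam\<close> is what
  equates the scalars of the blocks.\<close>

lemma Proj_block_trace:
  assumes g: "g permutes {1..m + 1}" and lam: "lam \<in> L"
  shows "(\<Sum>T\<in>Tab lam. Proj g (lam, T) (lam, T)) = real (num_tab lam) / real (d_L L) * real (num_tab mu)"
proof -
  have up: "lam \<in> up_set mu" using lam L_up by auto
  let ?w = "real (num_tab lam) / real (d_L L)"
  have sq: "(\<Sum>T\<in>Tab lam. young_rep lam g T U * young_rep lam g T U) = 1" if "U \<in> Tab lam" for U
  proof -
    have "matr_mult (Tab lam) (adj (young_rep lam g)) (young_rep lam g) U U = id_matr (Tab lam) U U"
      using young_rep_unitary[OF L_partition[OF lam] g] by (simp add: unitary_on_def)
    then show ?thesis using that by (simp add: matr_mult_def adj_def id_matr_def)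
  qed
  have "(\<Sum>T\<in>Tab lam. Proj g (lam, T) (lam, T)) =
    (\<Sum>R\<in>J. \<Sum>T\<in>Tab lam. Phi g (lam, T) R * Phi g (lam, T) R)"
    unfolding Proj_def matr_mult_def adj_def by (rule sum.swap)
  also have "\<dots> = (\<Sum>R\<in>J. \<Sum>T\<in>Tab lam.
      ?w * (young_rep lam g T (extend_tab lam mu R) * young_rep lam g T (extend_tab lam mu R)))"
  proof (intro sum.cong refl)
    fix R T assume "R \<in> J"
    define w where "w = ?w"
    have "sqrt w * sqrt w = w" by (simp add: w_def)
    then show "Phi g (lam, T) R * Phi g (lam, T) R =
      ?w * (young_rep lam g T (extend_tab lam mu R) * young_rep lam g T (extend_tab lam mu R))"
      unfolding Phi_apply w_def[symmetric] using lam \<open>R \<in> J\<close> by (simp add: mult_ac)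
  qed
  also have "\<dots> = (\<Sum>R\<in>J. ?w)"
  proof (intro sum.cong refl)
    fix R assume "R \<in> J"
    then show "(\<Sum>T\<in>Tab lam. ?w * (young_rep lam g T (extend_tab lam mu R) *
        young_rep lam g T (extend_tab lam mu R))) = ?w"
      using sq[OF extend_tab_in_Tab[OF mu up]] by (simp only: sum_distrib_left[symmetric] mult_1_right)
  qed
  finally show ?thesis by (simp add: num_tab_def)
qed

lemma sum_Proj:
  assumes reps: "\<forall>k\<in>{1..m + 1}. t k permutes {1..m + 1} \<and> t k (m + 1) = k"
  shows "(\<lambda>x y. \<Sum>k\<in>{1..m + 1}. Proj (t k) x y) =
    (\<lambda>x y. real (m + 1) * real (num_tab mu) / real (d_L L) * id_matr I x y)"
proof -
  note t = bspec[OF reps]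
  define M where "M x y = (\<Sum>k\<in>{1..m + 1}. Proj (t k) x y)" for x y
  have Pm: "Proj (t k) \<in> mats I I" if "k \<in> {1..m + 1}" for k
    using Proj_orth t[OF that] by (auto simp: orth_projection_def)
  have M: "M \<in> mats I I"
    unfolding mats_def M_def using Pm by (auto simp: mats_def intro!: sum.neutral)
  have comm: "matr_mult I (pi_L L g) M = matr_mult I M (pi_L L g)" if g: "g permutes {1..m + 1}" for g
  proof -
    \<comment> \<open>\<open>g \<circ> t k\<close> and \<open>t (g k)\<close> agree at
      \<open>m + 1\<close>, so conjugation by \<open>g\<close> permutes the summands.\<close>
    have eq: "matr_mult I (pi_L L g) (Proj (t k)) = matr_mult I (Proj (t (g k))) (pi_L L g)" if "k \<in> {1..m + 1}" for k
    proof -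
      have gk: "g k \<in> {1..m + 1}" using permutes_in_image[OF g] that by blast
      have "Proj (g \<circ> t k) = Proj (t (g k))"
        using t[OF that] t[OF gk] by (intro Proj_same_coset permutes_compose g) auto
      then show ?thesis using pi_Proj[OF g, of "t k"] t[OF that] by simp
    qed
    have "matr_mult I (pi_L L g) M = (\<lambda>x y. \<Sum>k\<in>{1..m + 1}. matr_mult I (pi_L L g) (Proj (t k)) x y)"
      unfolding M_def matr_mult_sum_right ..
    also have "\<dots> = (\<lambda>x y. \<Sum>k\<in>{1..m + 1}. matr_mult I (Proj (t (g k))) (pi_L L g) x y)"
      using eq by (intro ext sum.cong refl) (simp only:)
    also have "\<dots> = (\<lambda>x y. \<Sum>k\<in>{1..m + 1}. matr_mult I (Proj (t k)) (pi_L L g) x y)"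
      by (intro ext) (rule sum.reindex_bij_betw[OF permutes_imp_bij[OF g], of "\<lambda>k. matr_mult I (Proj (t k)) (pi_L L g) _ _"])
    also have "\<dots> = matr_mult I M (pi_L L g)" unfolding M_def matr_mult_sum_left ..
    finally show ?thesis .
  qed
  have "\<exists>c. M = (\<lambda>x y. c (fst x) * id_matr I x y)"
    using L_partition by (intro schur_block_diag finite_L M comm permutes_adj_transp)
  then obtain c where c: "M = (\<lambda>x y. c (fst x) * id_matr I x y)" by blast
  \<comment> \<open>Both expressions compute the trace of \<open>M\<close> over one block.\<close>
  have "c lam = real (m + 1) * real (num_tab mu) / real (d_L L)" if lam: "lam \<in> L" for lam
  proof -
    have "(\<Sum>T\<in>Tab lam. M (lam, T) (lam, T)) = c lam * real (num_tab lam)"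
      using lam by (simp add: c id_matr_def basis_L_def num_tab_def)
    moreover have "(\<Sum>T\<in>Tab lam. M (lam, T) (lam, T)) =
        (\<Sum>k\<in>{1..m + 1}. \<Sum>T\<in>Tab lam. Proj (t k) (lam, T) (lam, T))"
      unfolding M_def by (rule sum.swap)
    moreover have "\<dots> = (\<Sum>k\<in>{1..m + 1}. real (num_tab lam) / real (d_L L) * real (num_tab mu))"
      using Proj_block_trace[OF _ lam] t by (intro sum.cong refl) blast
    moreover have "\<dots> = real (m + 1) * (real (num_tab lam) / real (d_L L) * real (num_tab mu))" by simp
    ultimately have "c lam * real (num_tab lam) = (real (m + 1) * real (num_tab mu) / real (d_L L)) * real (num_tab lam)"
      by simp
    moreover have "real (num_tab lam) \<noteq> 0" using num_tab_pos[OF L_partition[OF lam]] by simp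
    ultimately show ?thesis by (simp only: mult_cancel_right) simp
  qed
  then have "M x y = real (m + 1) * real (num_tab mu) / real (d_L L) * id_matr I x y" for x y
    unfolding c by (cases "x \<in> I") (auto simp: id_matr_def basis_L_def)
  then show ?thesis by (intro ext) (simp only: M_def)
qed

section \<open>The cross-Gramians\<close>

definition Cross :: "tableau \<Rightarrow> tableau \<Rightarrow> real" where
  "Cross = matr_mult I (adj (Psi_L L mu)) (Phi (adj_transp m))"

text \<open>The sum of the condition on \<beta>, normalised by \<open>d_L\<close> in place of
  \<open>n d_\<mu>\<close>.\<close>

definition cross_val :: "box \<Rightarrow> real" where
  "cross_val b = (\<Sum>lam\<in>L. real (num_tab lam) / real (d_L L) * (1 / real_of_int (axial_dist (added_box lam mu) b)))"

lemma Cross_eq: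
  assumes "1 \<le> m"
  shows "Cross = (\<lambda>R R'. cross_val (box_of R m) * id_matr J R R')"
proof (intro ext)
  fix R R'
  have mk: "m \<in> {1..<m + 1}" using assms by simp
  show "Cross R R' = cross_val (box_of R m) * id_matr J R R'"
  proof (cases "R \<in> J \<and> R' \<in> J")
    case True
    have "Cross R R' = (\<Sum>lam\<in>L. real (num_tab lam) / real (d_L L) *
       (1 / real_of_int (axial_dist (added_box lam mu) (box_of R m))) * id_matr J R R')"
      unfolding Cross_def matr_mult_adj_Psi_L[OF conjunct1[OF True]]
    proof (intro sum.cong refl)
      fix lam assume lam: "lam \<in> L"
      then have up: "lam \<in> up_set mu" using L_up by auto
      let ?e = "extend_tab lam mu"
      have e: "?e R \<in> Tab lam" "?e R' \<in> Tab lam" using extend_tab_in_Tab[OF mu up] True by auto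
      have top: "box_of (?e R) (m + 1) = added_box lam mu" "box_of (?e R) m = box_of R m"
        using box_of_extend_tab_top[OF mu up] box_of_extend_tab[OF mu up] True assms by auto
      \<comment> \<open>This rules out the second term of Young's formula: on the left
        \<open>m + 1\<close> sits in the added box, on the right inside \<open>mu\<close>.\<close>
      have "?e R' \<noteq> adj_transp m \<circ> ?e R"
      proof
        assume "?e R' = adj_transp m \<circ> ?e R"
        then have "box_of (?e R') (m + 1) = box_of (?e R) m" by (simp only: box_of_transp) simp
        then have "added_box lam mu = box_of R m" using box_of_extend_tab_top[OF mu up, of R'] True top by simp
        moreover have "box_of R m \<in> young_diagram mu"
          using box_of_in_diagram[of R mu m] True assms mu by (simp add: is_partition_def)
        ultimately show False using added_box_notin[OF up] by simp
      qed
      then have "young_mat lam m (?e R) (?e R') = young_coeff (?e R) m * id_matr J R R'"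
        using e True extend_tab_inject[OF up, of R' R] by (auto simp: young_mat_def id_matr_def)
      moreover have "young_coeff (?e R) m = 1 / real_of_int (axial_dist (added_box lam mu) (box_of R m))"
        unfolding young_coeff_def tab_content_def top axial_dist_content ..
      ultimately have y: "young_mat lam m (?e R) (?e R') =
          1 / real_of_int (axial_dist (added_box lam mu) (box_of R m)) * id_matr J R R'" by simp
      have "Phi (adj_transp m) (lam, ?e R) R' = sqrt (real (num_tab lam) / real (d_L L)) * young_mat lam m (?e R) (?e R')"
        unfolding Phi_apply young_rep_adj_transp[OF L_partition[OF lam] mk] using lam True by simp
      then show "sqrt (real (num_tab lam) / real (d_L L)) * Phi (adj_transp m) (lam, ?e R) R' =
        real (num_tab lam) / real (d_L L) * (1 / real_of_int (axial_dist (added_box lam mu) (box_of R m))) * id_matr J R R'"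
        unfolding y by (simp only: mult.assoc[symmetric] sqrt_weight_square)
    qed
    then show ?thesis by (simp add: cross_val_def sum_distrib_right)
  next
    case False
    have "Cross \<in> mats J J" unfolding Cross_def
      using adj_in_mats[OF Psi_L_in_mats] Phi_isometry[OF permutes_adj_transp[OF mk]]
      by (auto simp only: isometry_def intro: matr_mult_in_mats)
    then show ?thesis using False by (auto simp: mats_def id_matr_def)
  qed
qed

lemma Cross_in_mats: "1 \<le> m \<Longrightarrow> Cross \<in> mats J J"
  by (auto simp: Cross_eq mats_def id_matr_def)

text \<open>The outer factors of the double coset decomposition commute past the adjoint of
  \<open>Psi_L\<close> and past \<open>Psi_L\<close>, where they become unitary matrices on
  \<open>J\<close>. Two different images of \<open>m + 1\<close> force
  \<open>1 \<le> m\<close>.\<close>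

lemma Phi_cross:
  assumes g: "g permutes {1..m + 1}" and g': "g' permutes {1..m + 1}" and ne: "g (m + 1) \<noteq> g' (m + 1)"
  obtains U V where "unitary_on J U" "unitary_on J V" "1 \<le> m"
    "matr_mult I (adj (Phi g)) (Phi g') = matr_mult J U (matr_mult J Cross V)"
proof -
  have p: "inv g \<circ> g' permutes {1..m + 1}" by (rule permutes_compose[OF g' permutes_inv[OF g]])
  have "(inv g \<circ> g') (m + 1) \<noteq> m + 1"
    using ne permutes_inverses(1)[OF g] by (metis comp_apply)
  then obtain a b where ab: "a permutes {1..m}" "b permutes {1..m}" "inv g \<circ> g' = a \<circ> (adj_transp m \<circ> b)" "1 \<le> m"
    using permutes_decompose_top_moved[OF p] by blast
  have s: "adj_transp m permutes {1..m + 1}" using ab(4) by (intro permutes_adj_transp) simp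
  have aS: "a permutes {1..m + 1}" and bS: "b permutes {1..m + 1}" using permutes_Suc ab by auto
  have "matr_mult I (adj (Psi_L L mu)) (pi_L L a) = adj (matr_mult I (pi_L L (inv a)) (Psi_L L mu))"
    using pi_inv[OF permutes_inv[OF aS]] permutes_inv_inv[OF aS] by (simp add: adj_matr_mult)
  also have "\<dots> = adj (matr_mult J (Psi_L L mu) (young_rep mu (inv a)))"
    using Phi_restrict[OF permutes_inv[OF ab(1)]] by (simp add: Phi_def)
  also have "\<dots> = matr_mult J (young_rep mu a) (adj (Psi_L L mu))"
    using young_rep_inv[OF mu permutes_inv[OF ab(1)]] permutes_inv_inv[OF ab(1)] by (simp add: adj_matr_mult)
  finally have left: "matr_mult I (adj (Psi_L L mu)) (pi_L L a) = matr_mult J (young_rep mu a) (adj (Psi_L L mu))" .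
  have "matr_mult I (adj (Phi g)) (Phi g') =
      matr_mult I (adj (Psi_L L mu)) (matr_mult I (pi_L L (inv g)) (Phi g'))"
    by (simp only: Phi_def[of g] adj_matr_mult pi_inv[OF g] matr_mult_assoc finite_I)
  also have "\<dots> = matr_mult I (adj (Psi_L L mu)) (Phi (a \<circ> (adj_transp m \<circ> b)))"
    by (simp only: pi_Phi[OF permutes_inv[OF g] g'] ab(3))
  also have "\<dots> = matr_mult I (matr_mult I (adj (Psi_L L mu)) (pi_L L a)) (matr_mult J (Phi (adj_transp m)) (young_rep mu b))"
    by (simp only: pi_Phi[OF aS permutes_compose[OF bS s], symmetric] Phi_comp_restrict[OF s ab(2)]
        matr_mult_assoc finite_I)
  also have "\<dots> = matr_mult J (young_rep mu a) (matr_mult J Cross (young_rep mu b))"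
    unfolding left Cross_def by (simp only: matr_mult_assoc finite_I finite_Tab)
  finally show thesis
    using that[OF young_rep_unitary[OF mu ab(1)] young_rep_unitary[OF mu ab(2)] ab(4)] by blast
qed

text \<open>The diagonal entries are indexed by the boxes of \<open>m\<close>, and these run through
  all removable boxes.\<close>

lemma Cross_isoclinic_iff:
  assumes "1 \<le> m"
  shows "matr_mult J (adj Cross) Cross = (\<lambda>R R'. \<alpha> * id_matr J R R') \<longleftrightarrow>
    (\<forall>b\<in>removable_boxes mu. (cross_val b)\<^sup>2 = \<alpha>)"
proof -
  have C: "matr_mult J (adj Cross) Cross R R' = (cross_val (box_of R m))\<^sup>2 * id_matr J R R'" for R R'
  proof -
    have "matr_mult J (adj Cross) Cross R R' =
       (\<Sum>S\<in>J. if S = R then (cross_val (box_of R m))\<^sup>2 * id_matr J R R' else 0)"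
      unfolding matr_mult_def adj_def Cross_eq[OF assms]
      by (intro sum.cong refl) (auto simp: id_matr_def power2_eq_square)
    then show ?thesis by (auto simp: id_matr_def)
  qed
  show ?thesis
  proof
    assume eq: "matr_mult J (adj Cross) Cross = (\<lambda>R R'. \<alpha> * id_matr J R R')"
    show "\<forall>b\<in>removable_boxes mu. (cross_val b)\<^sup>2 = \<alpha>"
    proof
      fix b assume "b \<in> removable_boxes mu"
      then obtain R where "R \<in> J" "box_of R m = b" using removable_box_of_top[OF mu] by blast
      then show "(cross_val b)\<^sup>2 = \<alpha>" using C[of R R] unfolding eq by (simp add: id_matr_def)
    qed
  next
    assume *: "\<forall>b\<in>removable_boxes mu. (cross_val b)\<^sup>2 = \<alpha>"
    have "(cross_val (box_of R m))\<^sup>2 * id_matr J R R' = \<alpha> * id_matr J R R'" for R R'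
      using * box_of_top_removable[OF mu assms, of R] by (auto simp: id_matr_def)
    then show "matr_mult J (adj Cross) Cross = (\<lambda>R R'. \<alpha> * id_matr J R R')"
      by (intro ext) (simp only: C)
  qed
qed

text \<open>Squaring absorbs the choice of sign; \<open>c\<close> converts between the two
  normalisations.\<close>

lemma beta_condition_iff:
  assumes "0 \<le> \<beta>"
  shows "beta_condition (m + 1) mu L \<beta> \<longleftrightarrow>
    (\<forall>b\<in>removable_boxes mu. (cross_val b)\<^sup>2 = (real (m + 1))\<^sup>2 * (real (num_tab mu))\<^sup>2 / (real (d_L L))\<^sup>2 * \<beta>\<^sup>2)"
proof -
  define c where "c = real (m + 1) * real (num_tab mu) / real (d_L L)"
  have c: "c > 0" using d_L_pos num_tab_pos[OF mu] by (simp add: c_def)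
  have "(\<Sum>lam\<in>L. real (num_tab lam) / (real (m + 1) * real (num_tab mu)) *
           (1 / real_of_int (axial_dist (added_box lam mu) b))) = cross_val b / c" for b
    unfolding cross_val_def sum_divide_distrib using d_L_pos num_tab_pos[OF mu]
    by (intro sum.cong refl) (simp add: c_def field_simps)
  moreover have "cross_val b / c \<in> {\<beta>, - \<beta>} \<longleftrightarrow> (cross_val b)\<^sup>2 = c\<^sup>2 * \<beta>\<^sup>2" for b
  proof -
    have "cross_val b / c \<in> {\<beta>, - \<beta>} \<longleftrightarrow> (cross_val b / c)\<^sup>2 = \<beta>\<^sup>2" by (simp add: power2_eq_iff)
    then show ?thesis using c by (simp add: power_divide field_simps)
  qed
  moreover have "c\<^sup>2 = (real (m + 1))\<^sup>2 * (real (num_tab mu))\<^sup>2 / (real (d_L L))\<^sup>2"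
    by (simp add: c_def power_divide power_mult_distrib)
  ultimately show ?thesis unfolding beta_condition_def by simp
qed

section \<open>The properties of the ensemble\<close>

lemma W_family_eq: "W_family L mu t = (\<lambda>k. matr_app J (Phi (t k)) ` vecs J)"
  by (simp add: W_family_def W_L_def Phi_def image_image matr_app_matr_mult finite_I fun_eq_iff)

text \<open>The unitary for \<tau> is \<open>pi_L L \<tau>\<close>, since
  \<open>\<tau> \<circ> t k\<close> and \<open>t (\<tau> k)\<close> lie in the same coset.\<close>

lemma totally_symmetric_W:
  assumes reps: "\<forall>k\<in>{1..m + 1}. t k permutes {1..m + 1} \<and> t k (m + 1) = k"
  shows "totally_symmetric I {1..m + 1} (W_family L mu t)"
  unfolding totally_symmetric_def
proof (intro allI impI)
  note t = bspec[OF reps]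
  fix \<tau> assume \<tau>: "\<tau> permutes {1..m + 1}"
  have "matr_app I (pi_L L \<tau>) ` W_family L mu t k = W_family L mu t (\<tau> k)" if k: "k \<in> {1..m + 1}" for k
  proof -
    have \<tau>k: "\<tau> k \<in> {1..m + 1}" using permutes_in_image[OF \<tau>] k by blast
    have "matr_app I (pi_L L \<tau>) ` W_family L mu t k = matr_app J (Phi (\<tau> \<circ> t k)) ` vecs J"
      using pi_Phi[OF \<tau>, of "t k"] t[OF k]
      by (simp add: W_family_eq image_image matr_app_matr_mult[OF finite_I finite_Tab, symmetric])
    also have "\<dots> = W_family L mu t (\<tau> k)"
      unfolding W_family_eq using t[OF k] t[OF \<tau>k]
      by (intro Phi_image_same_coset permutes_compose \<tau>) auto
    finally show ?thesis .
  qed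
  then show "\<exists>U. unitary_on I U \<and> (\<forall>k\<in>{1..m + 1}. matr_app I U ` W_family L mu t k = W_family L mu t (\<tau> k))"
    using pi_unitary[OF \<tau>] by blast
qed

lemma tight_W:
  assumes reps: "\<forall>k\<in>{1..m + 1}. t k permutes {1..m + 1} \<and> t k (m + 1) = k"
  shows "tight_fusion_frame I (num_tab mu) {1..m + 1} (W_family L mu t)"
proof -
  note t = bspec[OF reps]
  have "subspace_ensemble I (num_tab mu) {1..m + 1} (W_family L mu t)"
    unfolding W_family_eq num_tab_def using t
    by (intro subspace_ensemble_isometries finite_I finite_Tab Phi_isometry) blast
  moreover have "\<forall>k\<in>{1..m + 1}. orth_projection I (Proj (t k)) (W_family L mu t k)"
    unfolding W_family_eq using t Proj_orth by blast
  ultimately show ?thesis unfolding tight_fusion_frame_def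
    by (intro conjI exI[of _ "\<lambda>k. Proj (t k)"] exI[of _ "real (m + 1) * real (num_tab mu) / real (d_L L)"]
        sum_Proj reps)
qed

lemma equi_chordal_W:
  assumes reps: "\<forall>k\<in>{1..m + 1}. t k permutes {1..m + 1} \<and> t k (m + 1) = k"
  shows "equi_chordal I (num_tab mu) {1..m + 1} (W_family L mu t)"
  unfolding W_family_eq num_tab_def
proof (rule equi_chordal_isometries[OF finite_Tab])
  note t = bspec[OF reps]
  show "isometry I J (Phi (t k))" if "k \<in> {1..m + 1}" for k using Phi_isometry t[OF that] by blast
  fix k l assume "k \<in> {1..m + 1}" "l \<in> {1..m + 1}" "k \<noteq> l"
  then obtain U V where "unitary_on J U" "unitary_on J V" "1 \<le> m"
    "matr_mult I (adj (Phi (t k))) (Phi (t l)) = matr_mult J U (matr_mult J Cross V)"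
    using Phi_cross[of "t k" "t l"] t by metis
  then show "frobenius_norm J J (matr_mult I (adj (Phi (t k))) (Phi (t l))) = frobenius_norm J J Cross"
    using frobenius_norm_unitary[OF finite_Tab _ _ Cross_in_mats] by simp
qed

lemma Phi_cross_isoclinic_iff:
  assumes "g permutes {1..m + 1}" "g' permutes {1..m + 1}" "g (m + 1) \<noteq> g' (m + 1)"
  defines "X \<equiv> matr_mult I (adj (Phi g)) (Phi g')"
  shows "matr_mult J (adj X) X = (\<lambda>R R'. \<alpha> * id_matr J R R') \<longleftrightarrow> (\<forall>b\<in>removable_boxes mu. (cross_val b)\<^sup>2 = \<alpha>)"
proof -
  obtain U V where UV: "unitary_on J U" "unitary_on J V" "1 \<le> m"
    "X = matr_mult J U (matr_mult J Cross V)"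
    unfolding X_def using Phi_cross[OF assms(1-3)] .
  show ?thesis
    unfolding UV(4) isoclinic_unitary[OF finite_Tab UV(1,2) Cross_in_mats[OF UV(3)]]
    by (rule Cross_isoclinic_iff[OF UV(3)])
qed

text \<open>For \<open>m = 0\<close> there is a single subspace and every \<alpha> is a parameter;
  the guard \<open>1 \<le> m\<close> records this.\<close>

lemma equi_isoclinic_with_W_iff:
  assumes reps: "\<forall>k\<in>{1..m + 1}. t k permutes {1..m + 1} \<and> t k (m + 1) = k"
  shows "equi_isoclinic_with I (num_tab mu) {1..m + 1} (W_family L mu t) \<alpha> \<longleftrightarrow>
    (1 \<le> m \<longrightarrow> (\<forall>b\<in>removable_boxes mu. (cross_val b)\<^sup>2 = \<alpha>))"
proof -
  note t = bspec[OF reps]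
  have iso: "isometry I J (Phi (t k))" if "k \<in> {1..m + 1}" for k using Phi_isometry t[OF that] by blast
  define X where "X k l = matr_mult I (adj (Phi (t k))) (Phi (t l))" for k l
  have X: "matr_mult J (adj (X k l)) (X k l) = (\<lambda>R R'. \<alpha> * id_matr J R R') \<longleftrightarrow>
      (\<forall>b\<in>removable_boxes mu. (cross_val b)\<^sup>2 = \<alpha>)"
    if "k \<in> {1..m + 1}" "l \<in> {1..m + 1}" "k \<noteq> l" for k l
    unfolding X_def using t[OF that(1)] t[OF that(2)] that(3) by (intro Phi_cross_isoclinic_iff) auto
  have "equi_isoclinic_with I (num_tab mu) {1..m + 1} (W_family L mu t) \<alpha> \<longleftrightarrow>
    (\<forall>k\<in>{1..m + 1}. \<forall>l\<in>{1..m + 1}. k \<noteq> l \<longrightarrow>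
      matr_mult J (adj (X k l)) (X k l) = (\<lambda>R R'. \<alpha> * id_matr J R R'))"
    unfolding W_family_eq num_tab_def X_def
    by (rule equi_isoclinic_with_isometries[OF finite_I finite_Tab iso])
  also have "\<dots> \<longleftrightarrow> (1 \<le> m \<longrightarrow> (\<forall>b\<in>removable_boxes mu. (cross_val b)\<^sup>2 = \<alpha>))"
  proof
    assume *: "\<forall>k\<in>{1..m + 1}. \<forall>l\<in>{1..m + 1}. k \<noteq> l \<longrightarrow>
      matr_mult J (adj (X k l)) (X k l) = (\<lambda>R R'. \<alpha> * id_matr J R R')"
    show "1 \<le> m \<longrightarrow> (\<forall>b\<in>removable_boxes mu. (cross_val b)\<^sup>2 = \<alpha>)"
    proof
      assume "1 \<le> m"
      then have "1 \<in> {1..m + 1}" "2 \<in> {1..m + 1}" "(1::nat) \<noteq> 2" by auto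
      with * X show "\<forall>b\<in>removable_boxes mu. (cross_val b)\<^sup>2 = \<alpha>" by blast
    qed
  next
    assume *: "1 \<le> m \<longrightarrow> (\<forall>b\<in>removable_boxes mu. (cross_val b)\<^sup>2 = \<alpha>)"
    show "\<forall>k\<in>{1..m + 1}. \<forall>l\<in>{1..m + 1}. k \<noteq> l \<longrightarrow>
      matr_mult J (adj (X k l)) (X k l) = (\<lambda>R R'. \<alpha> * id_matr J R R')"
    proof (intro ballI impI)
      fix k l assume kl: "k \<in> {1..m + 1}" "l \<in> {1..m + 1}" "k \<noteq> l"
      then have "1 \<le> m" by auto
      with * show "matr_mult J (adj (X k l)) (X k l) = (\<lambda>R R'. \<alpha> * id_matr J R R')"
        unfolding X[OF kl] by blast
    qed
  qed
  finally show ?thesis .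
qed

text \<open>Sandwiching \<open>\<Sum>\<^sub>k P\<^sub>k = c I\<close> between \<open>\<Phi>\<^sub>l\<^sup>*\<close> and \<open>\<Phi>\<^sub>l\<close> gives \<open>1 + (n - 1) \<alpha> = c\<close>.\<close>

lemma isoclinic_parameter:
  assumes reps: "\<forall>k\<in>{1..m + 1}. t k permutes {1..m + 1} \<and> t k (m + 1) = k"
    and \<alpha>: "\<forall>b\<in>removable_boxes mu. (cross_val b)\<^sup>2 = \<alpha>"
  shows "1 + real m * \<alpha> = real (m + 1) * real (num_tab mu) / real (d_L L)"
proof -
  note t = bspec[OF reps]
  let ?c = "real (m + 1) * real (num_tab mu) / real (d_L L)" and ?l = "m + 1"
  have l: "?l \<in> {1..m + 1}" by simp
  obtain R where R: "R \<in> J" using Tab_nonempty[OF mu] by blast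
  have iso: "isometry I J (Phi (t k))" if "k \<in> {1..m + 1}" for k using Phi_isometry t[OF that] by blast
  \<comment> \<open>The term of \<open>?l\<close> itself is the square of an identity matrix; each
    of the other \<open>m\<close> terms contributes \<alpha> on the diagonal.\<close>
  have summand: "matr_mult I (adj (Phi (t ?l))) (matr_mult I (Proj (t k)) (Phi (t ?l))) R R = (if k = ?l then 1 else \<alpha>)"
    if k: "k \<in> {1..m + 1}" for k
  proof -
    define X where "X = matr_mult I (adj (Phi (t k))) (Phi (t ?l))"
    have "matr_mult I (adj (Phi (t ?l))) (matr_mult I (Proj (t k)) (Phi (t ?l))) = matr_mult J (adj X) X"
      unfolding X_def Proj_def adj_matr_mult adj_adj by (simp only: matr_mult_assoc finite_I finite_Tab)
    moreover have "matr_mult J (adj X) X R R = (if k = ?l then 1 else \<alpha>)"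
    proof (cases "k = ?l")
      case True
      then have "X = id_matr J" using iso[OF l] unfolding X_def isometry_def by simp
      then have "matr_mult J (adj X) X = id_matr J"
        using matr_mult_id_left[OF finite_Tab id_matr_in_mats] by simp
      then show ?thesis using True R by (simp add: id_matr_def)
    next
      case False
      then have "matr_mult J (adj X) X = (\<lambda>R R'. \<alpha> * id_matr J R R')"
        unfolding X_def using t[OF k] t[OF l] \<alpha> by (subst Phi_cross_isoclinic_iff) auto
      then show ?thesis using False R by (simp add: id_matr_def)
    qed
    ultimately show ?thesis by simp
  qed
  have "(\<Sum>k\<in>{1..m + 1}. matr_mult I (adj (Phi (t ?l))) (matr_mult I (Proj (t k)) (Phi (t ?l))) R R) =
    matr_mult I (adj (Phi (t ?l))) (matr_mult I (\<lambda>x y. \<Sum>k\<in>{1..m + 1}. Proj (t k) x y) (Phi (t ?l))) R R"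
    unfolding matr_mult_sum_left matr_mult_sum_right ..
  also have "\<dots> = ?c * matr_mult I (adj (Phi (t ?l))) (Phi (t ?l)) R R"
  proof -
    have "Phi (t ?l) \<in> mats I J" using iso[OF l] by (simp add: isometry_def)
    then show ?thesis unfolding sum_Proj[OF reps] matr_mult_scale_left matr_mult_scale_right
      by (simp only: matr_mult_id_left[OF finite_I])
  qed
  also have "\<dots> = ?c" using iso[OF l] R by (simp add: isometry_def id_matr_def)
  finally have "(\<Sum>k\<in>{1..m + 1}. if k = ?l then 1 else \<alpha>) = ?c" using summand by simp
  moreover have "(\<Sum>k\<in>{1..m + 1}. if k = ?l then 1 else \<alpha>) = 1 + real m * \<alpha>" by simp
  ultimately show ?thesis by simp
qed

end

theorem theorem6p1:
  fixes n :: nat and mu :: "nat list" and L :: "nat list set"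
    and t :: "nat \<Rightarrow> nat \<Rightarrow> nat"
  assumes "1 \<le> n"
    and "is_partition mu (n - 1)"
    and "L \<subseteq> up_set mu"
    and "L \<noteq> {}"
    and "\<And>k. k \<in> {1..n} \<Longrightarrow> t k permutes {1..n} \<and> t k n = k"
  shows "isometry (basis_L L) (Tab mu) (Psi_L L mu)
    \<and> fvec.dim (vecs (basis_L L)) = d_L L
    \<and> totally_symmetric (basis_L L) {1..n} (W_family L mu t)
    \<and> tight_fusion_frame (basis_L L) (num_tab mu) {1..n} (W_family L mu t)
    \<and> equi_chordal (basis_L L) (num_tab mu) {1..n} (W_family L mu t)
    \<and> (equi_isoclinic (basis_L L) (num_tab mu) {1..n} (W_family L mu t)
         \<longleftrightarrow> (\<exists>\<beta>\<ge>0. beta_condition n mu L \<beta>))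
    \<and> (\<forall>\<beta>\<ge>0. beta_condition n mu L \<beta> \<longrightarrow>
         equi_isoclinic_with (basis_L L) (num_tab mu) {1..n} (W_family L mu t)
           ((real n)\<^sup>2 * (real (num_tab mu))\<^sup>2 / (real (d_L L))\<^sup>2 * \<beta>\<^sup>2)
         \<and> (2 \<le> n \<longrightarrow>
              \<beta> = sqrt (real (d_L L) * (real n * real (num_tab mu) - real (d_L L)) /
                         ((real (num_tab mu))\<^sup>2 * (real n)\<^sup>2 * (real n - 1)))))"
proof -
  interpret young_frame "n - 1" mu L using assms by unfold_locales
  have n: "n - 1 + 1 = n" using assms(1) by simp
  have t: "\<forall>k\<in>{1..n}. t k permutes {1..n} \<and> t k n = k" using assms(5) by blast
  let ?d = "real (num_tab mu)" and ?D = "real (d_L L)"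
  have pos: "?d > 0" "?D > 0" "real n > 0" using num_tab_pos[OF mu] d_L_pos assms(1) by auto
  note ei = equi_isoclinic_with_W_iff[unfolded n, OF t]
  note bc = beta_condition_iff[unfolded n]
  have dir: "equi_isoclinic_with I (num_tab mu) {1..n} (W_family L mu t) ((real n)\<^sup>2 * ?d\<^sup>2 / ?D\<^sup>2 * \<beta>\<^sup>2)"
    if "0 \<le> \<beta>" "beta_condition n mu L \<beta>" for \<beta>
    using that bc[OF that(1)] ei by blast
  have iff: "equi_isoclinic I (num_tab mu) {1..n} (W_family L mu t) \<longleftrightarrow> (\<exists>\<beta>\<ge>0. beta_condition n mu L \<beta>)"
  proof
    assume "equi_isoclinic I (num_tab mu) {1..n} (W_family L mu t)"
    then obtain \<alpha> where \<alpha>: "1 \<le> n - 1 \<longrightarrow> (\<forall>b\<in>removable_boxes mu. (cross_val b)\<^sup>2 = \<alpha>)"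
      unfolding equi_isoclinic_def using ei by blast
    show "\<exists>\<beta>\<ge>0. beta_condition n mu L \<beta>"
    proof (cases "removable_boxes mu = {}")
      case True
      then show ?thesis by (intro exI[of _ 0]) (simp add: beta_condition_def)
    next
      case False
      then obtain b where b: "b \<in> removable_boxes mu" by blast
      \<comment> \<open>The existence of a removable box excludes the empty partition.\<close>
      have "1 \<le> n - 1"
      proof (rule ccontr)
        assume "\<not> 1 \<le> n - 1"
        then have "card (young_diagram mu) = 0"
          using mu by (simp add: card_young_diagram is_partition_def)
        then show False using b by (auto simp: removable_boxes_def)
      qed
      with \<alpha> have \<alpha>: "\<forall>b\<in>removable_boxes mu. (cross_val b)\<^sup>2 = \<alpha>" by blast
      then have "0 \<le> \<alpha>" using b zero_le_power2[of "cross_val b"] by simp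
      \<comment> \<open>The nonnegative solution of \<alpha> =
        \<open>(n d_\<mu> / d_L)\<^sup>2 \<beta>\<^sup>2\<close>.\<close>
      define \<beta> where "\<beta> = ?D / (real n * ?d) * sqrt \<alpha>"
      have "(real n)\<^sup>2 * ?d\<^sup>2 / ?D\<^sup>2 * \<beta>\<^sup>2 = \<alpha>"
        using pos \<open>0 \<le> \<alpha>\<close> by (simp add: \<beta>_def power_mult_distrib power_divide)
      moreover have "0 \<le> \<beta>" using pos \<open>0 \<le> \<alpha>\<close> by (simp add: \<beta>_def)
      ultimately show ?thesis using bc[of \<beta>] \<alpha> by auto
    qed
  next
    assume "\<exists>\<beta>\<ge>0. beta_condition n mu L \<beta>"
    then show "equi_isoclinic I (num_tab mu) {1..n} (W_family L mu t)"
      unfolding equi_isoclinic_def using dir by blast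
  qed
  \<comment> \<open>Tightness determines \<alpha> from
    \<open>1 + (n - 1) \<alpha> = n d_\<mu> / d_L\<close>. Solving divides by \<open>n - 1\<close>,
    hence \<open>2 \<le> n\<close>.\<close>
  have val: "\<beta> = sqrt (?D * (real n * ?d - ?D) / (?d\<^sup>2 * (real n)\<^sup>2 * (real n - 1)))"
    if "0 \<le> \<beta>" "beta_condition n mu L \<beta>" "2 \<le> n" for \<beta>
  proof -
    define \<alpha> where "\<alpha> = (real n)\<^sup>2 * ?d\<^sup>2 / ?D\<^sup>2 * \<beta>\<^sup>2"
    have "1 + real (n - 1) * \<alpha> = real n * ?d / ?D"
      using isoclinic_parameter[unfolded n, OF t, of \<alpha>] that(2) bc[OF that(1)] by (simp only: \<alpha>_def)
    moreover have n1: "real (n - 1) = real n - 1" "real n - 1 > 0" using that(3) by auto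
    ultimately have "(real n - 1) * \<alpha> = (real n * ?d - ?D) / ?D" using pos by (simp add: field_simps)
    then have a: "\<alpha> = (real n * ?d - ?D) / (?D * (real n - 1))" using n1 pos by (simp add: field_simps)
    have "\<beta>\<^sup>2 = \<alpha> * ?D\<^sup>2 / ((real n)\<^sup>2 * ?d\<^sup>2)" using pos by (simp add: \<alpha>_def)
    also have "\<dots> = ?D * (real n * ?d - ?D) / (?d\<^sup>2 * (real n)\<^sup>2 * (real n - 1))"
      unfolding a using pos n1 by (simp add: power2_eq_square divide_simps)
    finally show ?thesis using that(1) by (metis real_sqrt_unique)
  qed
  show ?thesis
    using Psi_L_isometry dim_vecs[OF finite_I] card_I totally_symmetric_W[unfolded n, OF t]
      tight_W[unfolded n, OF t] equi_chordal_W[unfolded n, OF t] iff dir val by simp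
qed

end
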